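(* Let $\mathcal{B}>0$ be the total privacy budget. For every (possibly adaptive) analyst, the interactive query-answering algorithm CacheDP described in the context, viewed as a randomized mechanism that takes the database $D$ as input and outputs the sequence of all responses returned to the analyst, satisfies $\mathcal{B}$-differential privacy.
   Context: **Differential privacy.** A database $D$ is a finite multiset of elements of a finite domain $\mathrm{dom}$ of size $n$; its data vector $x\in\mathbb{R}^n$ has $x[i]$ = multiplicity of the $i$-th domain value. $D,D'$ are neighbouring if $|D\setminus D'\cup D'\setminus D|=1$ (so data vectors differ by $1$ in exactly one coordinate). A randomized mechanism $M$ is $\epsilon$-DP if $\Pr[M(D)\in O]\le e^{\epsilon}\Pr[M(D')\in O]$ for all neighbouring $D,D'$ and all output sets $O$. $\mathrm{Lap}(b)$ is the centred Laplace distribution of scale $b$. For a matrix $M$, $\|M\|_1$ is the maximum over columns of the sum of absolute values; $M^+$ is the Moore–Penrose pseudoinverse. A matrix of queries is also regarded as the set of its rows. **Cache.** The global strategy $A^*$ is a fixed $0/1$ matrix whose rows are the indicator vectors of the nodes of a $k$-ary tree decomposition of $\mathrm{dom}$. The cache stores for each row $a\in A^*$ an entry $(a,b,\tilde y,t)$: latest noise parameter, latest noisy response, timestamp of the latest update (initially invalid, $t=0$). $\mathcal C$ denotes the set of valid entries. **Algorithm CacheDP.** Initialize $B_c=0$ and an empty cache. Repeatedly, the analyst (who may choose adaptively, depending on all previous responses) submits a workload, i.e. a $0/1$ matrix $\mathbb W$ with $n$ columns, with an accuracy requirement $(\alpha,\beta)$. 1. From $\mathbb W$ and $A^*$ only,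 a strategy $\mathbb A\subseteq A^*$ supporting $\mathbb W$ is chosen (minimal tree decompositions of the workload queries). A family of disjoint buckets of domain values, each query in $\mathbb A$ being a union of buckets, is used to rewrite $\mathbb W,\mathbb A,x$ over the buckets as $\mathbf W,\mathbf A,\mathbf x$, so that $\mathbb A x=\mathbf A\mathbf x$, $\mathbb Wx=\mathbf W\mathbf x$. 2. Privacy cost estimates, none of which access $D$, are computed: - *MMM* (Modified Matrix Mechanism): by searching over noise parameters, a value $b_P>0$ is chosen such that, with free rows $F$ = rows of $\mathbf A$ that are cached with noise parameter smaller than $b_P$, and paid rows $P=\mathbf A\setminus F$, answering with these noise parameters meets the accuracy requirement (checked by Monte Carlo simulation of the error, using only $\mathbf W,\mathbf A$ and noise parameters). The cost is $\epsilon=\|P\|_1/b_P$. - *RP* (Relax Privacy): let $b$ be the noise parameter that MMM would choose with an empty cache. Valid cache entries are grouped by timestamp into matrices $\mathbb A_j$ (all rows in a group share one noise parameter $b_j$). Candidates are groups with $\mathbb A_j\supseteq \mathbb A$ and $b<b_j$; if there is none, RP is unavailable. The cost is the minimum over candidates of $\|\mathbb A_j\|_1/b-\|\mathbb A_j\|_1/b_j$; let $\mathbb A_o$, with noise parameter $b_o$, be the minimizer. - *MMM with expanded strategy*: $\mathbb A$ is enlarged by further cached rows selected using only noise parameters and tree structure, and the MMM cost of the enlarged strategy is computed. The option with the smallest cost $\epsilon_i\ge 0$ is selected. 3. If $\epsilon_i+B_c\ge\mathcal B$, the workload is rejected. Otherwise the selected mechanism is run, its answer is returned, and $B_c\leftarrow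 B_c+\epsilon_i$. - *Running MMM*: optionally enlarge $P$ by additional uncached rows of $A^*$ (selected without access to $D$) that do not increase $\|P\|_1$; compute $\tilde y_P=P\mathbf x+\mathrm{Lap}(b_P)^{|P|}$ with fresh independent noise; store the responses with parameter $b_P$ and the current time in the cache; concatenate the cached responses for $F$ and the fresh responses for the other rows of $\mathbf A$ into $\tilde y$; return $\mathbf W\mathbf A^+\tilde y$. - *Running RP*: let $\eta_o=\tilde y_o-\mathbb A_o x$ be the old noise of the group. Draw the new noise $\eta$ coordinatewise, independently, using the noise-down kernel of Koufogiannis et al.: given old noise value $u$, sample from the conditional law of $V$ given $V+Z=u$, where $V\sim\mathrm{Lap}(b)$ and $Z$ is independent of $V$, equal to $0$ with probability $(b/b_o)^2$ and distributed as $\mathrm{Lap}(b_o)$ otherwise (so that $V+Z\sim\mathrm{Lap}(b_o)$). Set $\tilde y=\mathbb A_o x+\eta$, store it in the cache with parameter $b$ and the current time, and return $\mathbf W\mathbf A^+\tilde y'$, where $\tilde y'$ is the restriction of $\tilde y$ to the rows of $\mathbb A$. *)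

theory Defs
  imports "HOL-Probability.Probability" "HOL-Library.Disjoint_Sets" "Jordan_Normal_Form.Matrix"
begin

section \<open>Databases and differential privacy\<close>

text \<open>The domain is a finite type \<open>'d\<close>, so that its size is \<open>n = CARD('d)\<close>. The indices of the
  vectors and matrices below refer to an arbitrary but fixed enumeration of the domain.\<close>

definition enum_set :: "'a set \<Rightarrow> 'a list" where
  "enum_set A = (SOME xs. distinct xs \<and> set xs = A)"

definition data_vec :: "'d::finite multiset \<Rightarrow> real vec" where
  "data_vec D = vec CARD('d) (\<lambda>i. real (count D (enum_set UNIV ! i)))"

definition neighbouring :: "'d multiset \<Rightarrow> 'd multiset \<Rightarrow> bool" where
  "neighbouring D D' \<longleftrightarrow> size ((D - D') \<union># (D' - D)) = 1"

text \<open>A randomized mechanism maps a database to a probability measure on the output space \<open>N\<close>; that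
  it does so is part of the definition.\<close>

definition differentially_private ::
  "real \<Rightarrow> 'b measure \<Rightarrow> ('d multiset \<Rightarrow> 'b measure) \<Rightarrow> bool" where
  "differentially_private \<epsilon> N M \<longleftrightarrow>
     (\<forall>D. M D \<in> space (prob_algebra N)) \<and>
     (\<forall>D D'. neighbouring D D' \<longrightarrow>
        (\<forall>X\<in>sets N. measure (M D) X \<le> exp \<epsilon> * measure (M D') X))"


section \<open>Laplace noise and the noise-down kernel\<close>

definition laplace_density :: "real \<Rightarrow> real \<Rightarrow> real" where
  "laplace_density b v = exp (- \<bar>v\<bar> / b) / (2 * b)"

definition laplace :: "real \<Rightarrow> real measure" where
  "laplace b = density lborel (\<lambda>v. ennreal (laplace_density b v))"

definition laplace_gap :: "real \<Rightarrow> real \<Rightarrow> real measure" where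
  "laplace_gap b b\<^sub>o = do {
     z \<leftarrow> measure_pmf (bernoulli_pmf ((b / b\<^sub>o)\<^sup>2));
     if z then return borel 0 else laplace b\<^sub>o }"

text \<open>For \<open>V\<close> distributed as \<open>laplace b\<close> and an independent \<open>Z\<close> distributed as \<open>laplace_gap b b\<^sub>o\<close>,
  this is Bayes' formula for the law of \<open>V\<close> given \<open>V + Z = u\<close>; see \<open>noise_down_conditional_law\<close>
  below. A conditional law is in general determined only for almost every \<open>u\<close>, and that would not be
  enough here: the analyst picks the noise parameters after having seen responses and could steer
  the algorithm into the exceptional null sets. The kernel meant is this one, continuous in \<open>u\<close>.\<close>

definition noise_down :: "real \<Rightarrow> real \<Rightarrow> real \<Rightarrow> real measure" where
  "noise_down b b\<^sub>o u = measure_of UNIV (sets borel) (\<lambda>X.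
     ennreal ((b / b\<^sub>o)\<^sup>2 * laplace_density b u / laplace_density b\<^sub>o u) * indicator X u +
     (\<integral>\<^sup>+v\<in>X. ennreal ((1 - (b / b\<^sub>o)\<^sup>2) * laplace_density b v * laplace_density b\<^sub>o (u - v)
        / laplace_density b\<^sub>o u) \<partial>lborel))"

lemma laplace_density_nonneg: "0 < b \<Longrightarrow> 0 \<le> laplace_density b v"
  by (simp add: laplace_density_def)

lemma laplace_density_pos: "0 < b \<Longrightarrow> 0 < laplace_density b v"
  by (simp add: laplace_density_def)

lemma laplace_density_measurable [measurable]: "laplace_density b \<in> borel_measurable borel"
  unfolding laplace_density_def by measurable

lemma nn_integral_exp_atLeast:
  assumes s: "0 < (s::real)" and K: "0 \<le> K"
  shows "(\<integral>\<^sup>+v. ennreal (K * exp (- s * v)) * indicator {a..} v \<partial>lborel) = ennreal (K * exp (- s * a) / s)"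
proof -
  have "((\<lambda>v. - (K / s) * exp (- s * v)) \<longlongrightarrow> - (K / s) * 0) at_top"
    using s by (intro tendsto_mult tendsto_const) real_asymp
  then have "(\<integral>\<^sup>+v. ennreal (K * exp (- s * v)) * indicator {a..} v \<partial>lborel)
      = ennreal (- (K / s) * 0 - (- (K / s) * exp (- s * a)))"
    using s K by (intro nn_integral_FTC_atLeast) (auto intro!: derivative_eq_intros)
  then show ?thesis by simp
qed

lemma nn_integral_laplace_conv_nonneg:
  assumes b: "0 < b" "b < b\<^sub>o" and u: "0 \<le> u"
  shows "(\<integral>\<^sup>+v. ennreal ((1 - (b / b\<^sub>o)\<^sup>2) * laplace_density b v * laplace_density b\<^sub>o (u - v)) \<partial>lborel)
     = ennreal (laplace_density b\<^sub>o u - (b / b\<^sub>o)\<^sup>2 * laplace_density b u)"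
proof -
  define p q where "p = 1 / b" and "q = 1 / b\<^sub>o"
  have pq: "0 < q" "q < p" using b by (auto simp: p_def q_def field_simps)
  have ld: "laplace_density b v = p / 2 * exp (- p * \<bar>v\<bar>)" "laplace_density b\<^sub>o v = q / 2 * exp (- q * \<bar>v\<bar>)" for v
    by (auto simp: laplace_density_def p_def q_def)
  have c: "b / b\<^sub>o = q / p" using b by (auto simp: p_def q_def)
  have dq: "- (x * (q - p) * y / (p - q)) = y * x" for x y
  proof -
    have "x * (q - p) * y = - (y * x) * (p - q)" by (simp add: algebra_simps)
    then show ?thesis using pq by simp
  qed
  define K where "K = (1 - (q / p)\<^sup>2) * (p / 2) * (q / 2)"
  have K: "0 \<le> K" using pq by (auto simp: K_def power2_eq_square field_simps intro!: mult_mono)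
  define f where "f v = K * (exp (- p * \<bar>v\<bar>) * exp (- q * \<bar>u - v\<bar>))" for v
  have f_meas[measurable]: "f \<in> borel_measurable borel" unfolding f_def by measurable
  have f_nn: "0 \<le> f v" for v using K by (simp add: f_def)
  have "AE v in lborel. ennreal (f v) = ennreal (f v) * indicator {..0} v
       + ennreal (f v) * indicator {0..u} v + ennreal (f v) * indicator {u..} v"
    using AE_lborel_singleton[of 0] AE_lborel_singleton[of u]
    by eventually_elim (use u in \<open>auto split: split_indicator\<close>)
  then have "(\<integral>\<^sup>+v. f v \<partial>lborel) = (\<integral>\<^sup>+v. ennreal (f v) * indicator {..0} v
       + ennreal (f v) * indicator {0..u} v + ennreal (f v) * indicator {u..} v \<partial>lborel)"
    by (rule nn_integral_cong_AE)
  also have "\<dots> = (\<integral>\<^sup>+v. ennreal (f v) * indicator {..0} v \<partial>lborel)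
       + (\<integral>\<^sup>+v. ennreal (f v) * indicator {0..u} v \<partial>lborel)
       + (\<integral>\<^sup>+v. ennreal (f v) * indicator {u..} v \<partial>lborel)"
    by (simp add: nn_integral_add)
  also have "(\<integral>\<^sup>+v. ennreal (f v) * indicator {..0} v \<partial>lborel)
      = ennreal (K / (p + q) * exp (- q * u))"
  proof -
    have "(\<integral>\<^sup>+v. ennreal (f v) * indicator {..0} v \<partial>lborel)
        = (\<integral>\<^sup>+v. ennreal (f (- v)) * indicator {0..} v \<partial>lborel)"
      by (subst nn_integral_real_affine[where c="-1" and t=0])
         (auto intro!: nn_integral_cong split: split_indicator)
    also have "\<dots> = (\<integral>\<^sup>+v. ennreal (K * exp (- q * u) * exp (- (p + q) * v)) * indicator {0..} v \<partial>lborel)"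
      using u by (intro nn_integral_cong)
        (auto simp: f_def algebra_simps exp_add[symmetric] exp_diff[symmetric] split: split_indicator)
    also have "\<dots> = ennreal (K * exp (- q * u) * exp (- (p + q) * 0) / (p + q))"
      using pq K by (intro nn_integral_exp_atLeast) auto
    finally show ?thesis by simp
  qed
  also have "(\<integral>\<^sup>+v. ennreal (f v) * indicator {u..} v \<partial>lborel)
      = ennreal (K / (p + q) * exp (- p * u))"
  proof -
    have "(\<integral>\<^sup>+v. ennreal (f v) * indicator {u..} v \<partial>lborel)
        = (\<integral>\<^sup>+v. ennreal (K * exp (q * u) * exp (- (p + q) * v)) * indicator {u..} v \<partial>lborel)"
      using u by (intro nn_integral_cong)
        (auto simp: f_def algebra_simps exp_add[symmetric] exp_diff[symmetric] split: split_indicator)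
    also have "\<dots> = ennreal (K * exp (q * u) * exp (- (p + q) * u) / (p + q))"
      using pq K by (intro nn_integral_exp_atLeast) auto
    also have "K * exp (q * u) * exp (- (p + q) * u) / (p + q) = K / (p + q) * exp (- p * u)"
    proof -
      have "exp (q * u) * exp (- (p + q) * u) = exp (- p * u)"
        unfolding exp_add[symmetric] by (simp add: algebra_simps)
      then show ?thesis by simp
    qed
    finally show ?thesis .
  qed
  also have "(\<integral>\<^sup>+v. ennreal (f v) * indicator {0..u} v \<partial>lborel)
      = ennreal (K / (p - q) * (exp (- q * u) - exp (- p * u)))"
  proof -
    have "(\<integral>\<^sup>+v. ennreal (f v) * indicator {0..u} v \<partial>lborel)
        = (\<integral>\<^sup>+v. ennreal (K * exp (- q * u) * exp (- (p - q) * v)) * indicator {0..u} v \<partial>lborel)"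
      using u by (intro nn_integral_cong)
        (auto simp: f_def algebra_simps exp_add[symmetric] exp_diff[symmetric] split: split_indicator)
    also have "\<dots> = ennreal ((- (K / (p - q)) * exp (- q * u) * exp (- (p - q) * u))
         - (- (K / (p - q)) * exp (- q * u) * exp (- (p - q) * 0)))"
      using pq K u by (intro nn_integral_FTC_Icc) (auto intro!: derivative_eq_intros simp: dq)
    also have "(- (K / (p - q)) * exp (- q * u) * exp (- (p - q) * u))
         - (- (K / (p - q)) * exp (- q * u) * exp (- (p - q) * 0))
       = K / (p - q) * (exp (- q * u) - exp (- p * u))"
    proof -
      have "exp (- q * u) * exp (- (p - q) * u) = exp (- p * u)"
        unfolding exp_add[symmetric] by (simp add: algebra_simps)
      then show ?thesis by (simp add: right_diff_distrib)
    qed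
    finally show ?thesis .
  qed
  also have "ennreal (K / (p + q) * exp (- q * u)) + ennreal (K / (p - q) * (exp (- q * u) - exp (- p * u)))
      + ennreal (K / (p + q) * exp (- p * u))
    = ennreal (K / (p + q) * exp (- q * u) + K / (p - q) * (exp (- q * u) - exp (- p * u))
      + K / (p + q) * exp (- p * u))"
  proof -
    have "exp (- p * u) \<le> exp (- q * u)" using pq u by (auto intro: mult_right_mono)
    then have "0 \<le> K / (p - q) * (exp (- q * u) - exp (- p * u))"
      using pq K by (intro mult_nonneg_nonneg) auto
    then show ?thesis using pq K by (simp add: ennreal_plus)
  qed
  also have "K / (p + q) * exp (- q * u) + K / (p - q) * (exp (- q * u) - exp (- p * u))
      + K / (p + q) * exp (- p * u) = laplace_density b\<^sub>o u - (b / b\<^sub>o)\<^sup>2 * laplace_density b u"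
  proof -
    have nz: "p \<noteq> 0" "p + q \<noteq> 0" "p - q \<noteq> 0" using pq by auto
    have "K = (p + q) * (p - q) * (q / (4 * p))"
      using nz by (simp add: K_def field_simps power2_eq_square)
    then have "K / (p + q) = (p - q) * (q / (4 * p))" "K / (p - q) = (p + q) * (q / (4 * p))"
      using nz by auto
    moreover have "(p - q) * (q / (4 * p)) * X + (p + q) * (q / (4 * p)) * (X - Y) + (p - q) * (q / (4 * p)) * Y
        = q / 2 * X - (q / p)\<^sup>2 * (p / 2 * Y)" for X Y
      using nz(1) by (simp add: divide_simps power2_eq_square) (simp add: algebra_simps)
    ultimately show ?thesis using u unfolding c ld by simp
  qed
  finally have "(\<integral>\<^sup>+v. f v \<partial>lborel) = ennreal (laplace_density b\<^sub>o u - (b / b\<^sub>o)\<^sup>2 * laplace_density b u)" .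
  moreover have "(1 - (b / b\<^sub>o)\<^sup>2) * laplace_density b v * laplace_density b\<^sub>o (u - v) = f v" for v
    unfolding f_def K_def c ld by simp
  ultimately show ?thesis by simp
qed

lemma laplace_density_minus [simp]: "laplace_density b (- v) = laplace_density b v"
  by (simp add: laplace_density_def)

lemma nn_integral_laplace_conv:
  assumes b: "0 < b" "b < b\<^sub>o"
  shows "(\<integral>\<^sup>+v. ennreal ((1 - (b / b\<^sub>o)\<^sup>2) * laplace_density b v * laplace_density b\<^sub>o (u - v)) \<partial>lborel)
     = ennreal (laplace_density b\<^sub>o u - (b / b\<^sub>o)\<^sup>2 * laplace_density b u)"
proof (cases "0 \<le> u")
  case False
  have "(\<integral>\<^sup>+v. ennreal ((1 - (b / b\<^sub>o)\<^sup>2) * laplace_density b v * laplace_density b\<^sub>o (u - v)) \<partial>lborel)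
    = (\<integral>\<^sup>+v. ennreal ((1 - (b / b\<^sub>o)\<^sup>2) * laplace_density b v * laplace_density b\<^sub>o (- u - v)) \<partial>lborel)"
    using laplace_density_minus[of b\<^sub>o "u + _"]
    by (subst nn_integral_real_affine[where c="-1" and t=0]) (auto intro!: nn_integral_cong)
  also have "\<dots> = ennreal (laplace_density b\<^sub>o (-u) - (b / b\<^sub>o)\<^sup>2 * laplace_density b (-u))"
    using False b by (intro nn_integral_laplace_conv_nonneg) auto
  finally show ?thesis by simp
qed (use nn_integral_laplace_conv_nonneg b in auto)

lemma laplace_gap_density_le:
  assumes b: "0 < b" "b < b\<^sub>o"
  shows "(b / b\<^sub>o)\<^sup>2 * laplace_density b u \<le> laplace_density b\<^sub>o u"
proof -
  have "exp (- \<bar>u\<bar> / b) \<le> exp (- \<bar>u\<bar> / b\<^sub>o)" using b by (auto simp: frac_le)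
  moreover have "(b / b\<^sub>o)\<^sup>2 / (2 * b) \<le> 1 / (2 * b\<^sub>o)"
    using b by (auto simp: power2_eq_square field_simps)
  ultimately have "(b / b\<^sub>o)\<^sup>2 / (2 * b) * exp (- \<bar>u\<bar> / b) \<le> 1 / (2 * b\<^sub>o) * exp (- \<bar>u\<bar> / b\<^sub>o)"
    using b by (intro mult_mono) auto
  then show ?thesis by (simp add: laplace_density_def)
qed

lemma sets_laplace [measurable_cong]: "sets (laplace b) = sets borel"
  by (simp add: laplace_def)

lemma prob_space_laplace:
  assumes b: "0 < b"
  shows "prob_space (laplace b)"
proof
  define p where "p = 1 / b"
  have p: "0 < p" using b by (simp add: p_def)
  have ld: "laplace_density b v = p / 2 * exp (- p * \<bar>v\<bar>)" for v
    by (auto simp: laplace_density_def p_def)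
  have "AE v in lborel. ennreal (laplace_density b v) = ennreal (laplace_density b v) * indicator {..0} v
       + ennreal (laplace_density b v) * indicator {0..} v"
    using AE_lborel_singleton[of 0] by eventually_elim (auto split: split_indicator)
  then have "(\<integral>\<^sup>+v. laplace_density b v \<partial>lborel) = (\<integral>\<^sup>+v. ennreal (laplace_density b v) * indicator {..0} v
       + ennreal (laplace_density b v) * indicator {0..} v \<partial>lborel)"
    by (rule nn_integral_cong_AE)
  also have "\<dots> = (\<integral>\<^sup>+v. ennreal (laplace_density b v) * indicator {..0} v \<partial>lborel)
       + (\<integral>\<^sup>+v. ennreal (laplace_density b v) * indicator {0..} v \<partial>lborel)"
    by (simp add: nn_integral_add)
  also have "(\<integral>\<^sup>+v. ennreal (laplace_density b v) * indicator {..0} v \<partial>lborel)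
      = (\<integral>\<^sup>+v. ennreal (laplace_density b v) * indicator {0..} v \<partial>lborel)"
    by (subst nn_integral_real_affine[where c="-1" and t=0])
       (auto intro!: nn_integral_cong split: split_indicator)
  also have "(\<integral>\<^sup>+v. ennreal (laplace_density b v) * indicator {0..} v \<partial>lborel)
      = (\<integral>\<^sup>+v. ennreal (p / 2 * exp (- p * v)) * indicator {0..} v \<partial>lborel)"
    by (intro nn_integral_cong) (auto simp: ld split: split_indicator)
  also have "\<dots> = ennreal (p / 2 * exp (- p * 0) / p)"
    using p by (intro nn_integral_exp_atLeast) auto
  also have "p / 2 * exp (- p * 0) / p = 1 / 2" using p by simp
  also have "ennreal (1 / 2) + ennreal (1 / 2) = 1" by (subst ennreal_plus[symmetric]) auto
  finally show "emeasure (laplace b) (space (laplace b)) = 1"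
    by (simp add: laplace_def emeasure_density cong: nn_integral_cong)
qed

lemma sets_noise_down [measurable_cong, simp]: "sets (noise_down b b\<^sub>o u) = sets borel"
proof -
  have "sets (noise_down b b\<^sub>o u) = sigma_sets UNIV (sets borel)"
    unfolding noise_down_def by (rule sets_measure_of) simp
  then show ?thesis using sets.sigma_sets_eq[of borel] by simp
qed

lemma space_noise_down [simp]: "space (noise_down b b\<^sub>o u) = UNIV"
  using sets_eq_imp_space_eq[OF sets_noise_down] by simp

lemma emeasure_noise_down:
  assumes X: "X \<in> sets borel"
  shows "emeasure (noise_down b b\<^sub>o u) X =
     ennreal ((b / b\<^sub>o)\<^sup>2 * laplace_density b u / laplace_density b\<^sub>o u) * indicator X u +
     (\<integral>\<^sup>+v\<in>X. ennreal ((1 - (b / b\<^sub>o)\<^sup>2) * laplace_density b v * laplace_density b\<^sub>o (u - v)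
        / laplace_density b\<^sub>o u) \<partial>lborel)"
proof (rule emeasure_measure_of[OF noise_down_def])
  define g where "g v = ennreal ((1 - (b / b\<^sub>o)\<^sup>2) * laplace_density b v * laplace_density b\<^sub>o (u - v)
        / laplace_density b\<^sub>o u)" for v
  have [measurable]: "g \<in> borel_measurable borel" unfolding g_def by measurable
  define k where "k = ennreal ((b / b\<^sub>o)\<^sup>2 * laplace_density b u / laplace_density b\<^sub>o u)"
  have "countably_additive (sets borel) (\<lambda>X. k * indicator X u + (\<integral>\<^sup>+v\<in>X. g v \<partial>lborel))"
    unfolding countably_additive_def
  proof safe
    fix A :: "nat \<Rightarrow> real set" assume A: "range A \<subseteq> sets borel" "disjoint_family A"
    then have [measurable]: "A i \<in> sets borel" for i by auto
    have dens: "(\<integral>\<^sup>+v\<in>X. g v \<partial>lborel) = emeasure (density lborel g) X"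
      and ret: "indicator X u = emeasure (return borel u) X" if "X \<in> sets borel" for X
      using that by (auto simp: emeasure_density)
    have "(\<Sum>i. k * indicator (A i) u + (\<integral>\<^sup>+v\<in>A i. g v \<partial>lborel))
       = (\<Sum>i. k * emeasure (return borel u) (A i) + emeasure (density lborel g) (A i))"
      by (simp only: dens ret \<open>\<And>i. A i \<in> sets borel\<close>)
    also have "\<dots> = k * emeasure (return borel u) (\<Union> (range A)) + emeasure (density lborel g) (\<Union> (range A))"
      using A by (subst suminf_add[symmetric]) (auto simp: suminf_emeasure simp del: emeasure_return)
    also have "\<dots> = k * indicator (\<Union> (range A)) u + (\<integral>\<^sup>+v\<in>\<Union> (range A). g v \<partial>lborel)"
      by (subst dens) auto
    finally show "(\<Sum>i. k * indicator (A i) u + (\<integral>\<^sup>+v\<in>A i. g v \<partial>lborel))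
       = k * indicator (\<Union> (range A)) u + (\<integral>\<^sup>+v\<in>\<Union> (range A). g v \<partial>lborel)" .
  qed
  then show "countably_additive (sets (noise_down b b\<^sub>o u)) (\<lambda>X.
     ennreal ((b / b\<^sub>o)\<^sup>2 * laplace_density b u / laplace_density b\<^sub>o u) * indicator X u +
     (\<integral>\<^sup>+v\<in>X. ennreal ((1 - (b / b\<^sub>o)\<^sup>2) * laplace_density b v * laplace_density b\<^sub>o (u - v)
        / laplace_density b\<^sub>o u) \<partial>lborel))"
    by (simp add: g_def k_def)
qed (use X in \<open>auto simp: positive_def\<close>)

lemma prob_space_noise_down:
  assumes b: "0 < b" "b < b\<^sub>o"
  shows "prob_space (noise_down b b\<^sub>o u)"
proof
  note pos = laplace_density_pos[of b] laplace_density_pos[of b\<^sub>o]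
  have nn: "0 \<le> (1 - (b / b\<^sub>o)\<^sup>2) * laplace_density b v * laplace_density b\<^sub>o (u - v)" for v
    using b pos[of v] pos(2)[of "u - v"] by (auto simp: power_le_one intro!: mult_nonneg_nonneg)
  have "(\<integral>\<^sup>+v. ennreal ((1 - (b / b\<^sub>o)\<^sup>2) * laplace_density b v * laplace_density b\<^sub>o (u - v)
        / laplace_density b\<^sub>o u) \<partial>lborel)
     = (\<integral>\<^sup>+v. ennreal ((1 - (b / b\<^sub>o)\<^sup>2) * laplace_density b v * laplace_density b\<^sub>o (u - v)) \<partial>lborel)
        / laplace_density b\<^sub>o u"
    using b pos by (subst nn_integral_divide[symmetric])
      (auto intro!: nn_integral_cong simp: divide_ennreal nn)
  also have "\<dots> = ennreal ((laplace_density b\<^sub>o u - (b / b\<^sub>o)\<^sup>2 * laplace_density b u) / laplace_density b\<^sub>o u)"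
    using b pos laplace_gap_density_le[OF b] unfolding nn_integral_laplace_conv[OF b]
    by (intro divide_ennreal) auto
  finally have *: "(\<integral>\<^sup>+v. ennreal ((1 - (b / b\<^sub>o)\<^sup>2) * laplace_density b v * laplace_density b\<^sub>o (u - v)
        / laplace_density b\<^sub>o u) \<partial>lborel)
     = ennreal ((laplace_density b\<^sub>o u - (b / b\<^sub>o)\<^sup>2 * laplace_density b u) / laplace_density b\<^sub>o u)" .
  show "emeasure (noise_down b b\<^sub>o u) (space (noise_down b b\<^sub>o u)) = 1"
    using b pos(1)[of u] pos(2)[of u] laplace_gap_density_le[OF b, of u]
    by (simp add: emeasure_noise_down *) (simp flip: ennreal_plus add_divide_distrib)
qed


lemma measurable_noise_down [measurable]:
  assumes b: "0 < b" "b < b\<^sub>o"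
  shows "noise_down b b\<^sub>o \<in> borel \<rightarrow>\<^sub>M prob_algebra borel"
proof (rule measurable_prob_algebraI)
  show "noise_down b b\<^sub>o \<in> borel \<rightarrow>\<^sub>M subprob_algebra borel"
  proof (rule measurable_subprob_algebra)
    fix X :: "real set" assume [measurable]: "X \<in> sets borel"
    show "(\<lambda>u. emeasure (noise_down b b\<^sub>o u) X) \<in> borel_measurable borel"
      by (simp add: emeasure_noise_down) measurable
  qed (auto intro!: prob_space_imp_subprob_space prob_space_noise_down b)
qed (rule prob_space_noise_down[OF b])

lemma laplace_gap_space:
  assumes b: "0 < b" "b < b\<^sub>o"
  shows "laplace_gap b b\<^sub>o \<in> space (prob_algebra borel)"
proof -
  have "(\<lambda>z. if z then return borel 0 else laplace b\<^sub>o) \<in> count_space UNIV \<rightarrow>\<^sub>M prob_algebra borel"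
    using b by (auto simp: space_prob_algebra sets_laplace intro!: prob_space_return prob_space_laplace split: if_splits)
  moreover have "measure_pmf (bernoulli_pmf ((b / b\<^sub>o)\<^sup>2)) \<in> space (prob_algebra (count_space UNIV))"
    by (simp add: space_prob_algebra measure_pmf.prob_space_axioms)
  ultimately show ?thesis
    using sets_bind' prob_space_bind' unfolding laplace_gap_def space_prob_algebra[of borel] by blast
qed

lemma nn_integral_laplace_gap:
  assumes b: "0 < b" "b < b\<^sub>o" and [measurable]: "f \<in> borel_measurable borel"
  shows "(\<integral>\<^sup>+z. f z \<partial>laplace_gap b b\<^sub>o) = ennreal ((b / b\<^sub>o)\<^sup>2) * f 0
    + ennreal (1 - (b / b\<^sub>o)\<^sup>2) * (\<integral>\<^sup>+z. ennreal (laplace_density b\<^sub>o z) * f z \<partial>lborel)"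
proof -
  have c: "0 \<le> (b / b\<^sub>o)\<^sup>2" "(b / b\<^sub>o)\<^sup>2 \<le> 1" using b by (auto simp: power_le_one)
  have "(\<lambda>z. if z then return borel 0 else laplace b\<^sub>o) \<in> count_space UNIV \<rightarrow>\<^sub>M subprob_algebra borel"
    using b by (auto simp: space_subprob_algebra sets_laplace
      intro!: prob_space_imp_subprob_space prob_space_return prob_space_laplace split: if_splits)
  then have "(\<integral>\<^sup>+z. f z \<partial>laplace_gap b b\<^sub>o)
     = (\<integral>\<^sup>+z. (\<integral>\<^sup>+x. f x \<partial>(if z then return borel 0 else laplace b\<^sub>o)) \<partial>measure_pmf (bernoulli_pmf ((b / b\<^sub>o)\<^sup>2)))"
    unfolding laplace_gap_def by (intro nn_integral_bind[where B=borel]) (auto cong: measurable_cong_sets)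
  also have "\<dots> = ennreal ((b / b\<^sub>o)\<^sup>2) * f 0 + ennreal (1 - (b / b\<^sub>o)\<^sup>2) * (\<integral>\<^sup>+z. f z \<partial>laplace b\<^sub>o)"
    using c by (simp add: nn_integral_return mult.commute)
  finally show ?thesis by (simp add: laplace_def nn_integral_density)
qed

theorem noise_down_conditional_law:
  assumes b: "0 < b" "b < b\<^sub>o"
  shows "do { v \<leftarrow> laplace b; z \<leftarrow> laplace_gap b b\<^sub>o; return (borel \<Otimes>\<^sub>M borel) (v + z, v) }
       = do { u \<leftarrow> laplace b\<^sub>o; v \<leftarrow> noise_down b b\<^sub>o u; return (borel \<Otimes>\<^sub>M borel) (u, v) }"
    (is "?L = ?R")
proof (rule measure_eqI)
  have c: "0 \<le> (b / b\<^sub>o)\<^sup>2" "(b / b\<^sub>o)\<^sup>2 \<le> 1" using b by (auto simp: power_le_one)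
  have b': "0 < b\<^sub>o" using b by simp
  note pos = laplace_density_pos[OF b(1)] laplace_density_pos[OF b']
  note nn = laplace_density_nonneg[OF b(1)] laplace_density_nonneg[OF b']
  have lap: "laplace b \<in> space (prob_algebra borel)" "laplace b\<^sub>o \<in> space (prob_algebra borel)"
    using b by (auto simp: space_prob_algebra sets_laplace prob_space_laplace)
  have gap: "laplace_gap b b\<^sub>o \<in> space (prob_algebra borel)"
    by (rule laplace_gap_space[OF b])
  have [measurable]: "(\<lambda>_::real. laplace_gap b b\<^sub>o) \<in> borel \<rightarrow>\<^sub>M prob_algebra borel"
    using gap by simp
  note [measurable] = measurable_noise_down[OF b]
  have kL [measurable]: "(\<lambda>v. laplace_gap b b\<^sub>o \<bind> (\<lambda>z. return (borel \<Otimes>\<^sub>M borel) (v + z, v)))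
      \<in> borel \<rightarrow>\<^sub>M prob_algebra (borel \<Otimes>\<^sub>M borel)"
    by (rule measurable_bind_prob_space2[where N=borel]) measurable
  have kR [measurable]: "(\<lambda>u. noise_down b b\<^sub>o u \<bind> (\<lambda>v. return (borel \<Otimes>\<^sub>M borel) (u, v)))
      \<in> borel \<rightarrow>\<^sub>M prob_algebra (borel \<Otimes>\<^sub>M borel)"
    by (rule measurable_bind_prob_space2[where N=borel]) measurable
  have sL: "sets ?L = sets (borel \<Otimes>\<^sub>M borel)"
    by (rule sets_bind'[OF lap(1) kL])
  have sR: "sets ?R = sets (borel \<Otimes>\<^sub>M borel)"
    by (rule sets_bind'[OF lap(2) kR])
  show "sets ?L = sets ?R" using sL sR by simp
  fix X assume "X \<in> sets ?L"
  then have X[measurable]: "X \<in> sets (borel \<Otimes>\<^sub>M borel)" using sL by simp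
  have gapE: "emeasure (laplace_gap b b\<^sub>o \<bind> (\<lambda>z. return (borel \<Otimes>\<^sub>M borel) (v + z, v))) X
     = ennreal ((b / b\<^sub>o)\<^sup>2) * indicator X (v, v)
       + ennreal (1 - (b / b\<^sub>o)\<^sup>2) * (\<integral>\<^sup>+u. ennreal (laplace_density b\<^sub>o (u - v)) * indicator X (u, v) \<partial>lborel)" for v
  proof -
    have "emeasure (laplace_gap b b\<^sub>o \<bind> (\<lambda>z. return (borel \<Otimes>\<^sub>M borel) (v + z, v))) X
      = (\<integral>\<^sup>+z. indicator X (v + z, v) \<partial>laplace_gap b b\<^sub>o)"
      by (subst emeasure_bind_prob_algebra[OF gap, where L="borel \<Otimes>\<^sub>M borel"]) auto
    also have "\<dots> = ennreal ((b / b\<^sub>o)\<^sup>2) * indicator X (v, v)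
       + ennreal (1 - (b / b\<^sub>o)\<^sup>2) * (\<integral>\<^sup>+z. ennreal (laplace_density b\<^sub>o z) * indicator X (v + z, v) \<partial>lborel)"
      by (subst nn_integral_laplace_gap[OF b]) auto
    also have "(\<integral>\<^sup>+z. ennreal (laplace_density b\<^sub>o z) * indicator X (v + z, v) \<partial>lborel)
      = (\<integral>\<^sup>+u. ennreal (laplace_density b\<^sub>o (u - v)) * indicator X (u, v) \<partial>lborel)"
      by (subst nn_integral_real_affine[where c=1 and t="-v"]) (auto simp: algebra_simps)
    finally show ?thesis .
  qed
  have downE: "ennreal (laplace_density b\<^sub>o u) *
        emeasure (noise_down b b\<^sub>o u \<bind> (\<lambda>v. return (borel \<Otimes>\<^sub>M borel) (u, v))) X
     = ennreal ((b / b\<^sub>o)\<^sup>2 * laplace_density b u) * indicator X (u, u)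
       + (\<integral>\<^sup>+v. ennreal (1 - (b / b\<^sub>o)\<^sup>2) * ennreal (laplace_density b v)
            * (ennreal (laplace_density b\<^sub>o (u - v)) * indicator X (u, v)) \<partial>lborel)" for u
  proof -
    have nd: "noise_down b b\<^sub>o u \<in> space (prob_algebra borel)"
      by (simp add: space_prob_algebra prob_space_noise_down b)
    have "emeasure (noise_down b b\<^sub>o u \<bind> (\<lambda>v. return (borel \<Otimes>\<^sub>M borel) (u, v))) X
      = (\<integral>\<^sup>+v. indicator X (u, v) \<partial>noise_down b b\<^sub>o u)"
      by (subst emeasure_bind_prob_algebra[OF nd, where L="borel \<Otimes>\<^sub>M borel"]) auto
    also have "\<dots> = (\<integral>\<^sup>+v. indicator (Pair u -` X) v \<partial>noise_down b b\<^sub>o u)"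
      by (intro nn_integral_cong) (auto split: split_indicator)
    also have "\<dots> = emeasure (noise_down b b\<^sub>o u) (Pair u -` X)"
      using sets_Pair1[OF X] by (subst nn_integral_indicator) auto
    also have "\<dots> = ennreal ((b / b\<^sub>o)\<^sup>2 * laplace_density b u / laplace_density b\<^sub>o u) * indicator X (u, u) +
     (\<integral>\<^sup>+v. ennreal ((1 - (b / b\<^sub>o)\<^sup>2) * laplace_density b v * laplace_density b\<^sub>o (u - v)
        / laplace_density b\<^sub>o u) * indicator X (u, v) \<partial>lborel)"
      using sets_Pair1[OF X]
      by (subst emeasure_noise_down) (auto intro!: arg_cong2[where f="(+)"] nn_integral_cong split: split_indicator)
    finally have main: "ennreal (laplace_density b\<^sub>o u) *
        emeasure (noise_down b b\<^sub>o u \<bind> (\<lambda>v. return (borel \<Otimes>\<^sub>M borel) (u, v))) X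
      = ennreal (laplace_density b\<^sub>o u) * ennreal ((b / b\<^sub>o)\<^sup>2 * laplace_density b u / laplace_density b\<^sub>o u) * indicator X (u, u) +
     (\<integral>\<^sup>+v. ennreal (laplace_density b\<^sub>o u) * (ennreal ((1 - (b / b\<^sub>o)\<^sup>2) * laplace_density b v * laplace_density b\<^sub>o (u - v)
        / laplace_density b\<^sub>o u) * indicator X (u, v)) \<partial>lborel)"
      by (simp add: distrib_left mult.assoc nn_integral_cmult)
    have e1: "ennreal (laplace_density b\<^sub>o u) * ennreal ((b / b\<^sub>o)\<^sup>2 * laplace_density b u / laplace_density b\<^sub>o u)
       = ennreal ((b / b\<^sub>o)\<^sup>2 * laplace_density b u)"
      using pos(2)[of u] nn(1)[of u] by (subst ennreal_mult[symmetric]) auto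
    have e2: "ennreal (laplace_density b\<^sub>o u) * (ennreal ((1 - (b / b\<^sub>o)\<^sup>2) * laplace_density b v * laplace_density b\<^sub>o (u - v)
        / laplace_density b\<^sub>o u) * indicator X (u, v))
       = ennreal (1 - (b / b\<^sub>o)\<^sup>2) * ennreal (laplace_density b v)
            * (ennreal (laplace_density b\<^sub>o (u - v)) * indicator X (u, v))" for v
    proof -
      have "ennreal (laplace_density b\<^sub>o u) * ennreal ((1 - (b / b\<^sub>o)\<^sup>2) * laplace_density b v * laplace_density b\<^sub>o (u - v)
        / laplace_density b\<^sub>o u) = ennreal (1 - (b / b\<^sub>o)\<^sup>2) * ennreal (laplace_density b v)
            * ennreal (laplace_density b\<^sub>o (u - v))"
        using pos(2)[of u] nn(1)[of v] nn(2)[of "u - v"] c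
        by (subst ennreal_mult[symmetric] | simp)+
      then show ?thesis by (simp add: mult.assoc[symmetric])
    qed
    show ?thesis using main by (simp only: e1 e2)
  qed
  have "emeasure ?L X = (\<integral>\<^sup>+v. ennreal (laplace_density b v) * (ennreal ((b / b\<^sub>o)\<^sup>2) * indicator X (v, v)
       + ennreal (1 - (b / b\<^sub>o)\<^sup>2) * (\<integral>\<^sup>+u. ennreal (laplace_density b\<^sub>o (u - v)) * indicator X (u, v) \<partial>lborel)) \<partial>lborel)"
    by (subst emeasure_bind_prob_algebra[OF lap(1) kL X])
       (simp add: gapE laplace_def nn_integral_density)
  also have "\<dots> = (\<integral>\<^sup>+v. ennreal ((b / b\<^sub>o)\<^sup>2 * laplace_density b v) * indicator X (v, v) \<partial>lborel)
     + (\<integral>\<^sup>+v. \<integral>\<^sup>+u. ennreal (1 - (b / b\<^sub>o)\<^sup>2) * ennreal (laplace_density b v)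
            * (ennreal (laplace_density b\<^sub>o (u - v)) * indicator X (u, v)) \<partial>lborel \<partial>lborel)"
    using c nn(1)
    by (subst nn_integral_add[symmetric])
       (auto simp: distrib_left nn_integral_cmult[symmetric] ennreal_mult mult_ac intro!: nn_integral_cong)
  also have "(\<integral>\<^sup>+v. \<integral>\<^sup>+u. ennreal (1 - (b / b\<^sub>o)\<^sup>2) * ennreal (laplace_density b v)
            * (ennreal (laplace_density b\<^sub>o (u - v)) * indicator X (u, v)) \<partial>lborel \<partial>lborel)
    = (\<integral>\<^sup>+u. \<integral>\<^sup>+v. ennreal (1 - (b / b\<^sub>o)\<^sup>2) * ennreal (laplace_density b v)
            * (ennreal (laplace_density b\<^sub>o (u - v)) * indicator X (u, v)) \<partial>lborel \<partial>lborel)"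
    by (rule lborel_pair.Fubini') measurable
  also have "(\<integral>\<^sup>+v. ennreal ((b / b\<^sub>o)\<^sup>2 * laplace_density b v) * indicator X (v, v) \<partial>lborel) + \<dots>
    = (\<integral>\<^sup>+u. ennreal (laplace_density b\<^sub>o u) *
        emeasure (noise_down b b\<^sub>o u \<bind> (\<lambda>v. return (borel \<Otimes>\<^sub>M borel) (u, v))) X \<partial>lborel)"
    unfolding downE by (subst nn_integral_add) measurable
  also have "\<dots> = emeasure ?R X"
  proof -
    have "(\<lambda>u. emeasure (noise_down b b\<^sub>o u \<bind> (\<lambda>v. return (borel \<Otimes>\<^sub>M borel) (u, v))) X) \<in> borel_measurable borel"
      using measurable_emeasure_subprob_algebra[OF X] measurable_prob_algebraD[OF kR]
      by (rule measurable_compose[rotated])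
    then show ?thesis
      by (subst emeasure_bind_prob_algebra[OF lap(2) kR X]) (simp add: laplace_def nn_integral_density)
  qed
  finally show "emeasure ?L X = emeasure ?R X" .
qed


section \<open>Queries, strategies and matrices\<close>

text \<open>A 0/1 row with \<open>n\<close> columns is encoded by its support, a set of domain values. A workload is the
  list of its rows, a strategy the set of its rows.\<close>

type_synonym 'd workload = "'d set list"

definition row_vec :: "'d::finite set \<Rightarrow> real vec" where
  "row_vec a = vec CARD('d) (\<lambda>i. of_bool (enum_set UNIV ! i \<in> a))"

definition row_mat :: "'d::finite set set \<Rightarrow> real mat" where
  "row_mat R = mat_of_rows CARD('d) (map row_vec (enum_set R))"

text \<open>The matrix of a list of rows, rewritten over a list of buckets. Every row is a union of buckets
  wherever this is used.\<close>

definition bucket_mat :: "'d set list \<Rightarrow> 'd set list \<Rightarrow> real mat" where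
  "bucket_mat R Bs = mat (length R) (length Bs) (\<lambda>(i, j). of_bool (Bs ! j \<subseteq> R ! i))"

definition bucket_family :: "'d set set \<Rightarrow> 'd set list \<Rightarrow> bool" where
  "bucket_family R Bs \<longleftrightarrow> distinct Bs \<and> {} \<notin> set Bs \<and> disjoint (set Bs) \<and>
     (\<forall>a\<in>R. \<exists>\<B> \<subseteq> set Bs. a = \<Union>\<B>)"

definition norm1_mat :: "real mat \<Rightarrow> real" where
  "norm1_mat M = Max (insert 0 ((\<lambda>j. \<Sum>i<dim_row M. \<bar>M $$ (i, j)\<bar>) ` {..<dim_col M}))"

definition pinv_mat :: "real mat \<Rightarrow> real mat" where
  "pinv_mat M = (THE X. X \<in> carrier_mat (dim_col M) (dim_row M) \<and>
     M * X * M = M \<and> X * M * X = X \<and>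
     transpose_mat (M * X) = M * X \<and> transpose_mat (X * M) = X * M)"

text \<open>\<open>kary_tree k A T\<close>: \<open>T\<close> is the set of nodes of a tree with root \<open>A\<close> and singleton leaves, whose
  inner nodes are partitioned by their children, at most \<open>k\<close> in number.\<close>

inductive kary_tree :: "nat \<Rightarrow> 'd set \<Rightarrow> 'd set set \<Rightarrow> bool" for k where
  leaf: "kary_tree k {v} {{v}}"
| node: "\<lbrakk>partition_on A C; 2 \<le> card C; card C \<le> k; \<forall>c\<in>C. kary_tree k c (T c)\<rbrakk>
           \<Longrightarrow> kary_tree k A (insert A (\<Union>c\<in>C. T c))"

definition tree_decomposition :: "'d set set \<Rightarrow> 'd set \<Rightarrow> 'd set set" where
  "tree_decomposition T w = arg_min card (\<lambda>C. C \<subseteq> T \<and> disjoint C \<and> \<Union>C = w)"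

definition strategy :: "'d set set \<Rightarrow> 'd workload \<Rightarrow> 'd set set" where
  "strategy T W = (\<Union>w\<in>set W. tree_decomposition T w)"


section \<open>Cache, requests and responses\<close>

text \<open>A cache holds for every row the latest noise parameter, the latest noisy response and the time
  of the latest update, which is \<open>0\<close> if the entry is not valid. Its public part, on which
  data-independent decisions are based, omits the noisy responses.\<close>

type_synonym 'd cache = "'d set \<Rightarrow> real \<times> real \<times> nat"
type_synonym 'd cache_table = "'d set \<Rightarrow> real \<times> nat"

definition cache_space :: "'d::finite cache measure" where
  "cache_space = (\<Pi>\<^sub>M a\<in>UNIV. borel \<Otimes>\<^sub>M borel \<Otimes>\<^sub>M count_space UNIV)"

definition table_space :: "'d::finite cache_table measure" where
  "table_space = (\<Pi>\<^sub>M a\<in>UNIV. borel \<Otimes>\<^sub>M count_space UNIV)"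

definition empty_cache :: "'d cache" where
  "empty_cache = (\<lambda>a. (0, 0, 0))"

definition cached_response :: "'d cache \<Rightarrow> 'd set \<Rightarrow> real" where
  "cached_response c a = fst (snd (c a))"

definition cache_table :: "'d cache \<Rightarrow> 'd cache_table" where
  "cache_table c = (\<lambda>a. (fst (c a), snd (snd (c a))))"

abbreviation noise_param :: "'d cache_table \<Rightarrow> 'd set \<Rightarrow> real" where
  "noise_param tab a \<equiv> fst (tab a)"

abbreviation timestamp :: "'d cache_table \<Rightarrow> 'd set \<Rightarrow> nat" where
  "timestamp tab a \<equiv> snd (tab a)"

definition update_cache :: "'d cache \<Rightarrow> 'd set set \<Rightarrow> real \<Rightarrow> ('d set \<Rightarrow> real) \<Rightarrow> nat \<Rightarrow> 'd cache" where
  "update_cache c R b y t = (\<lambda>a. if a \<in> R then (b, y a, t) else c a)"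

text \<open>A request is a workload together with \<open>\<alpha>\<close> and \<open>\<beta>\<close>. A response is either \<open>(None, _)\<close>, a
  rejection, or \<open>(Some m, v)\<close>, the vector of length \<open>m\<close> whose entries are those of \<open>v\<close>, which is padded
  with zeros.\<close>

type_synonym 'd request = "'d workload \<times> real \<times> real"
type_synonym response = "nat option \<times> (nat \<Rightarrow> real)"

definition request_space :: "'d::finite request measure" where
  "request_space = count_space UNIV \<Otimes>\<^sub>M borel \<Otimes>\<^sub>M borel"

definition response_space :: "response measure" where
  "response_space = count_space UNIV \<Otimes>\<^sub>M (\<Pi>\<^sub>M i\<in>UNIV. borel)"

definition rejection :: response where
  "rejection = (None, \<lambda>_. 0)"


section \<open>The algorithm\<close>

datatype mechanism = MMM | RP | Expanded_MMM

text \<open>The components of CacheDP that are left open by its description. None of them has access to the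
  database; as far as they depend on the state of the algorithm, it is through the public part of
  the cache.

  \<^item> \<open>search\<close> is the search for the noise parameter of MMM for a given workload, strategy, accuracy
    requirement and cache. It is a randomized procedure, since it relies on Monte Carlo simulation.
    It is deliberately not constrained by how it explores the parameters and tests the accuracy: the
    claim is made for every such procedure.
  \<^item> \<open>expand\<close> selects the cached rows that are added for the expanded strategy, \<open>extra\<close> the uncached
    rows that MMM additionally answers. Both may be empty.
  \<^item> \<open>pick_group\<close> and \<open>pick_mechanism\<close> choose minimizers of the cost; they only serve to leave the
    resolution of ties open.\<close>

record 'd cachedp =
  arity :: nat
  global_strategy :: "'d set set"
  buckets :: "'d workload \<Rightarrow> 'd set set \<Rightarrow> 'd set list"
  search :: "'d workload \<Rightarrow> 'd set set \<Rightarrow> real \<Rightarrow> real \<Rightarrow> 'd cache_table \<Rightarrow> real measure"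
  expand :: "'d workload \<Rightarrow> 'd set set \<Rightarrow> real \<Rightarrow> 'd cache_table \<Rightarrow> 'd set set"
  extra :: "'d workload \<Rightarrow> 'd set set \<Rightarrow> real \<Rightarrow> 'd cache_table \<Rightarrow> 'd set set"
  pick_group :: "'d set set \<Rightarrow> real \<Rightarrow> 'd cache_table \<Rightarrow> nat"
  pick_mechanism :: "(mechanism \<Rightarrow> ereal) \<Rightarrow> mechanism"

definition valid_rows :: "'d cachedp \<Rightarrow> 'd cache_table \<Rightarrow> 'd set set" where
  "valid_rows S tab = {a \<in> global_strategy S. 0 < timestamp tab a}"

definition free_rows :: "'d cachedp \<Rightarrow> 'd set set \<Rightarrow> real \<Rightarrow> 'd cache_table \<Rightarrow> 'd set set" where
  "free_rows S R b tab = {a \<in> R \<inter> valid_rows S tab. noise_param tab a < b}"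

definition paid_rows :: "'d cachedp \<Rightarrow> 'd set set \<Rightarrow> real \<Rightarrow> 'd cache_table \<Rightarrow> 'd set set" where
  "paid_rows S R b tab = R - free_rows S R b tab"

definition mmm_cost ::
  "'d cachedp \<Rightarrow> 'd workload \<Rightarrow> 'd set set \<Rightarrow> real \<Rightarrow> 'd cache_table \<Rightarrow> real" where
  "mmm_cost S W R b tab =
     norm1_mat (bucket_mat (enum_set (paid_rows S R b tab)) (buckets S W R)) / b"

definition group_rows :: "'d cachedp \<Rightarrow> 'd cache_table \<Rightarrow> nat \<Rightarrow> 'd set set" where
  "group_rows S tab j = {a \<in> valid_rows S tab. timestamp tab a = j}"

text \<open>All rows of a group have the same noise parameter, because every round stores at most one noise
  parameter.\<close>

definition group_noise :: "'d cachedp \<Rightarrow> 'd cache_table \<Rightarrow> nat \<Rightarrow> real" where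
  "group_noise S tab j = noise_param tab (SOME a. a \<in> group_rows S tab j)"

definition rp_candidates :: "'d cachedp \<Rightarrow> 'd set set \<Rightarrow> real \<Rightarrow> 'd cache_table \<Rightarrow> nat set" where
  "rp_candidates S R b tab =
     {j. group_rows S tab j \<noteq> {} \<and> R \<subseteq> group_rows S tab j \<and> b < group_noise S tab j}"

definition rp_cost :: "'d::finite cachedp \<Rightarrow> real \<Rightarrow> 'd cache_table \<Rightarrow> nat \<Rightarrow> real" where
  "rp_cost S b tab j =
     norm1_mat (row_mat (group_rows S tab j)) / b
     - norm1_mat (row_mat (group_rows S tab j)) / group_noise S tab j"

definition positive_reals :: "real measure" where
  "positive_reals = restrict_space borel {0<..}"

definition valid_cachedp :: "'d::finite cachedp \<Rightarrow> bool" where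
  "valid_cachedp S \<longleftrightarrow>
     kary_tree (arity S) UNIV (global_strategy S) \<and>
     (\<forall>W R. R \<subseteq> global_strategy S \<longrightarrow> bucket_family R (buckets S W R)) \<and>
     (\<forall>W R. (\<lambda>(\<alpha>, \<beta>, tab). search S W R \<alpha> \<beta> tab)
        \<in> borel \<Otimes>\<^sub>M borel \<Otimes>\<^sub>M table_space \<rightarrow>\<^sub>M prob_algebra positive_reals) \<and>
     (\<forall>W R. (\<lambda>(b, tab). expand S W R b tab)
        \<in> positive_reals \<Otimes>\<^sub>M table_space \<rightarrow>\<^sub>M count_space UNIV) \<and>
     (\<forall>W R b tab. expand S W R b tab \<subseteq> valid_rows S tab) \<and>
     (\<forall>W R. (\<lambda>(b, tab). extra S W R b tab)
        \<in> positive_reals \<Otimes>\<^sub>M table_space \<rightarrow>\<^sub>M count_space UNIV) \<and>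
     (\<forall>W R b tab. extra S W R b tab \<subseteq> global_strategy S - valid_rows S tab \<and>
        norm1_mat (row_mat (paid_rows S R b tab \<union> extra S W R b tab))
          \<le> norm1_mat (row_mat (paid_rows S R b tab))) \<and>
     (\<forall>R. (\<lambda>(b, tab). pick_group S R b tab)
        \<in> positive_reals \<Otimes>\<^sub>M table_space \<rightarrow>\<^sub>M count_space UNIV) \<and>
     (\<forall>R b tab. rp_candidates S R b tab \<noteq> {} \<longrightarrow>
        is_arg_min (rp_cost S b tab) (\<lambda>j. j \<in> rp_candidates S R b tab) (pick_group S R b tab)) \<and>
     pick_mechanism S \<in> (\<Pi>\<^sub>M m\<in>UNIV. borel) \<rightarrow>\<^sub>M count_space UNIV \<and>
     (\<forall>cost. is_arg_min cost (\<lambda>m. True) (pick_mechanism S cost))"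

text \<open>The response computed from noisy answers \<open>y\<close> to the rows of the strategy \<open>R\<close>.\<close>

definition answer :: "'d cachedp \<Rightarrow> 'd workload \<Rightarrow> 'd set set \<Rightarrow> ('d set \<Rightarrow> real) \<Rightarrow> response" where
  "answer S W R y =
     (let Bs = buckets S W R; rs = enum_set R;
          v = bucket_mat W Bs * pinv_mat (bucket_mat rs Bs)
                *\<^sub>v vec (length rs) (\<lambda>i. y (rs ! i))
      in (Some (length W), \<lambda>i. if i < length W then v $ i else 0))"

definition run_mmm :: "'d::finite cachedp \<Rightarrow> 'd multiset \<Rightarrow> nat \<Rightarrow> 'd workload \<Rightarrow> 'd set set \<Rightarrow> real
    \<Rightarrow> 'd cache \<Rightarrow> (response \<times> 'd cache) measure" where
  "run_mmm S D t W R b c = (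
     let F = free_rows S R b (cache_table c);
         P = paid_rows S R b (cache_table c) \<union> extra S W R b (cache_table c)
     in do {
       \<eta> \<leftarrow> (\<Pi>\<^sub>M a\<in>P. laplace b);
       let y = (\<lambda>a. scalar_prod (row_vec a) (data_vec D) + \<eta> a);
       return (response_space \<Otimes>\<^sub>M cache_space)
         (answer S W R (\<lambda>a. if a \<in> F then cached_response c a else y a),
          update_cache c P b y t) })"

definition run_rp :: "'d::finite cachedp \<Rightarrow> 'd multiset \<Rightarrow> nat \<Rightarrow> 'd workload \<Rightarrow> 'd set set \<Rightarrow> real
    \<Rightarrow> 'd cache \<Rightarrow> (response \<times> 'd cache) measure" where
  "run_rp S D t W R b c = (
     let j = pick_group S R b (cache_table c);
         A\<^sub>o = group_rows S (cache_table c) j;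
         b\<^sub>o = group_noise S (cache_table c) j;
         \<eta>\<^sub>o = (\<lambda>a. cached_response c a - scalar_prod (row_vec a) (data_vec D))
     in do {
       \<eta> \<leftarrow> (\<Pi>\<^sub>M a\<in>A\<^sub>o. noise_down b b\<^sub>o (\<eta>\<^sub>o a));
       let y = (\<lambda>a. scalar_prod (row_vec a) (data_vec D) + \<eta> a);
       return (response_space \<Otimes>\<^sub>M cache_space) (answer S W R y, update_cache c A\<^sub>o b y t) })"

text \<open>One round: the request, its response, and the cache and the consumed budget afterwards.\<close>

type_synonym 'd round = "'d request \<times> response \<times> 'd cache \<times> real"

definition round_space :: "'d::finite round measure" where
  "round_space = request_space \<Otimes>\<^sub>M response_space \<Otimes>\<^sub>M cache_space \<Otimes>\<^sub>M borel"

definition serve :: "'d::finite cachedp \<Rightarrow> real \<Rightarrow> 'd multiset \<Rightarrow> nat \<Rightarrow> 'd request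
    \<Rightarrow> 'd cache \<Rightarrow> real \<Rightarrow> 'd round measure" where
  "serve S \<B> D t req c B\<^sub>c = (
     let (W, \<alpha>, \<beta>) = req; tab = cache_table c; R = strategy (global_strategy S) W
     in do {
       b \<leftarrow> search S W R \<alpha> \<beta> tab;
       b\<^sub>r \<leftarrow> search S W R \<alpha> \<beta> (cache_table empty_cache);
       let R\<^sub>e = R \<union> expand S W R b tab;
       b\<^sub>e \<leftarrow> search S W R\<^sub>e \<alpha> \<beta> tab;
       let cost = (\<lambda>m. case m of
             MMM \<Rightarrow> ereal (mmm_cost S W R b tab)
           | RP \<Rightarrow> if rp_candidates S R b\<^sub>r tab = {} then \<infinity>
                   else ereal (rp_cost S b\<^sub>r tab (pick_group S R b\<^sub>r tab))
           | Expanded_MMM \<Rightarrow> ereal (mmm_cost S W R\<^sub>e b\<^sub>e tab));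
       let m = pick_mechanism S cost;
       let \<epsilon> = real_of_ereal (cost m);
       if \<epsilon> + B\<^sub>c \<ge> \<B> then return round_space (req, rejection, c, B\<^sub>c)
       else do {
         (resp, c') \<leftarrow> (case m of
             MMM \<Rightarrow> run_mmm S D t W R b c
           | RP \<Rightarrow> run_rp S D t W R b\<^sub>r c
           | Expanded_MMM \<Rightarrow> run_mmm S D t W R\<^sub>e b\<^sub>e c);
         return round_space (req, resp, c', B\<^sub>c + \<epsilon>) } })"


section \<open>The interaction\<close>

text \<open>An analyst may be randomized and chooses the request of round \<open>i\<close> depending on the requests and
  responses of all previous rounds.\<close>

type_synonym 'd analyst = "nat \<Rightarrow> (nat \<Rightarrow> 'd request \<times> response) \<Rightarrow> 'd request measure"

definition valid_analyst :: "'d::finite analyst \<Rightarrow> bool" where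
  "valid_analyst An \<longleftrightarrow> (\<forall>i. An i \<in>
     (\<Pi>\<^sub>M j\<in>{0..<i}. request_space \<Otimes>\<^sub>M response_space) \<rightarrow>\<^sub>M prob_algebra request_space)"

definition round_kernel :: "'d::finite cachedp \<Rightarrow> real \<Rightarrow> 'd analyst \<Rightarrow> 'd multiset
    \<Rightarrow> nat \<Rightarrow> (nat \<Rightarrow> 'd round) \<Rightarrow> 'd round measure" where
  "round_kernel S \<B> An D i \<omega> = (
     let (c, B\<^sub>c) = (if i = 0 then (empty_cache, 0) else snd (snd (\<omega> (i - 1))))
     in do {
       req \<leftarrow> An i (\<lambda>j\<in>{0..<i}. case \<omega> j of (req, resp, _) \<Rightarrow> (req, resp));
       serve S \<B> D (Suc i) req c B\<^sub>c })"

text \<open>The law of the infinite sequence of rounds, by the theorem of Ionescu-Tulcea.\<close>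

definition interaction :: "'d::finite cachedp \<Rightarrow> real \<Rightarrow> 'd analyst \<Rightarrow> 'd multiset
    \<Rightarrow> (nat \<Rightarrow> 'd round) measure" where
  "interaction S \<B> An D = projective_family.lim UNIV
     (Ionescu_Tulcea.CI (round_kernel S \<B> An D) (\<lambda>_. round_space)) (\<lambda>_. round_space)"

definition transcript_space :: "(nat \<Rightarrow> response) measure" where
  "transcript_space = (\<Pi>\<^sub>M i\<in>UNIV. response_space)"

definition CacheDP :: "'d::finite cachedp \<Rightarrow> real \<Rightarrow> 'd analyst \<Rightarrow> 'd multiset
    \<Rightarrow> (nat \<Rightarrow> response) measure" where
  "CacheDP S \<B> An D =
     distr (interaction S \<B> An D) transcript_space (\<lambda>\<omega> i. fst (snd (\<omega> i)))"

end

theory Submission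
  imports Defs
begin

text \<open>The noisy responses are tracked through a potential. For a value \<open>v\<close> in which \<open>D\<close> and \<open>D'\<close> differ,
  a cached response with noise parameter \<open>b\<close> to a row containing \<open>v\<close> contributes a likelihood ratio of
  at most \<open>exp (1 / b)\<close>; its slack is the distance of the logarithm of that ratio from \<open>1 / b\<close>. The
  potential is \<open>exp (B\<^sub>c - \<Sigma> slack)\<close>, summed over the cache, and it bounds the likelihood ratio of the
  whole interaction so far. A fresh response replaces an old one whose slack is simply
  dropped, and adds a new \<open>1 / b\<close>, which is paid for by the cost of MMM. For RP a bound on the ratio of
  the noise-down kernels alone would be too weak: conditionally on the old response it can exceed
  \<open>exp (1 / b - 1 / b\<^sub>o)\<close>. But it equals the ratio of the new densities divided by that of the old ones,
  and the latter is exactly what the slack of the old response remembers, so that the product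
  telescopes. As \<open>B\<^sub>c\<close> never exceeds \<open>\<B>\<close>, neither does the logarithm of the potential.\<close>

section \<open>Domination of measures by a reweighted measure\<close>

text \<open>The comparison concerns complete rounds, caches included, although only the responses
  are published: cached values steer later rounds and RP resamples them, so a bound on the responses
  alone could not be iterated. The weights stand inside the integrals because the potential after a
  round is random. The potential before a round is the factor \<open>k\<close> on the left, the one
  after it the weight \<open>h\<close> on the right, so consecutive rounds compose by cancelling the
  weight they share, and no kernel has to be private on its own. Densities are taken of a kernel
  under \<open>D\<close> relative to the same kernel under \<open>D'\<close>, not relative to
  Lebesgue measure, because the noise-down kernel has an atom and the analyst and the search may
  follow arbitrary laws. All kernel inequalities are pointwise in the state. Finitely many rounds
  give a bound whose constant does not depend on their number; the passage to infinite sequences is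
  made for the measures themselves, not through a limit of potentials.\<close>

definition dominated :: "'a measure \<Rightarrow> ennreal \<Rightarrow> 'a measure \<Rightarrow> ('a \<Rightarrow> ennreal) \<Rightarrow> 'a measure \<Rightarrow> bool" where
  "dominated N k \<mu> h \<nu> \<longleftrightarrow>
     (\<forall>f\<in>borel_measurable N. k * (\<integral>\<^sup>+x. f x \<partial>\<mu>) \<le> (\<integral>\<^sup>+x. f x * h x \<partial>\<nu>))"

text \<open>Covers the draws that do not see the database, namely the requests of the analyst and
  the searched noise parameters: their law is the same on both sides, and the potential passes
  through them unchanged.\<close>

lemma dominated_refl:
  assumes "sets M = sets N"
  shows "dominated N k M (\<lambda>_. k) M"
  unfolding dominated_def
proof
  fix f :: "'a \<Rightarrow> ennreal" assume "f \<in> borel_measurable N"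
  then have "f \<in> borel_measurable M"
    using assms by (auto cong: measurable_cong_sets)
  then show "k * (\<integral>\<^sup>+x. f x \<partial>M) \<le> (\<integral>\<^sup>+x. f x * k \<partial>M)"
    by (simp add: nn_integral_multc) (simp add: mult.commute)
qed

text \<open>Adaptive composition. The weight \<open>g\<close> is the upper weight of the first stage
  and the lower weight of the second, so it cancels, even though it depends on the intermediate
  outcome.\<close>

lemma dominated_bind:
  assumes \<mu>\<nu>: "dominated L k \<mu> g \<nu>" and sets: "sets \<mu> = sets L" "sets \<nu> = sets L"
    and K: "K \<in> L \<rightarrow>\<^sub>M subprob_algebra N" and K': "K' \<in> L \<rightarrow>\<^sub>M subprob_algebra N"
    and h: "h \<in> borel_measurable N"
    and dom: "\<And>x. x \<in> space L \<Longrightarrow> dominated N (g x) (K x) h (K' x)"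
  shows "dominated N k (\<mu> \<bind> K) h (\<nu> \<bind> K')"
  unfolding dominated_def
proof
  fix f :: "_ \<Rightarrow> ennreal" assume f: "f \<in> borel_measurable N"
  have K_\<mu>: "K \<in> \<mu> \<rightarrow>\<^sub>M subprob_algebra N" and K'_\<nu>: "K' \<in> \<nu> \<rightarrow>\<^sub>M subprob_algebra N"
    using K K' sets by (auto cong: measurable_cong_sets)
  have fh: "(\<lambda>x. f x * h x) \<in> borel_measurable N"
    using f h by measurable
  have int: "(\<lambda>x. \<integral>\<^sup>+y. f y \<partial>K x) \<in> borel_measurable L"
    using K nn_integral_measurable_subprob_algebra[OF f] by (rule measurable_compose)
  have "k * (\<integral>\<^sup>+x. f x \<partial>(\<mu> \<bind> K)) = k * (\<integral>\<^sup>+x. \<integral>\<^sup>+y. f y \<partial>K x \<partial>\<mu>)"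
    by (simp add: nn_integral_bind[OF f K_\<mu>])
  \<comment> \<open>The domination of the first stage is applied to the inner integral as test
    function. This is why \<open>dominated\<close> quantifies over functions instead of
    events.\<close>
  also have "\<dots> \<le> (\<integral>\<^sup>+x. (\<integral>\<^sup>+y. f y \<partial>K x) * g x \<partial>\<nu>)"
    using \<mu>\<nu> int by (auto simp: dominated_def)
  also have "\<dots> \<le> (\<integral>\<^sup>+x. \<integral>\<^sup>+y. f y * h y \<partial>K' x \<partial>\<nu>)"
    using dom f sets_eq_imp_space_eq[OF sets(2)]
    by (intro nn_integral_mono) (auto simp: dominated_def mult.commute)
  also have "\<dots> = (\<integral>\<^sup>+x. f x * h x \<partial>(\<nu> \<bind> K'))"
    by (simp add: nn_integral_bind[OF fh K'_\<nu>])
  finally show "k * (\<integral>\<^sup>+x. f x \<partial>(\<mu> \<bind> K)) \<le> (\<integral>\<^sup>+x. f x * h x \<partial>(\<nu> \<bind> K'))" .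
qed

lemma dominated_return:
  assumes "x \<in> space N" "k \<le> h x" "h \<in> borel_measurable N"
  shows "dominated N k (return N x) h (return N x)"
  using assms by (auto simp: dominated_def nn_integral_return mult.commute[of k] intro!: mult_left_mono)

lemma dominated_distr:
  assumes "dominated M k \<mu> (\<lambda>x. h (g x)) \<nu>" and sets: "sets \<mu> = sets M" "sets \<nu> = sets M"
    and g: "g \<in> M \<rightarrow>\<^sub>M N" and h: "h \<in> borel_measurable N"
  shows "dominated N k (distr \<mu> N g) h (distr \<nu> N g)"
  unfolding dominated_def
proof
  fix f :: "_ \<Rightarrow> ennreal" assume f: "f \<in> borel_measurable N"
  then have fh: "(\<lambda>x. f x * h x) \<in> borel_measurable N"
    using h by measurable
  have "g \<in> \<mu> \<rightarrow>\<^sub>M N" "g \<in> \<nu> \<rightarrow>\<^sub>M N"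
    using g sets by (auto cong: measurable_cong_sets)
  then show "k * (\<integral>\<^sup>+x. f x \<partial>distr \<mu> N g) \<le> (\<integral>\<^sup>+x. f x * h x \<partial>distr \<nu> N g)"
    using assms(1) measurable_compose[OF g f]
    by (simp add: nn_integral_distr f fh dominated_def)
qed

text \<open>The point at which likelihood ratios enter: domination is reduced to a pointwise
  inequality between the two weights and the density \<open>r\<close>.\<close>

lemma dominated_density:
  assumes sets: "sets \<nu> = sets N" and r: "r \<in> borel_measurable N"
    and le: "\<And>x. x \<in> space N \<Longrightarrow> k * r x \<le> h x"
  shows "dominated N k (density \<nu> r) h \<nu>"
  unfolding dominated_def
proof
  fix f :: "'a \<Rightarrow> ennreal" assume f: "f \<in> borel_measurable N"
  have [measurable]: "f \<in> borel_measurable \<nu>" "r \<in> borel_measurable \<nu>"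
    using f r sets by (auto cong: measurable_cong_sets)
  have "k * (\<integral>\<^sup>+x. f x \<partial>density \<nu> r) = (\<integral>\<^sup>+x. f x * (k * r x) \<partial>\<nu>)"
    by (simp add: nn_integral_density nn_integral_cmult[symmetric] mult_ac)
  also have "\<dots> \<le> (\<integral>\<^sup>+x. f x * h x \<partial>\<nu>)"
    using le sets_eq_imp_space_eq[OF sets] by (intro nn_integral_mono mult_left_mono) auto
  finally show "k * (\<integral>\<^sup>+x. f x \<partial>density \<nu> r) \<le> (\<integral>\<^sup>+x. f x * h x \<partial>\<nu>)" .
qed

section \<open>Finite products of probability spaces\<close>

lemma
  assumes I: "finite I" and M: "\<And>i. i \<in> I \<Longrightarrow> prob_space (M i)"
  shows emeasure_PiM_prob_space: "(\<And>i. i \<in> I \<Longrightarrow> A i \<in> sets (M i)) \<Longrightarrow>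
      emeasure (PiM I M) (Pi\<^sub>E I A) = (\<Prod>i\<in>I. emeasure (M i) (A i))"
    and PiM_eqI_prob_space: "sets P = sets (PiM I M) \<Longrightarrow>
      (\<And>A. (\<And>i. i \<in> I \<Longrightarrow> A i \<in> sets (M i)) \<Longrightarrow>
        emeasure P (Pi\<^sub>E I A) = (\<Prod>i\<in>I. emeasure (M i) (A i))) \<Longrightarrow> P = PiM I M"
    and nn_integral_PiM_prod: "(\<And>i. i \<in> I \<Longrightarrow> f i \<in> borel_measurable (M i)) \<Longrightarrow>
      (\<integral>\<^sup>+x. (\<Prod>i\<in>I. f i (x i)) \<partial>PiM I M) = (\<Prod>i\<in>I. integral\<^sup>N (M i) (f i))"
proof -
  \<comment> \<open>\<open>product_prob_space\<close> speaks of families that are probability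
    measures at every index. Outside \<open>I\<close> the family is padded by a point mass, which
    leaves the product over \<open>I\<close> as it is.\<close>
  define M' where "M' i = (if i \<in> I then M i else return (count_space UNIV) undefined)" for i
  interpret product_prob_space M'
    by (intro product_prob_spaceI) (auto simp: M'_def M intro!: prob_space_return)
  have eq: "PiM I M = PiM I M'"
    by (intro PiM_cong) (auto simp: M'_def)
  show "emeasure (PiM I M) (Pi\<^sub>E I A) = (\<Prod>i\<in>I. emeasure (M i) (A i))"
    if "\<And>i. i \<in> I \<Longrightarrow> A i \<in> sets (M i)"
    unfolding eq using that I by (subst emeasure_PiM) (auto simp: M'_def intro!: prod.cong)
  show "P = PiM I M" if "sets P = sets (PiM I M)"
      "\<And>A. (\<And>i. i \<in> I \<Longrightarrow> A i \<in> sets (M i)) \<Longrightarrow> emeasure P (Pi\<^sub>E I A) = (\<Prod>i\<in>I. emeasure (M i) (A i))"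
    unfolding eq using that I by (intro PiM_eqI) (auto simp: eq M'_def intro!: prod.cong)
  show "(\<integral>\<^sup>+x. (\<Prod>i\<in>I. f i (x i)) \<partial>PiM I M) = (\<Prod>i\<in>I. integral\<^sup>N (M i) (f i))"
    if "\<And>i. i \<in> I \<Longrightarrow> f i \<in> borel_measurable (M i)"
    unfolding eq using that I
    by (subst product_nn_integral_prod) (auto simp: M'_def intro!: prod.cong)
qed

text \<open>Measurability into the space of probability measures may be tested on an
  intersection-stable generator. On boxes the product measure is a finite product of measurable
  functions of the parameter.\<close>

lemma measurable_PiM_kernel:
  assumes I: "finite I" and K: "\<And>i. i \<in> I \<Longrightarrow> K i \<in> L \<rightarrow>\<^sub>M prob_algebra (M i)"
  shows "(\<lambda>x. PiM I (\<lambda>i. K i x)) \<in> L \<rightarrow>\<^sub>M prob_algebra (PiM I M)"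
proof (rule measurable_prob_algebra_generated)
  have sp: "prob_space (K i x)" "sets (K i x) = sets (M i)" if "i \<in> I" "x \<in> space L" for i x
    using measurable_space[OF K[OF that(1)] that(2)] by (auto simp: space_prob_algebra)
  show "sets (PiM I M) = sigma_sets (\<Pi>\<^sub>E i\<in>I. space (M i)) (prod_algebra I M)"
    by (rule sets_PiM)
  show "Int_stable (prod_algebra I M)"
    by (rule Int_stable_prod_algebra)
  show "prod_algebra I M \<subseteq> Pow (\<Pi>\<^sub>E i\<in>I. space (M i))"
    by (rule prod_algebra_sets_into_space)
  show "prob_space (PiM I (\<lambda>i. K i x))" if "x \<in> space L" for x
    using that sp by (intro prob_space_PiM) auto
  show "sets (PiM I (\<lambda>i. K i x)) = sets (PiM I M)" if "x \<in> space L" for x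
    using that sp by (intro sets_PiM_cong) auto
  fix A assume "A \<in> prod_algebra I M"
  then obtain X where X: "A = Pi\<^sub>E I X" "\<And>i. i \<in> I \<Longrightarrow> X i \<in> sets (M i)"
    using I by (auto simp: prod_algebra_eq_finite)
  have "(\<lambda>x. \<Prod>i\<in>I. emeasure (K i x) (X i)) \<in> borel_measurable L"
    using X(2)
    by (intro borel_measurable_prod_ennreal
        measurable_compose[OF measurable_prob_algebraD[OF K] measurable_emeasure_subprob_algebra])
  also have "?this \<longleftrightarrow> (\<lambda>x. emeasure (PiM I (\<lambda>i. K i x)) A) \<in> borel_measurable L"
    unfolding X(1) using I X(2) sp
    by (intro measurable_cong emeasure_PiM_prob_space[symmetric]) auto
  finally show "(\<lambda>x. emeasure (PiM I (\<lambda>i. K i x)) A) \<in> borel_measurable L" .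
qed

text \<open>Both sides agree on boxes, since the indicator of a box is the product of the indicators
  of its sides and the integral of a product of one-coordinate functions factorizes. For the noise
  this says that log-likelihood ratios of independent responses add up.\<close>

lemma PiM_density:
  assumes I: "finite I" and M: "\<And>i. i \<in> I \<Longrightarrow> prob_space (M i)"
    and D: "\<And>i. i \<in> I \<Longrightarrow> prob_space (density (M i) (f i))"
    and f: "\<And>i. i \<in> I \<Longrightarrow> f i \<in> borel_measurable (M i)"
  shows "PiM I (\<lambda>i. density (M i) (f i)) = density (PiM I M) (\<lambda>x. \<Prod>i\<in>I. f i (x i))"
proof (rule PiM_eqI_prob_space[OF I D, symmetric])
  show "sets (density (PiM I M) (\<lambda>x. \<Prod>i\<in>I. f i (x i))) = sets (PiM I (\<lambda>i. density (M i) (f i)))"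
    by (simp cong: sets_PiM_cong)
  fix A assume "\<And>i. i \<in> I \<Longrightarrow> A i \<in> sets (density (M i) (f i))"
  then have A: "A i \<in> sets (M i)" if "i \<in> I" for i using that by simp
  have [measurable]: "(\<lambda>x. \<Prod>i\<in>I. f i (x i)) \<in> borel_measurable (PiM I M)"
    by (intro borel_measurable_prod_ennreal)
       (use f in \<open>auto intro: measurable_compose[OF measurable_component_singleton]\<close>)
  have "emeasure (density (PiM I M) (\<lambda>x. \<Prod>i\<in>I. f i (x i))) (Pi\<^sub>E I A)
      = (\<integral>\<^sup>+x. (\<Prod>i\<in>I. f i (x i)) * indicator (Pi\<^sub>E I A) x \<partial>PiM I M)"
    using A I by (subst emeasure_density) (auto intro!: sets_PiM_I_finite)
  also have "\<dots> = (\<integral>\<^sup>+x. (\<Prod>i\<in>I. f i (x i) * indicator (A i) (x i)) \<partial>PiM I M)"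
  proof (rule nn_integral_cong)
    fix x assume "x \<in> space (PiM I M)"
    then have "indicator (Pi\<^sub>E I A) x = (\<Prod>i\<in>I. indicator (A i) (x i) :: ennreal)"
      using I by (cases "x \<in> Pi\<^sub>E I A") (auto simp: space_PiM PiE_iff prod_zero_iff indicator_eq_0_iff)
    then show "(\<Prod>i\<in>I. f i (x i)) * indicator (Pi\<^sub>E I A) x
        = (\<Prod>i\<in>I. f i (x i) * indicator (A i) (x i))"
      by (simp add: prod.distrib)
  qed
  also have "\<dots> = (\<Prod>i\<in>I. \<integral>\<^sup>+x. f i x * indicator (A i) x \<partial>M i)"
    using f A by (intro nn_integral_PiM_prod[OF I M]) auto
  also have "\<dots> = (\<Prod>i\<in>I. emeasure (density (M i) (f i)) (A i))"
    using f A by (intro prod.cong refl) (simp add: emeasure_density)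
  finally show "emeasure (density (PiM I M) (\<lambda>x. \<Prod>i\<in>I. f i (x i))) (Pi\<^sub>E I A)
      = (\<Prod>i\<in>I. emeasure (density (M i) (f i)) (A i))" .
qed

text \<open>The preimage of a box under a coordinatewise map is the box of the preimages.\<close>

lemma PiM_distr:
  assumes I: "finite I" and M: "\<And>i. i \<in> I \<Longrightarrow> prob_space (M i)"
    and g: "\<And>i. i \<in> I \<Longrightarrow> g i \<in> M i \<rightarrow>\<^sub>M N i"
  shows "PiM I (\<lambda>i. distr (M i) (N i) (g i)) = distr (PiM I M) (PiM I N) (\<lambda>x. \<lambda>i\<in>I. g i (x i))"
proof (rule PiM_eqI_prob_space[OF I, symmetric])
  show "prob_space (distr (M i) (N i) (g i))" if "i \<in> I" for i
    using that M g by (intro prob_space.prob_space_distr) auto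
  show "sets (distr (PiM I M) (PiM I N) (\<lambda>x. \<lambda>i\<in>I. g i (x i))) = sets (PiM I (\<lambda>i. distr (M i) (N i) (g i)))"
    by (simp cong: sets_PiM_cong)
  fix A assume "\<And>i. i \<in> I \<Longrightarrow> A i \<in> sets (distr (M i) (N i) (g i))"
  then have A: "A i \<in> sets (N i)" if "i \<in> I" for i using that by simp
  have meas: "(\<lambda>x. \<lambda>i\<in>I. g i (x i)) \<in> PiM I M \<rightarrow>\<^sub>M PiM I N"
    by (intro measurable_restrict) (use g in \<open>auto intro: measurable_compose[OF measurable_component_singleton]\<close>)
  have pre: "g i -` A i \<inter> space (M i) \<in> sets (M i)" if "i \<in> I" for i
    using that A g by (auto intro: measurable_sets)
  have "emeasure (distr (PiM I M) (PiM I N) (\<lambda>x. \<lambda>i\<in>I. g i (x i))) (Pi\<^sub>E I A)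
      = emeasure (PiM I M) ((\<lambda>x. \<lambda>i\<in>I. g i (x i)) -` Pi\<^sub>E I A \<inter> space (PiM I M))"
    using A I by (intro emeasure_distr meas sets_PiM_I_finite) auto
  also have "(\<lambda>x. \<lambda>i\<in>I. g i (x i)) -` Pi\<^sub>E I A \<inter> space (PiM I M)
      = (\<Pi>\<^sub>E i\<in>I. g i -` A i \<inter> space (M i))"
    by (auto simp: space_PiM PiE_iff)
  also have "emeasure (PiM I M) \<dots> = (\<Prod>i\<in>I. emeasure (M i) (g i -` A i \<inter> space (M i)))"
    by (rule emeasure_PiM_prob_space[OF I M pre])
  also have "\<dots> = (\<Prod>i\<in>I. emeasure (distr (M i) (N i) (g i)) (A i))"
    using A g by (intro prod.cong refl) (simp add: emeasure_distr)
  finally show "emeasure (distr (PiM I M) (PiM I N) (\<lambda>x. \<lambda>i\<in>I. g i (x i))) (Pi\<^sub>E I A)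
      = (\<Prod>i\<in>I. emeasure (distr (M i) (N i) (g i)) (A i))" .
qed

section \<open>Shifted noise\<close>

text \<open>The ratio is kept exactly. Estimating the exponent by \<bar>q - q'\<bar> / b already
  here would destroy the shortfall that \<open>slack\<close> has to remember for a later RP.\<close>

lemma laplace_shift:
  assumes b: "0 < b"
  shows "distr (laplace b) borel ((+) q)
    = density (distr (laplace b) borel ((+) q')) (\<lambda>y. ennreal (exp ((\<bar>y - q'\<bar> - \<bar>y - q\<bar>) / b)))"
    (is "?L = density ?R ?r")
proof (rule measure_eqI)
  fix A assume "A \<in> sets ?L"
  then have [measurable]: "A \<in> sets borel" by simp
  have shift: "(\<integral>\<^sup>+y. f y \<partial>distr (laplace b) borel ((+) p))
      = (\<integral>\<^sup>+y. ennreal (laplace_density b (y - p)) * f y \<partial>lborel)"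
    if [measurable]: "f \<in> borel_measurable borel" for p :: real and f :: "real \<Rightarrow> ennreal"
  proof -
    have "(\<integral>\<^sup>+y. f y \<partial>distr (laplace b) borel ((+) p))
        = (\<integral>\<^sup>+v. ennreal (laplace_density b v) * f (p + v) \<partial>lborel)"
      by (simp add: nn_integral_distr laplace_def nn_integral_density)
    also have "\<dots> = (\<integral>\<^sup>+y. ennreal (laplace_density b (y - p)) * f y \<partial>lborel)"
      by (subst nn_integral_real_affine[where c=1 and t="-p"]) (auto simp: algebra_simps)
    finally show ?thesis .
  qed
  have eq: "laplace_density b (y - q) = exp ((\<bar>y - q'\<bar> - \<bar>y - q\<bar>) / b) * laplace_density b (y - q')" for y
    by (simp add: laplace_density_def exp_add[symmetric] diff_divide_distrib)
  have "emeasure ?L A = (\<integral>\<^sup>+y. indicator A y \<partial>?L)"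
    by simp
  also have "\<dots> = (\<integral>\<^sup>+y. ennreal (laplace_density b (y - q)) * indicator A y \<partial>lborel)"
    by (rule shift) measurable
  also have "\<dots> = (\<integral>\<^sup>+y. ennreal (laplace_density b (y - q')) * (?r y * indicator A y) \<partial>lborel)"
    using laplace_density_nonneg[OF b] by (simp add: eq ennreal_mult mult_ac)
  also have "\<dots> = (\<integral>\<^sup>+y. ?r y * indicator A y \<partial>?R)"
    by (rule shift[symmetric]) measurable
  also have "\<dots> = emeasure (density ?R ?r) A"
    by (simp add: emeasure_density)
  finally show "emeasure ?L A = emeasure (density ?R ?r) A" .
qed simp

text \<open>The kernel is given by its values on sets, as an atom plus a continuous part, so the
  integral formula is carried from indicators to all nonnegative functions by sums, multiples and
  monotone limits.\<close>

lemma nn_integral_noise_down: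
  assumes "f \<in> borel_measurable borel"
  shows "(\<integral>\<^sup>+v. f v \<partial>noise_down b b\<^sub>o u) =
     ennreal ((b / b\<^sub>o)\<^sup>2 * laplace_density b u / laplace_density b\<^sub>o u) * f u +
     (\<integral>\<^sup>+v. f v * ennreal ((1 - (b / b\<^sub>o)\<^sup>2) * laplace_density b v * laplace_density b\<^sub>o (u - v)
        / laplace_density b\<^sub>o u) \<partial>lborel)"
  using assms
proof (induction f rule: borel_measurable_induct)
  case (cong f g)
  then have "f = g" by auto
  with cong show ?case by simp
next
  case (set A)
  then show ?case by (simp add: emeasure_noise_down mult.commute)
next
  case (mult f c)
  then show ?case by (simp add: nn_integral_cmult distrib_left mult_ac)
next
  case (add f g)
  then show ?case by (simp add: nn_integral_add distrib_left distrib_right ac_simps)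
next
  case (seq F)
  have "(\<integral>\<^sup>+v. (SUP i. F i) v \<partial>noise_down b b\<^sub>o u) = (SUP i. \<integral>\<^sup>+v. F i v \<partial>noise_down b b\<^sub>o u)"
    using seq by (simp add: nn_integral_monotone_convergence_SUP image_comp)
  also have "\<dots> = (SUP i. ennreal ((b / b\<^sub>o)\<^sup>2 * laplace_density b u / laplace_density b\<^sub>o u) * F i u +
     (\<integral>\<^sup>+v. F i v * ennreal ((1 - (b / b\<^sub>o)\<^sup>2) * laplace_density b v * laplace_density b\<^sub>o (u - v)
        / laplace_density b\<^sub>o u) \<partial>lborel))"
    using seq by simp
  \<comment> \<open>The supremum of the sum splits because both summands increase with i.\<close>
  also have "\<dots> = (SUP i. ennreal ((b / b\<^sub>o)\<^sup>2 * laplace_density b u / laplace_density b\<^sub>o u) * F i u) +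
     (SUP i. \<integral>\<^sup>+v. F i v * ennreal ((1 - (b / b\<^sub>o)\<^sup>2) * laplace_density b v * laplace_density b\<^sub>o (u - v)
        / laplace_density b\<^sub>o u) \<partial>lborel)"
    using \<open>incseq F\<close>
    by (intro ennreal_SUP_add) (auto simp: mono_def le_fun_def intro!: mult_left_mono mult_right_mono nn_integral_mono)
  also have "(SUP i. \<integral>\<^sup>+v. F i v * ennreal ((1 - (b / b\<^sub>o)\<^sup>2) * laplace_density b v * laplace_density b\<^sub>o (u - v)
        / laplace_density b\<^sub>o u) \<partial>lborel) = (\<integral>\<^sup>+v. (SUP i. F i v * ennreal ((1 - (b / b\<^sub>o)\<^sup>2) * laplace_density b v * laplace_density b\<^sub>o (u - v)
        / laplace_density b\<^sub>o u)) \<partial>lborel)"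
    using seq by (intro nn_integral_monotone_convergence_SUP[symmetric])
      (auto simp: mono_def le_fun_def intro!: mult_right_mono)
  finally show ?case
    by (simp add: SUP_mult_left_ennreal[symmetric] SUP_mult_right_ennreal[symmetric] image_comp)
qed

text \<open>The difference of the old and the new response does not depend on the database, so only the
  factors \<open>laplace_density b v / laplace_density b\<^sub>o u\<close> of the kernel change.\<close>

lemma noise_down_shift:
  assumes b: "0 < b" "0 < b\<^sub>o"
  shows "distr (noise_down b b\<^sub>o (z - q)) borel ((+) q)
    = density (distr (noise_down b b\<^sub>o (z - q')) borel ((+) q'))
       (\<lambda>y. ennreal (exp ((\<bar>y - q'\<bar> - \<bar>y - q\<bar>) / b - (\<bar>z - q'\<bar> - \<bar>z - q\<bar>) / b\<^sub>o)))"
    (is "?L = density ?R ?r")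
proof (rule measure_eqI)
  fix A assume "A \<in> sets ?L"
  then have [measurable]: "A \<in> sets borel" by simp
  \<comment> \<open>Everything is expressed in the new response y = p + v, where p is the true
    answer and z - p the old noise. Then u - v becomes z - y, and the atom v = u becomes y = z: with
    mass \<open>k p\<close> the old response is repeated, at a place that does not depend on
    p.\<close>
  define K where "K p y = (1 - (b / b\<^sub>o)\<^sup>2) * laplace_density b (y - p) * laplace_density b\<^sub>o (z - y)
        / laplace_density b\<^sub>o (z - p)" for p y
  define k where "k p = (b / b\<^sub>o)\<^sup>2 * laplace_density b (z - p) / laplace_density b\<^sub>o (z - p)" for p
  have shift: "(\<integral>\<^sup>+y. f y \<partial>distr (noise_down b b\<^sub>o (z - p)) borel ((+) p))
      = ennreal (k p) * f z + (\<integral>\<^sup>+y. f y * ennreal (K p y) \<partial>lborel)"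
    if [measurable]: "f \<in> borel_measurable borel" for p :: real and f :: "real \<Rightarrow> ennreal"
  proof -
    have "(\<integral>\<^sup>+y. f y \<partial>distr (noise_down b b\<^sub>o (z - p)) borel ((+) p))
        = ennreal (k p) * f z + (\<integral>\<^sup>+v. f (p + v) * ennreal (K p (p + v)) \<partial>lborel)"
      by (simp add: nn_integral_distr nn_integral_noise_down K_def k_def diff_diff_eq)
    also have "(\<integral>\<^sup>+v. f (p + v) * ennreal (K p (p + v)) \<partial>lborel) = (\<integral>\<^sup>+y. f y * ennreal (K p y) \<partial>lborel)"
      unfolding K_def
      by (subst nn_integral_real_affine[where c=1 and t="-p"]) (auto simp: algebra_simps)
    finally show ?thesis .
  qed
  define r where "r y = exp ((\<bar>y - q'\<bar> - \<bar>y - q\<bar>) / b - (\<bar>z - q'\<bar> - \<bar>z - q\<bar>) / b\<^sub>o)" for y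
  \<comment> \<open>Passing from \<open>q'\<close> to \<open>q\<close> multiplies both the atom,
    where y = z, and the continuous part by the same function \<open>r\<close>. Hence one function
    serves as density for the mixed measure.\<close>
  have ratio: "laplace_density b (y - q) / laplace_density b\<^sub>o (z - q)
      = r y * (laplace_density b (y - q') / laplace_density b\<^sub>o (z - q'))" for y
    using b by (simp add: laplace_density_def r_def exp_add[symmetric] exp_diff[symmetric] field_simps)
  have "k q = (b / b\<^sub>o)\<^sup>2 * (laplace_density b (z - q) / laplace_density b\<^sub>o (z - q))"
    by (simp add: k_def)
  then have k_eq: "k q = r z * k q'"
    unfolding ratio by (simp add: k_def)
  have "K q y = (1 - (b / b\<^sub>o)\<^sup>2) * laplace_density b\<^sub>o (z - y)
      * (laplace_density b (y - q) / laplace_density b\<^sub>o (z - q))" for y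
    by (simp add: K_def)
  then have K_eq: "K q y = r y * K q' y" for y
    unfolding ratio by (simp add: K_def)
  have r_nn: "0 \<le> r y" for y by (simp add: r_def)
  have [measurable]: "r \<in> borel_measurable borel" unfolding r_def by measurable
  have "emeasure ?L A = (\<integral>\<^sup>+y. indicator A y \<partial>?L)"
    by simp
  also have "\<dots> = ennreal (k q) * indicator A z + (\<integral>\<^sup>+y. indicator A y * ennreal (K q y) \<partial>lborel)"
    by (rule shift) measurable
  also have "\<dots> = ennreal (k q') * (ennreal (r z) * indicator A z)
      + (\<integral>\<^sup>+y. ennreal (r y) * indicator A y * ennreal (K q' y) \<partial>lborel)"
  proof -
    have "ennreal (r z * k q') * indicator A z = ennreal (k q') * (ennreal (r z) * indicator A z)"
      "indicator A y * ennreal (r y * K q' y) = ennreal (r y) * indicator A y * ennreal (K q' y)" for y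
      unfolding ennreal_mult'[OF r_nn] by (simp_all only: mult_ac)
    then show ?thesis unfolding k_eq K_eq by presburger
  qed
  also have "\<dots> = (\<integral>\<^sup>+y. ennreal (r y) * indicator A y \<partial>?R)"
    by (rule shift[symmetric]) measurable
  also have "\<dots> = emeasure (density ?R (\<lambda>y. ennreal (r y))) A"
    by (simp add: emeasure_density)
  finally show "emeasure ?L A = emeasure (density ?R ?r) A"
    by (simp add: r_def)
qed simp

section \<open>Inequalities between measures on a generating algebra\<close>

text \<open>Such inequalities are not preserved under complements, so that a Dynkin argument does not apply
  directly; instead every set is approximated by sets of the algebra.\<close>

lemma (in Sigma_Algebra.algebra) measure_le_sigma_sets:
  assumes \<mu>: "finite_measure \<mu>" and \<nu>: "finite_measure \<nu>"
    and sets: "sets \<mu> = sigma_sets \<Omega> M" "sets \<nu> = sigma_sets \<Omega> M"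
    and c: "0 \<le> c" and le: "\<And>A. A \<in> M \<Longrightarrow> measure \<mu> A \<le> c * measure \<nu> A"
    and X: "X \<in> sigma_sets \<Omega> M"
  shows "measure \<mu> X \<le> c * measure \<nu> X"
proof -
  interpret \<mu>: finite_measure \<mu> by fact
  interpret \<nu>: finite_measure \<nu> by fact
  have M_sets: "A \<in> sets \<mu>" "A \<in> sets \<nu>" if "A \<in> M" for A
    using that sets by auto
  \<comment> \<open>The distance uses both measures at once, so that a single set of the algebra
    approximates X for \<mu> and \<nu> simultaneously.\<close>
  define d where "d X A = measure \<mu> (sym_diff X A) + measure \<nu> (sym_diff X A)" for X A
  have approx: "\<forall>e>0. \<exists>A\<in>M. d X A < e"
    using X
  proof induction
    case (Basic A)
    then show ?case by (auto simp: d_def intro!: bexI[of _ A])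
  next
    case Empty
    then show ?case by (auto simp: d_def intro!: bexI[of _ "{}"])
  next
    case (Compl X)
    have sub: "X \<subseteq> \<Omega>"
      using Compl(1) space_closed by (auto dest: sigma_sets_into_sp[rotated])
    have "d (\<Omega> - X) (\<Omega> - A) = d X A" if "A \<in> M" for A
    proof -
      have "sym_diff (\<Omega> - X) (\<Omega> - A) = sym_diff X A"
        using sub sets_into_space[OF that] by auto
      then show ?thesis by (simp add: d_def)
    qed
    then show ?case using Compl.IH by (metis compl_sets)
  next
    case (Union X)
    show ?case
    proof (intro allI impI)
      fix e :: real assume e: "0 < e"
      have X_sets: "X i \<in> sets \<mu>" "X i \<in> sets \<nu>" for i
        using Union(1) sets by auto
      \<comment> \<open>An algebra contains only finite unions. \<open>T n\<close> is what is lost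
        by stopping after \<open>n\<close> sets; these remainders decrease to the empty set, so
        finiteness of the measures makes them negligible.\<close>
      define T where "T n = (\<Union>i. X i) - (\<Union>i<n. X i)" for n
      have T_sets: "T n \<in> sets \<mu>" "T n \<in> sets \<nu>" for n
        using X_sets unfolding T_def by auto
      have "decseq T" by (auto simp: T_def decseq_def)
      moreover have "(\<Inter>n. T n) = {}" unfolding T_def by auto
      ultimately have "(\<lambda>n. measure \<mu> (T n)) \<longlonglongrightarrow> measure \<mu> {}" "(\<lambda>n. measure \<nu> (T n)) \<longlonglongrightarrow> measure \<nu> {}"
        using \<mu>.finite_Lim_measure_decseq[of T] \<nu>.finite_Lim_measure_decseq[of T] T_sets by auto
      from tendsto_add[OF this] have "(\<lambda>n. measure \<mu> (T n) + measure \<nu> (T n)) \<longlonglongrightarrow> 0" by simp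
      then have "\<forall>\<^sub>F n in sequentially. measure \<mu> (T n) + measure \<nu> (T n) < e / 2"
        using e by (intro order_tendstoD(2)) auto
      then obtain n where n: "measure \<mu> (T n) + measure \<nu> (T n) < e / 2"
        by (auto simp: eventually_sequentially)
      \<comment> \<open>The \<open>n\<close> approximation errors together stay below e / 2;
        \<open>Suc n\<close> instead of \<open>n\<close> keeps the denominator positive.\<close>
      have "\<exists>A\<in>M. d (X i) A < e / (2 * Suc n)" for i
        using Union.IH[of i] e by auto
      then obtain A where A: "\<And>i. A i \<in> M" "\<And>i. d (X i) (A i) < e / (2 * Suc n)"
        by metis
      define U where "U = (\<Union>i<n. A i)"
      have U: "U \<in> M" unfolding U_def using A by auto
      have sub: "sym_diff (\<Union>i. X i) U \<subseteq> T n \<union> (\<Union>i<n. sym_diff (X i) (A i))"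
        unfolding U_def T_def by auto
      have bound: "measure \<kappa> (sym_diff (\<Union>i. X i) U)
          \<le> measure \<kappa> (T n) + (\<Sum>i<n. measure \<kappa> (sym_diff (X i) (A i)))"
        if "finite_measure \<kappa>" "\<And>i. X i \<in> sets \<kappa>" "\<And>i. A i \<in> sets \<kappa>" "T n \<in> sets \<kappa>" for \<kappa>
      proof -
        interpret finite_measure \<kappa> by fact
        have "measure \<kappa> (sym_diff (\<Union>i. X i) U) \<le> measure \<kappa> (T n \<union> (\<Union>i<n. sym_diff (X i) (A i)))"
          using that by (intro finite_measure_mono sub) auto
        also have "\<dots> \<le> measure \<kappa> (T n) + measure \<kappa> (\<Union>i<n. sym_diff (X i) (A i))"
          using that by (intro measure_Un_le) auto
        also have "measure \<kappa> (\<Union>i<n. sym_diff (X i) (A i)) \<le> (\<Sum>i<n. measure \<kappa> (sym_diff (X i) (A i)))"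
          using that by (intro finite_measure_subadditive_finite) auto
        finally show ?thesis by simp
      qed
      have "d (\<Union>i. X i) U \<le> measure \<mu> (T n) + measure \<nu> (T n) + (\<Sum>i<n. d (X i) (A i))"
        using bound[OF \<mu>] bound[OF \<nu>] X_sets M_sets[OF A(1)] T_sets
        by (simp add: d_def sum.distrib)
      also have "(\<Sum>i<n. d (X i) (A i)) \<le> (\<Sum>i<n. e / (2 * Suc n))"
        using A(2) by (intro sum_mono less_imp_le)
      also have "\<dots> \<le> e / 2" using e by (simp add: field_simps)
      finally have "d (\<Union>i. X i) U < e" using n by simp
      then show "\<exists>A\<in>M. d (\<Union>i. X i) A < e" using U by auto
    qed
  qed
  have "measure \<mu> X \<le> c * measure \<nu> X + e" if e: "0 < e" for e
  proof -
    \<comment> \<open>Exchanging X for A costs one symmetric difference in \<mu> and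
      \<open>c\<close> times one in \<nu>, hence at most (1 + c) times \<open>d X A\<close>.\<close>
    obtain A where A: "A \<in> M" "d X A < e / (1 + c)"
      using approx[rule_format, of "e / (1 + c)"] c e by auto
    have XA: "X \<in> sets \<mu>" "A \<in> sets \<mu>" "X \<in> sets \<nu>" "A \<in> sets \<nu>"
      using X A sets by auto
    have "measure \<mu> X \<le> measure \<mu> (A \<union> sym_diff X A)"
      using XA by (intro \<mu>.finite_measure_mono) auto
    also have "\<dots> \<le> measure \<mu> A + measure \<mu> (sym_diff X A)"
      using XA by (intro measure_Un_le) auto
    also have "measure \<mu> A \<le> c * measure \<nu> A" by (rule le[OF A(1)])
    also have "measure \<nu> A \<le> measure \<nu> (X \<union> sym_diff X A)"
      using XA by (intro \<nu>.finite_measure_mono) auto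
    also have "\<dots> \<le> measure \<nu> X + measure \<nu> (sym_diff X A)"
      using XA by (intro measure_Un_le) auto
    finally have "measure \<mu> X \<le> c * measure \<nu> X + (c * measure \<nu> (sym_diff X A) + measure \<mu> (sym_diff X A))"
      using c by (simp add: distrib_left mult_left_mono)
    also have "c * measure \<nu> (sym_diff X A) + measure \<mu> (sym_diff X A) \<le> (1 + c) * d X A"
      using c by (simp add: d_def algebra_simps)
    also have "\<dots> \<le> e" using A(2) c by (simp add: field_simps)
    finally show ?thesis by simp
  qed
  then show ?thesis by (rule field_le_epsilon)
qed

section \<open>Sensitivity of the queries\<close>

lemma
  assumes "finite A"
  shows distinct_enum_set: "distinct (enum_set A)" and set_enum_set: "set (enum_set A) = A"
    and length_enum_set: "length (enum_set A) = card A"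
proof -
  have "distinct (enum_set A) \<and> set (enum_set A) = A"
    unfolding enum_set_def 
    by (rule someI_ex) (use finite_distinct_list[OF assms] in auto)
  then show "distinct (enum_set A)" "set (enum_set A) = A" "length (enum_set A) = card A"
    using distinct_card[of "enum_set A"] by auto
qed

definition query :: "'d::finite multiset \<Rightarrow> 'd set \<Rightarrow> real" where
  "query D a = scalar_prod (row_vec a) (data_vec D)"

lemma query_eq_sum: "query D a = (\<Sum>w\<in>a. real (count D w))"
proof -
  have "query D a = (\<Sum>i<CARD('a). of_bool (enum_set UNIV ! i \<in> a) * real (count D (enum_set UNIV ! i)))"
    by (simp add: query_def scalar_prod_def row_vec_def data_vec_def atLeast0LessThan)
  also have "\<dots> = (\<Sum>w\<in>UNIV. of_bool (w \<in> a) * real (count D w))"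
    by (intro sum.reindex_bij_betw bij_betw_nth)
       (auto simp: distinct_enum_set set_enum_set length_enum_set)
  also have "\<dots> = (\<Sum>w\<in>a. real (count D w))"
    by (intro sum.mono_neutral_cong_right) auto
  finally show ?thesis .
qed

lemma neighbouring_query:
  assumes "neighbouring D D'"
  obtains v where "\<And>a. \<bar>query D a - query D' a\<bar> \<le> of_bool (v \<in> a)"
proof -
  obtain v where v: "(D - D') \<union># (D' - D) = {#v#}"
    using assms size_1_singleton_mset by (auto simp: neighbouring_def)
  \<comment> \<open>\<open>\<union>#\<close> takes the maximum of multiplicities. Of the two
    truncated differences at most one is nonzero, so the maximum is the absolute difference of the
    counts.\<close>
  have count: "\<bar>real (count D w) - real (count D' w)\<bar> = of_bool (w = v)" for w
    using arg_cong[OF v, of "\<lambda>X. count X w"] by (auto simp: max_def split: if_splits)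
  have "\<bar>query D a - query D' a\<bar> \<le> of_bool (v \<in> a)" for a
  proof -
    have "\<bar>query D a - query D' a\<bar> \<le> (\<Sum>w\<in>a. \<bar>real (count D w) - real (count D' w)\<bar>)"
      unfolding query_eq_sum sum_subtractf[symmetric] by (rule sum_abs)
    also have "\<dots> = of_bool (v \<in> a)"
      unfolding count by (auto simp: of_bool_def)
    finally show ?thesis .
  qed
  then show thesis by (rule that)
qed

lemma norm1_mat_nonneg: "0 \<le> norm1_mat M"
  unfolding norm1_mat_def by (intro Max_ge) auto

lemma column_le_norm1_mat: "j < dim_col M \<Longrightarrow> (\<Sum>i<dim_row M. \<bar>M $$ (i, j)\<bar>) \<le> norm1_mat M"
  unfolding norm1_mat_def by (intro Max_ge) auto

lemma norm1_mat_le: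
  assumes "0 \<le> c" "\<And>j. j < dim_col M \<Longrightarrow> (\<Sum>i<dim_row M. \<bar>M $$ (i, j)\<bar>) \<le> c"
  shows "norm1_mat M \<le> c"
  unfolding norm1_mat_def using assms by (intro Max.boundedI) auto

lemma sum_of_bool_nth:
  assumes "finite A"
  shows "(\<Sum>i<length (enum_set A). of_bool (Q (enum_set A ! i)) :: real) = card {a\<in>A. Q a}"
proof -
  have "(\<Sum>i<length (enum_set A). of_bool (Q (enum_set A ! i)) :: real) = (\<Sum>a\<in>A. of_bool (Q a))"
    using assms by (intro sum.reindex_bij_betw[where g="\<lambda>a. of_bool (Q a)"] bij_betw_nth)
      (auto simp: distinct_enum_set set_enum_set)
  also have "\<dots> = card {a\<in>A. Q a}"
    using assms by (simp add: sum_of_bool_eq Int_def conj_commute)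
  finally show ?thesis .
qed

lemma row_mat_column:
  fixes R :: "'d::finite set set"
  assumes "j < CARD('d)"
  shows "(\<Sum>i<dim_row (row_mat R). \<bar>row_mat R $$ (i, j)\<bar>) = card {a\<in>R. enum_set UNIV ! j \<in> a}"
proof -
  have "(\<Sum>i<dim_row (row_mat R). \<bar>row_mat R $$ (i, j)\<bar>)
      = (\<Sum>i<length (enum_set R). of_bool (enum_set UNIV ! j \<in> enum_set R ! i))"
    using assms by (intro sum.cong) (auto simp: row_mat_def row_vec_def mat_of_rows_def)
  also have "\<dots> = card {a\<in>R. enum_set UNIV ! j \<in> a}"
    by (rule sum_of_bool_nth) simp
  finally show ?thesis .
qed

text \<open>The column of \<open>v\<close> has a 1 for each row containing \<open>v\<close>, so the
  norm bounds the number of responses that a change in the multiplicity of \<open>v\<close> can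
  affect.\<close>

lemma card_le_norm1_row_mat:
  fixes R :: "'d::finite set set"
  shows "real (card {a\<in>R. v \<in> a}) \<le> norm1_mat (row_mat R)"
proof -
  obtain j where j: "j < CARD('d)" "enum_set UNIV ! j = v"
    using set_enum_set[of "UNIV :: 'd set"] length_enum_set[of "UNIV :: 'd set"] UNIV_I[of v]
      in_set_conv_nth[of v "enum_set UNIV"] by auto
  then show ?thesis
    using column_le_norm1_mat[of j "row_mat R"] row_mat_column[of j R]
    by (simp add: row_mat_def)
qed

text \<open>Rows are unions of disjoint buckets, so every row containing \<open>v\<close> contains
  the whole bucket of \<open>v\<close>, and the column of that bucket counts all of them. If no row
  contains \<open>v\<close>, there need not be such a bucket, but then the left side is 0.\<close>

lemma card_le_norm1_bucket_mat:
  fixes P :: "'d::finite set set"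
  assumes Bs: "bucket_family R Bs" and P: "P \<subseteq> R"
  shows "real (card {a\<in>P. v \<in> a}) \<le> norm1_mat (bucket_mat (enum_set P) Bs)"
proof (cases "\<exists>a\<in>P. v \<in> a")
  case True
  have union: "\<exists>B\<in>set Bs. v \<in> B \<and> B \<subseteq> a" if a: "a \<in> P" "v \<in> a" for a
  proof -
    from a(1) P have "a \<in> R" by blast
    with Bs obtain \<B> where "\<B> \<subseteq> set Bs" "a = \<Union>\<B>" by (auto simp: bucket_family_def)
    with a(2) show ?thesis by blast
  qed
  with True obtain B where B: "B \<in> set Bs" "v \<in> B" by blast
  have "B \<subseteq> a" if a: "a \<in> P" "v \<in> a" for a
  proof -
    obtain B' where B': "B' \<in> set Bs" "v \<in> B'" "B' \<subseteq> a" using union[OF a] by blast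
    have "disjoint (set Bs)" using Bs by (simp add: bucket_family_def)
    from disjointD[OF this B'(1) B(1)] B B' show ?thesis by blast
  qed
  then have "card {a\<in>P. v \<in> a} \<le> card {a\<in>P. B \<subseteq> a}"
    by (intro card_mono) auto
  moreover obtain j where j: "j < length Bs" "Bs ! j = B"
    using B(1) by (auto simp: in_set_conv_nth)
  have "real (card {a\<in>P. B \<subseteq> a}) \<le> norm1_mat (bucket_mat (enum_set P) Bs)"
    using column_le_norm1_mat[of j "bucket_mat (enum_set P) Bs"] j
      sum_of_bool_nth[of P "\<lambda>a. B \<subseteq> a"]
    by (simp add: bucket_mat_def)
  ultimately show ?thesis by linarith
next
  case False
  then have "{a\<in>P. v \<in> a} = {}" by blast
  then show ?thesis by (simp only: card.empty of_nat_0 norm1_mat_nonneg)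
qed

text \<open>Links two scales: the cost of MMM is measured on buckets, whereas the condition on the
  additional rows of MMM is stated over domain values.\<close>

lemma norm1_row_mat_le_bucket_mat:
  fixes P :: "'d::finite set set"
  assumes "bucket_family R Bs" "P \<subseteq> R"
  shows "norm1_mat (row_mat P) \<le> norm1_mat (bucket_mat (enum_set P) Bs)"
proof (rule norm1_mat_le[OF norm1_mat_nonneg])
  fix j assume "j < dim_col (row_mat P)"
  then have "j < CARD('d)" by (simp add: row_mat_def)
  then have "(\<Sum>i<dim_row (row_mat P). \<bar>row_mat P $$ (i, j)\<bar>) = card {a\<in>P. enum_set UNIV ! j \<in> a}"
    by (rule row_mat_column)
  also have "\<dots> \<le> norm1_mat (bucket_mat (enum_set P) Bs)"
    by (rule card_le_norm1_bucket_mat[OF assms])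
  finally show "(\<Sum>i<dim_row (row_mat P). \<bar>row_mat P $$ (i, j)\<bar>) \<le> norm1_mat (bucket_mat (enum_set P) Bs)" .
qed

lemma kary_tree_singleton: "kary_tree k A T \<Longrightarrow> v \<in> A \<Longrightarrow> {v} \<in> T"
proof (induction rule: kary_tree.induct)
  case (leaf w)
  then show ?case by simp
next
  case (node A C T)
  have "v \<in> \<Union>C"
    using partition_onD1[OF node.hyps(1)] node.prems by (rule subst)
  then obtain c where c: "c \<in> C" "v \<in> c" by (rule UnionE)
  then have "{v} \<in> T c" using node.IH by blast
  with c(1) show ?case by blast
qed

text \<open>A minimal decomposition says something only if some decomposition exists. Cutting
  \<open>w\<close> into singletons gives one, because all singletons are leaves of the tree.\<close>

lemma strategy_subset:
  assumes T: "kary_tree k UNIV T"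
  shows "strategy T W \<subseteq> T"
proof -
  have "tree_decomposition T w \<subseteq> T" for w
  proof -
    let ?P = "\<lambda>C. C \<subseteq> T \<and> disjoint C \<and> \<Union>C = w"
    have "?P ((\<lambda>v. {v}) ` w)"
      using kary_tree_singleton[OF T] by (auto simp: disjoint_def)
    then have "?P (tree_decomposition T w)"
      unfolding tree_decomposition_def by (rule arg_min_natI)
    then show ?thesis by blast
  qed
  then show ?thesis by (auto simp: strategy_def)
qed

section \<open>The potential\<close>

text \<open>The amount by which the share of a cached response in the privacy loss, with respect to the
  value \<open>v\<close> in which the databases differ, falls short of its worst case \<open>1 / b\<close>.\<close>

definition slack :: "'d::finite multiset \<Rightarrow> 'd multiset \<Rightarrow> 'd \<Rightarrow> 'd set \<Rightarrow> real \<times> real \<times> nat \<Rightarrow> real" where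
  "slack D D' v a = (\<lambda>(b, y, t).
     if t = 0 then 0 else (of_bool (v \<in> a) - (\<bar>y - query D' a\<bar> - \<bar>y - query D a\<bar>)) / b)"

text \<open>The bookkeeping on which the privacy account rests. Equal noise parameters within a
  timestamp make \<open>group_noise\<close>, which is read off one arbitrary row, valid for the
  whole group. The bound \<open>t\<close> on the timestamps ensures that the next stamp is fresh and
  cannot merge a new group with an old one.\<close>

definition consistent :: "real \<Rightarrow> nat \<Rightarrow> 'd cache \<times> real \<Rightarrow> bool" where
  "consistent \<B> t = (\<lambda>(c, B\<^sub>c). B\<^sub>c \<le> \<B> \<and>
     (\<forall>a. timestamp (cache_table c) a \<noteq> 0 \<longrightarrow>
        0 < noise_param (cache_table c) a \<and> timestamp (cache_table c) a \<le> t) \<and>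
     (\<forall>a a'. timestamp (cache_table c) a \<noteq> 0 \<longrightarrow>
        timestamp (cache_table c) a = timestamp (cache_table c) a' \<longrightarrow>
        noise_param (cache_table c) a = noise_param (cache_table c) a'))"

lemma consistentD:
  assumes "consistent \<B> t (c, B\<^sub>c)"
  shows "B\<^sub>c \<le> \<B>"
    and "timestamp (cache_table c) a \<noteq> 0 \<Longrightarrow> 0 < noise_param (cache_table c) a"
    and "timestamp (cache_table c) a \<noteq> 0 \<Longrightarrow> timestamp (cache_table c) a \<le> t"
    and "timestamp (cache_table c) a \<noteq> 0 \<Longrightarrow> timestamp (cache_table c) a = timestamp (cache_table c) a' \<Longrightarrow>
      noise_param (cache_table c) a = noise_param (cache_table c) a'"
  using assms unfolding consistent_def prod.case by blast+

text \<open>The value 0 on inconsistent states makes every domination that starts from such a state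
  trivial, so that no separate proof is required that the interaction almost surely stays
  consistent. From a consistent state, in turn, consistency of the next state is part of the
  inequality.\<close>

definition potential :: "real \<Rightarrow> 'd::finite multiset \<Rightarrow> 'd multiset \<Rightarrow> 'd \<Rightarrow> nat \<Rightarrow> 'd cache \<times> real \<Rightarrow> ennreal" where
  "potential \<B> D D' v t = (\<lambda>(c, B\<^sub>c).
     if consistent \<B> t (c, B\<^sub>c) then ennreal (exp (B\<^sub>c - (\<Sum>a\<in>UNIV. slack D D' v a (c a)))) else 0)"

text \<open>By the triangle inequality the difference of the two distances is at most the difference
  of the two true answers.\<close>

lemma slack_nonneg:
  assumes "\<And>a. \<bar>query D a - query D' a\<bar> \<le> of_bool (v \<in> a)" and "t \<noteq> 0 \<Longrightarrow> 0 < b"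
  shows "0 \<le> slack D D' v a (b, y, t)"
proof -
  have "\<bar>y - query D' a\<bar> - \<bar>y - query D a\<bar> \<le> of_bool (v \<in> a)"
    using assms(1)[of a] by linarith
  then show ?thesis using assms(2) by (auto simp: slack_def)
qed

lemma slack_cache_nonneg:
  assumes "\<And>a. \<bar>query D a - query D' a\<bar> \<le> of_bool (v \<in> a)" and "consistent \<B> t (c, B\<^sub>c)"
  shows "0 \<le> slack D D' v a (c a)"
  using slack_nonneg[of D D' v "snd (snd (c a))" "fst (c a)" a "fst (snd (c a))"] assms(1)
    consistentD(2)[OF assms(2), of a]
  by (simp add: cache_table_def)

lemma potential_le:
  assumes "\<And>a. \<bar>query D a - query D' a\<bar> \<le> of_bool (v \<in> a)"
  shows "potential \<B> D D' v t s \<le> ennreal (exp \<B>)"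
proof -
  obtain c B\<^sub>c where s: "s = (c, B\<^sub>c)" by (cases s)
  show ?thesis
  proof (cases "consistent \<B> t s")
    case True
    have "0 \<le> (\<Sum>a\<in>UNIV. slack D D' v a (c a))"
      using True assms unfolding s by (intro sum_nonneg slack_cache_nonneg) auto
    then show ?thesis
      using True consistentD(1)[of \<B> t c B\<^sub>c] by (auto simp: potential_def s intro!: ennreal_leI)
  qed (auto simp: potential_def s)
qed

lemma consistent_mono: "consistent \<B> t s \<Longrightarrow> t \<le> t' \<Longrightarrow> consistent \<B> t' s"
  unfolding consistent_def split_beta by (meson le_trans)

text \<open>For rejected rounds, in which the state stays the same and only the clock
  advances.\<close>

lemma potential_mono: "t \<le> t' \<Longrightarrow> potential \<B> D D' v t s \<le> potential \<B> D D' v t' s"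
  using consistent_mono[of \<B> t s t'] by (cases s) (auto simp: potential_def)

text \<open>As t < t', no old valid entry carries the stamp t', so the rows stamped t' are exactly
  those just written, and these share the parameter \<open>b\<close>.\<close>

lemma consistent_update:
  assumes c: "consistent \<B> t (c, B\<^sub>c)" and "t < t'" "0 < b" "B\<^sub>c' \<le> \<B>"
  shows "consistent \<B> t' (update_cache c P b y t', B\<^sub>c')"
proof -
  define c' where "c' = update_cache c P b y t'"
  have tab: "cache_table c' a = (if a \<in> P then (b, t') else cache_table c a)" for a
    by (auto simp: c'_def cache_table_def update_cache_def)
  have old: "0 < noise_param (cache_table c) a \<and> timestamp (cache_table c) a \<le> t"
    if "timestamp (cache_table c) a \<noteq> 0" for a
    using consistentD[OF c] that by blast
  have same: "noise_param (cache_table c) a = noise_param (cache_table c) a'"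
    if "timestamp (cache_table c) a \<noteq> 0" "timestamp (cache_table c) a = timestamp (cache_table c) a'" for a a'
    using consistentD(4)[OF c] that by blast
  have "0 < noise_param (cache_table c') a \<and> timestamp (cache_table c') a \<le> t'"
    if "timestamp (cache_table c') a \<noteq> 0" for a
    using that old[of a] assms(2,3) by (auto simp: tab split: if_splits)
  moreover have "noise_param (cache_table c') a = noise_param (cache_table c') a'"
    if "timestamp (cache_table c') a \<noteq> 0" "timestamp (cache_table c') a = timestamp (cache_table c') a'" for a a'
    using that old[of a] old[of a'] same[of a a'] assms(2) by (auto simp: tab split: if_splits)
  ultimately have "consistent \<B> t' (c', B\<^sub>c')"
    using assms(4) unfolding consistent_def prod.case by blast
  then show ?thesis by (simp add: c'_def)
qed

text \<open>One step of the account: \<open>r a\<close> is the logarithm of the likelihood ratio of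
  the new response to \<open>a\<close>. Only the slacks of the rows in \<open>P\<close> change, so
  after taking logarithms the claim is the hypothesis \<open>le\<close>: ratios plus increase of
  slack are covered by \<epsilon>.\<close>

lemma potential_update:
  assumes "t < t'" "0 < b" "B\<^sub>c + \<epsilon> \<le> \<B>"
    and le: "consistent \<B> t (c, B\<^sub>c) \<Longrightarrow>
       (\<Sum>a\<in>P. r a + slack D D' v a (b, y a, t') - slack D D' v a (c a)) \<le> \<epsilon>"
  shows "potential \<B> D D' v t (c, B\<^sub>c) * (\<Prod>a\<in>P. ennreal (exp (r a)))
    \<le> potential \<B> D D' v t' (update_cache c P b y t', B\<^sub>c + \<epsilon>)"
proof (cases "consistent \<B> t (c, B\<^sub>c)")
  case True
  let ?c = "update_cache c P b y t'"
  have "(\<Sum>a\<in>UNIV. slack D D' v a (?c a)) - (\<Sum>a\<in>UNIV. slack D D' v a (c a))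
      = (\<Sum>a\<in>P. slack D D' v a (b, y a, t') - slack D D' v a (c a))"
    unfolding sum_subtractf[symmetric]
    by (intro sum.mono_neutral_cong_right) (auto simp: update_cache_def)
  then have "(\<Sum>a\<in>P. r a) + (\<Sum>a\<in>UNIV. slack D D' v a (?c a)) - (\<Sum>a\<in>UNIV. slack D D' v a (c a)) \<le> \<epsilon>"
    using le[OF True] by (simp add: sum.distrib sum_subtractf algebra_simps)
  then have "exp (B\<^sub>c - (\<Sum>a\<in>UNIV. slack D D' v a (c a))) * exp (\<Sum>a\<in>P. r a)
      \<le> exp (B\<^sub>c + \<epsilon> - (\<Sum>a\<in>UNIV. slack D D' v a (?c a)))"
    by (simp add: exp_add[symmetric])
  then show ?thesis
    using True consistent_update[OF True assms(1,2,3)]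
    by (simp add: potential_def exp_sum prod_ennreal ennreal_mult'[symmetric] ennreal_leI)
qed (simp add: potential_def)

section \<open>Measurability of the potential\<close>

lemma measurable_cache_entry [measurable]:
  "(\<lambda>c. c a) \<in> cache_space \<rightarrow>\<^sub>M borel \<Otimes>\<^sub>M borel \<Otimes>\<^sub>M count_space UNIV"
  unfolding cache_space_def by (rule measurable_component_singleton) simp

lemma measurable_table_entry [measurable]:
  "(\<lambda>tab. tab a) \<in> table_space \<rightarrow>\<^sub>M borel \<Otimes>\<^sub>M count_space UNIV"
  unfolding table_space_def by (rule measurable_component_singleton) simp

lemma measurable_cache_table [measurable]: "cache_table \<in> cache_space \<rightarrow>\<^sub>M table_space"
  unfolding table_space_def
proof (rule measurable_PiM_single')
  show "(\<lambda>c. cache_table c a) \<in> cache_space \<rightarrow>\<^sub>M borel \<Otimes>\<^sub>M count_space UNIV" for a :: "'a set"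
    unfolding cache_table_def by measurable
qed (auto simp: space_pair_measure)

lemma measurable_potential [measurable]:
  fixes D :: "'d::finite multiset"
  shows "potential \<B> D D' v t \<in> borel_measurable (cache_space \<Otimes>\<^sub>M borel)"
proof -
  have entry [measurable]: "(\<lambda>s. fst s a) \<in> cache_space \<Otimes>\<^sub>M borel \<rightarrow>\<^sub>M borel \<Otimes>\<^sub>M borel \<Otimes>\<^sub>M count_space UNIV" for a
    by (rule measurable_compose[OF measurable_fst measurable_cache_entry])
  have [measurable]: "slack D D' v a \<in> borel_measurable (borel \<Otimes>\<^sub>M borel \<Otimes>\<^sub>M count_space UNIV)" for a
    unfolding slack_def by measurable
  then have [measurable]: "(\<lambda>s. slack D D' v a (fst s a)) \<in> borel_measurable (cache_space \<Otimes>\<^sub>M borel)" for a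
    by (rule measurable_compose[OF entry])
  have tab: "(\<lambda>s. cache_table (fst s) a) \<in> cache_space \<Otimes>\<^sub>M borel \<rightarrow>\<^sub>M borel \<Otimes>\<^sub>M count_space UNIV" for a
    by (intro measurable_compose[OF _ measurable_table_entry] measurable_compose[OF measurable_fst measurable_cache_table])
  have noise: "(\<lambda>s. noise_param (cache_table (fst s)) a) \<in> borel_measurable (cache_space \<Otimes>\<^sub>M borel)"
    and time: "(\<lambda>s. timestamp (cache_table (fst s)) a) \<in> cache_space \<Otimes>\<^sub>M borel \<rightarrow>\<^sub>M count_space UNIV" for a
    by (auto intro: measurable_compose[OF tab])
  \<comment> \<open>The timestamp is named by a quantified natural number. This turns each condition
    into a countable conjunction of conditions with a fixed timestamp, whose measurability is
    evident.\<close>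
  define Q where "Q a s \<longleftrightarrow> (\<forall>k. timestamp (cache_table (fst s)) a = k \<longrightarrow> k \<noteq> 0 \<longrightarrow>
      0 < noise_param (cache_table (fst s)) a \<and> k \<le> t)"
    for a and s :: "'d cache \<times> real"
  define R where "R a a' s \<longleftrightarrow> (\<forall>k. timestamp (cache_table (fst s)) a = k \<longrightarrow> k \<noteq> 0 \<longrightarrow>
      k = timestamp (cache_table (fst s)) a' \<longrightarrow>
      noise_param (cache_table (fst s)) a = noise_param (cache_table (fst s)) a')"
    for a a' and s :: "'d cache \<times> real"
  have [measurable]: "Measurable.pred M (\<lambda>s. \<forall>k. n s = k \<longrightarrow> k \<noteq> 0 \<longrightarrow> 0 < x s \<and> k \<le> t)"
      "Measurable.pred M (\<lambda>s. \<forall>k. n s = k \<longrightarrow> k \<noteq> 0 \<longrightarrow> k = n' s \<longrightarrow> x s = x' s)"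
    if [measurable]: "n \<in> M \<rightarrow>\<^sub>M count_space UNIV" "n' \<in> M \<rightarrow>\<^sub>M count_space UNIV"
      "x \<in> borel_measurable M" "x' \<in> borel_measurable M"
    for M and n n' :: "'d cache \<times> real \<Rightarrow> nat" and x x' :: "'d cache \<times> real \<Rightarrow> real"
    by measurable
  note this[OF time time noise noise]
  then have [measurable]: "Measurable.pred (cache_space \<Otimes>\<^sub>M borel) (Q a)"
    "Measurable.pred (cache_space \<Otimes>\<^sub>M borel) (R a a')" for a a'
    unfolding Q_def R_def by blast+
  have "Measurable.pred (cache_space \<Otimes>\<^sub>M borel) (\<lambda>s. snd s \<le> \<B> \<and> (\<forall>a. Q a s) \<and> (\<forall>a a'. R a a' s))"
    by measurable
  also have "(\<lambda>s. snd s \<le> \<B> \<and> (\<forall>a. Q a s) \<and> (\<forall>a a'. R a a' s)) = consistent \<B> t"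
    unfolding consistent_def split_beta Q_def R_def by (simp only: simp_thms)
  finally have [measurable]: "Measurable.pred (cache_space \<Otimes>\<^sub>M borel)
    (consistent \<B> t :: 'd cache \<times> real \<Rightarrow> bool)" .
  show ?thesis
    unfolding potential_def split_beta prod.collapse by measurable
qed

section \<open>Release of noisy responses\<close>

lemma measurable_positive_reals [measurable]: "(\<lambda>b. b) \<in> positive_reals \<rightarrow>\<^sub>M borel"
  unfolding positive_reals_def by (rule measurable_restrict_space1) simp

lemma space_positive_reals: "space positive_reals = {0<..}"
  by (simp add: positive_reals_def space_restrict_space)

text \<open>The scale is the outcome of a randomized search, so the noise has to be a measurable
  kernel in it. This follows from joint measurability of the density in scale and value.\<close>

lemma measurable_laplace: "laplace \<in> positive_reals \<rightarrow>\<^sub>M prob_algebra borel"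
proof (rule measurable_prob_algebraI)
  show "prob_space (laplace b)" if "b \<in> space positive_reals" for b
    using that by (intro prob_space_laplace) (simp add: space_positive_reals)
  show "laplace \<in> positive_reals \<rightarrow>\<^sub>M subprob_algebra borel"
  proof (rule measurable_subprob_algebra)
    fix A :: "real set" assume [measurable]: "A \<in> sets borel"
    have [measurable]: "(\<lambda>(b, v). laplace_density b v) \<in> borel_measurable (borel \<Otimes>\<^sub>M borel)"
      unfolding laplace_density_def by measurable
    have "(\<lambda>b. \<integral>\<^sup>+v. ennreal (laplace_density b v) * indicator A v \<partial>lborel) \<in> borel_measurable borel"
      by measurable
    then show "(\<lambda>b. emeasure (laplace b) A) \<in> borel_measurable positive_reals"
      unfolding positive_reals_def
      by (intro measurable_restrict_space1) (simp add: laplace_def emeasure_density)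
  qed (auto simp: sets_laplace space_positive_reals intro!: prob_space_imp_subprob_space prob_space_laplace)
qed

text \<open>The noise-down kernel is a probability measure only for \<open>0 < b < b\<^sub>o\<close>; the value elsewhere is arbitrary.\<close>

definition total_noise_down :: "real \<times> real \<times> real \<Rightarrow> real measure" where
  "total_noise_down = (\<lambda>(b, b\<^sub>o, u). if 0 < b \<and> b < b\<^sub>o then noise_down b b\<^sub>o u else return borel 0)"

text \<open>\<open>measurable_noise_down\<close> lets only the old noise vary. In the interaction
  the new scale comes from the search and the old scale from the cache, so measurability is needed
  in all three arguments jointly.\<close>

lemma measurable_total_noise_down:
  "total_noise_down \<in> borel \<Otimes>\<^sub>M borel \<Otimes>\<^sub>M borel \<rightarrow>\<^sub>M prob_algebra borel"
proof (rule measurable_prob_algebraI)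
  show prob: "prob_space (total_noise_down x)" for x
    by (auto simp: total_noise_down_def split_beta intro!: prob_space_noise_down prob_space_return)
  show "total_noise_down \<in> borel \<Otimes>\<^sub>M borel \<Otimes>\<^sub>M borel \<rightarrow>\<^sub>M subprob_algebra borel"
  proof (rule measurable_subprob_algebra)
    fix A :: "real set" assume A [measurable]: "A \<in> sets borel"
    have [measurable]: "(\<lambda>x. laplace_density (f x) (g x)) \<in> borel_measurable M"
      if [measurable]: "f \<in> borel_measurable M" "g \<in> borel_measurable M" for f g and M :: "'x measure"
      unfolding laplace_density_def by measurable
    have "(\<lambda>x. if 0 < fst x \<and> fst x < fst (snd x) then
          ennreal ((fst x / fst (snd x))\<^sup>2 * laplace_density (fst x) (snd (snd x)) / laplace_density (fst (snd x)) (snd (snd x))) * indicator A (snd (snd x)) +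
           (\<integral>\<^sup>+v. ennreal ((1 - (fst x / fst (snd x))\<^sup>2) * laplace_density (fst x) v * laplace_density (fst (snd x)) (snd (snd x) - v)
              / laplace_density (fst (snd x)) (snd (snd x))) * indicator A v \<partial>lborel)
        else indicator A 0) \<in> borel_measurable (borel \<Otimes>\<^sub>M borel \<Otimes>\<^sub>M borel :: (real \<times> real \<times> real) measure)"
      by measurable
    then show "(\<lambda>x. emeasure (total_noise_down x) A) \<in> borel_measurable (borel \<Otimes>\<^sub>M borel \<Otimes>\<^sub>M borel)"
      by (rule measurable_cong[THEN iffD1, rotated])
        (auto simp: total_noise_down_def split_beta emeasure_noise_down A)
  next
    show "subprob_space (total_noise_down x)" for x
      by (rule prob_space_imp_subprob_space[OF prob])
    show "sets (total_noise_down x) = sets borel" for x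
      by (simp add: total_noise_down_def split_beta)
  qed
qed

section \<open>Measurability of the answer and of the updated cache\<close>

lemma enum_set_nth: "finite A \<Longrightarrow> i < length (enum_set A) \<Longrightarrow> enum_set A ! i \<in> A"
  using nth_mem[of i "enum_set A"] set_enum_set[of A] by simp

lemma answer_cong:
  assumes "\<And>a. a \<in> R \<Longrightarrow> y a = y' a"
  shows "answer S W (R :: 'd::finite set set) y = answer S W R y'"
proof -
  have "vec (length (enum_set R)) (\<lambda>i. y (enum_set R ! i)) = vec (length (enum_set R)) (\<lambda>i. y' (enum_set R ! i))"
    using assms enum_set_nth[of R] by (intro eq_vecI) auto
  then show ?thesis by (simp add: answer_def Let_def cong: if_cong)
qed

text \<open>With \<open>W\<close> and \<open>R\<close> fixed, the reconstruction matrix is constant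
  and each entry of the answer is a finite linear combination of the noisy responses.\<close>

lemma measurable_answer:
  fixes R :: "'d::finite set set"
  assumes y: "\<And>a. a \<in> R \<Longrightarrow> (\<lambda>x. y x a) \<in> borel_measurable M"
  shows "(\<lambda>x. answer S W R (y x)) \<in> M \<rightarrow>\<^sub>M response_space"
proof -
  define rs where "rs = enum_set R"
  define A where "A = bucket_mat W (buckets S W R) * pinv_mat (bucket_mat rs (buckets S W R))"
  have [measurable]: "(\<lambda>x. y x (rs ! j)) \<in> borel_measurable M" if "j < length rs" for j
    using y enum_set_nth[of R j] that unfolding rs_def by simp
  have "(\<lambda>x. if i < length W then (A *\<^sub>v vec (length rs) (\<lambda>j. y x (rs ! j))) $ i else 0) \<in> borel_measurable M" for i
  proof (cases "i < length W")
    case True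
    then have "i < dim_row A" by (simp add: A_def bucket_mat_def)
    then have "(A *\<^sub>v vec (length rs) (\<lambda>j. y x (rs ! j))) $ i = (\<Sum>j\<in>{0..<length rs}. row A i $ j * y x (rs ! j))" for x
      by (simp add: scalar_prod_def)
    moreover have "(\<lambda>x. \<Sum>j\<in>{0..<length rs}. row A i $ j * y x (rs ! j)) \<in> borel_measurable M"
      by (intro borel_measurable_sum borel_measurable_times borel_measurable_const) auto
    ultimately show ?thesis using True by simp
  qed simp
  then have "(\<lambda>x i. if i < length W then (A *\<^sub>v vec (length rs) (\<lambda>j. y x (rs ! j))) $ i else 0)
      \<in> M \<rightarrow>\<^sub>M (\<Pi>\<^sub>M i\<in>UNIV. borel)"
    by (intro measurable_PiM_single') auto
  then have "(\<lambda>x. (Some (length W), \<lambda>i. if i < length W then (A *\<^sub>v vec (length rs) (\<lambda>j. y x (rs ! j))) $ i else 0))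
      \<in> M \<rightarrow>\<^sub>M response_space"
    unfolding response_space_def by (intro measurable_Pair measurable_const) auto
  then show ?thesis by (simp add: answer_def Let_def A_def rs_def cong: if_cong)
qed

lemma measurable_update_cache:
  fixes P :: "'d::finite set set"
  assumes [measurable]: "c \<in> M \<rightarrow>\<^sub>M cache_space" "b \<in> borel_measurable M"
    and y: "\<And>a. a \<in> P \<Longrightarrow> (\<lambda>x. y x a) \<in> borel_measurable M"
  shows "(\<lambda>x. update_cache (c x) P (b x) (y x) t) \<in> M \<rightarrow>\<^sub>M cache_space"
  unfolding cache_space_def
proof (rule measurable_PiM_single')
  show "(\<lambda>x. update_cache (c x) P (b x) (y x) t a) \<in> M \<rightarrow>\<^sub>M borel \<Otimes>\<^sub>M borel \<Otimes>\<^sub>M count_space UNIV" for a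
  proof (cases "a \<in> P")
    case True
    note [measurable] = y[OF True]
    show ?thesis using True by (simp add: update_cache_def)
  next
    case False
    then show ?thesis
      using measurable_compose[OF assms(1) measurable_cache_entry] by (simp add: update_cache_def)
  qed
qed (auto simp: space_pair_measure)

text \<open>The part that MMM and RP have in common, with an empty set \<open>F\<close> for RP. The
  database does not occur in it: given the cache and the new noisy responses, the output is
  post-processing.\<close>

definition released :: "'d::finite cachedp \<Rightarrow> 'd workload \<Rightarrow> 'd set set \<Rightarrow> 'd set set \<Rightarrow> 'd set set
    \<Rightarrow> real \<Rightarrow> nat \<Rightarrow> 'd cache \<Rightarrow> ('d set \<Rightarrow> real) \<Rightarrow> response \<times> 'd cache" where
  "released S W R F P b t c y =
     (answer S W R (\<lambda>a. if a \<in> F then cached_response c a else y a), update_cache c P b y t)"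

text \<open>The law of the responses rather than of the noise. In these coordinates the two
  databases give measures on the same space whose likelihood ratio is the relevant one.\<close>

definition noisy_rows :: "'d::finite multiset \<Rightarrow> 'd set set \<Rightarrow> ('d set \<Rightarrow> real measure) \<Rightarrow> ('d set \<Rightarrow> real) measure" where
  "noisy_rows D P N = (\<Pi>\<^sub>M a\<in>P. distr (N a) borel ((+) (query D a)))"

abbreviation release_space :: "(response \<times> 'd::finite cache) measure" where
  "release_space \<equiv> response_space \<Otimes>\<^sub>M cache_space"

lemma sets_noisy_rows: "sets (noisy_rows D P N) = sets (\<Pi>\<^sub>M a\<in>P. borel)"
  unfolding noisy_rows_def by (intro sets_PiM_cong) auto

lemma measurable_released:
  assumes R: "R \<subseteq> F \<union> P" and c: "c \<in> M \<rightarrow>\<^sub>M cache_space" and b: "b \<in> borel_measurable M"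
    and y: "\<And>a. a \<in> P \<Longrightarrow> (\<lambda>x. y x a) \<in> borel_measurable M"
  shows "(\<lambda>x. released S W R F P (b x) t (c x) (y x)) \<in> M \<rightarrow>\<^sub>M release_space"
  unfolding released_def
proof (intro measurable_Pair measurable_answer measurable_update_cache c b y)
  fix a assume "a \<in> R"
  then have "a \<in> F \<or> a \<in> P" using R by blast
  moreover have "(\<lambda>x. fst (snd (c x a))) \<in> borel_measurable M"
    using measurable_compose[OF c measurable_cache_entry[of a]] by measurable
  ultimately show "(\<lambda>x. if a \<in> F then cached_response (c x) a else y x a) \<in> borel_measurable M"
    using y by (cases "a \<in> F") (auto simp: cached_response_def)
qed

lemma measurable_released_rows:
  assumes "R \<subseteq> F \<union> P"
  shows "released S W R F P b t c \<in> (\<Pi>\<^sub>M a\<in>P. borel) \<rightarrow>\<^sub>M release_space"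
  by (rule measurable_released[OF assms])
    (auto simp: cache_space_def space_PiM space_pair_measure intro: measurable_component_singleton)

lemma released_cong:
  assumes "R \<subseteq> F \<union> P" "\<And>a. a \<in> P \<Longrightarrow> y a = y' a"
  shows "released S W R F P b t c y = released S W R F P b t c y'"
proof -
  have "answer S W R (\<lambda>a. if a \<in> F then cached_response c a else y a)
      = answer S W R (\<lambda>a. if a \<in> F then cached_response c a else y' a)"
    using assms by (intro answer_cong) auto
  then show ?thesis using assms(2) by (auto simp: released_def update_cache_def)
qed

text \<open>Moves the true answers out of the post-processing and into the noise, so that afterwards
  the database enters through \<open>noisy_rows\<close> alone.\<close>

lemma bind_noise_eq_distr:
  fixes S :: "'d::finite cachedp"
  assumes R: "R \<subseteq> F \<union> P" and N: "\<And>a. prob_space (N a)" "\<And>a. sets (N a) = sets borel"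
  shows "((\<Pi>\<^sub>M a\<in>P. N a) \<bind> (\<lambda>\<eta>. return release_space (released S W R F P b t c (\<lambda>a. query D a + \<eta> a))))
    = distr (noisy_rows D P N) release_space (released S W R F P b t c)"
proof -
  have PN: "sets (\<Pi>\<^sub>M a\<in>P. N a) = sets (\<Pi>\<^sub>M a\<in>P. borel)"
    using N by (intro sets_PiM_cong) auto
  have meas: "(\<lambda>\<eta>. \<lambda>a\<in>P. query D a + \<eta> a) \<in> (\<Pi>\<^sub>M a\<in>P. N a) \<rightarrow>\<^sub>M (\<Pi>\<^sub>M a\<in>P. borel)"
    unfolding measurable_cong_sets[OF PN refl]
    by (intro measurable_restrict borel_measurable_add borel_measurable_const measurable_component_singleton)
  have ne: "space (\<Pi>\<^sub>M a\<in>P. N a) \<noteq> {}"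
    using N by (intro prob_space.not_empty prob_space_PiM)
  \<comment> \<open>Points of the product space are \<open>undefined\<close> outside
    \<open>P\<close>, so the shifted noise has to be restricted to \<open>P\<close> to lie in it.
    \<open>released\<close> reads no other coordinates, since the remaining rows of \<open>R\<close>
    are taken from the cache.\<close>
  have cong: "released S W R F P b t c (\<lambda>a. query D a + \<eta> a)
      = released S W R F P b t c (\<lambda>a\<in>P. query D a + \<eta> a)" for \<eta>
    by (rule released_cong[OF R]) auto
  have "((\<Pi>\<^sub>M a\<in>P. N a) \<bind> (\<lambda>\<eta>. return release_space (released S W R F P b t c (\<lambda>a. query D a + \<eta> a))))
      = distr (\<Pi>\<^sub>M a\<in>P. N a) release_space (\<lambda>\<eta>. released S W R F P b t c (\<lambda>a\<in>P. query D a + \<eta> a))"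
    unfolding cong by (intro bind_return_distr' ne measurable_compose[OF meas measurable_released_rows[OF R]])
  also have "\<dots> = distr (distr (\<Pi>\<^sub>M a\<in>P. N a) (\<Pi>\<^sub>M a\<in>P. borel) (\<lambda>\<eta>. \<lambda>a\<in>P. query D a + \<eta> a))
      release_space (released S W R F P b t c)"
    by (subst distr_distr[OF measurable_released_rows[OF R] meas]) (simp add: comp_def)
  also have "distr (\<Pi>\<^sub>M a\<in>P. N a) (\<Pi>\<^sub>M a\<in>P. borel) (\<lambda>\<eta>. \<lambda>a\<in>P. query D a + \<eta> a) = noisy_rows D P N"
    unfolding noisy_rows_def using N
    by (intro PiM_distr[symmetric]) (auto cong: measurable_cong_sets)
  finally show ?thesis .
qed

lemma run_mmm_eq:
  fixes S :: "'d::finite cachedp"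
  assumes "0 < b"
  shows "run_mmm S D t W R b c =
    (let F = free_rows S R b (cache_table c);
         P = paid_rows S R b (cache_table c) \<union> extra S W R b (cache_table c)
     in distr (noisy_rows D P (\<lambda>_. laplace b)) release_space (released S W R F P b t c))"
proof -
  define F where "F = free_rows S R b (cache_table c)"
  define P where "P = paid_rows S R b (cache_table c) \<union> extra S W R b (cache_table c)"
  have R: "R \<subseteq> F \<union> P" by (auto simp: F_def P_def paid_rows_def)
  have "run_mmm S D t W R b c
      = ((\<Pi>\<^sub>M a\<in>P. laplace b) \<bind> (\<lambda>\<eta>. return release_space (released S W R F P b t c (\<lambda>a. query D a + \<eta> a))))"
    by (simp add: run_mmm_def released_def query_def F_def P_def Let_def)
  also have "\<dots> = distr (noisy_rows D P (\<lambda>_. laplace b)) release_space (released S W R F P b t c)"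
    using assms by (intro bind_noise_eq_distr R prob_space_laplace sets_laplace)
  finally show ?thesis by (simp add: F_def P_def Let_def)
qed

lemma run_rp_eq:
  fixes S :: "'d::finite cachedp"
  assumes "j = pick_group S R b (cache_table c)" and j: "j \<in> rp_candidates S R b (cache_table c)" and b: "0 < b"
  shows "run_rp S D t W R b c =
    distr (noisy_rows D (group_rows S (cache_table c) j)
        (\<lambda>a. noise_down b (group_noise S (cache_table c) j) (cached_response c a - query D a)))
      release_space (released S W R {} (group_rows S (cache_table c) j) b t c)"
proof -
  have R: "R \<subseteq> {} \<union> group_rows S (cache_table c) j" and b\<^sub>o: "b < group_noise S (cache_table c) j"
    using j by (auto simp: rp_candidates_def)
  have "run_rp S D t W R b c = ((\<Pi>\<^sub>M a\<in>group_rows S (cache_table c) j.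
        noise_down b (group_noise S (cache_table c) j) (cached_response c a - query D a))
      \<bind> (\<lambda>\<eta>. return release_space (released S W R {} (group_rows S (cache_table c) j) b t c (\<lambda>a. query D a + \<eta> a))))"
    by (simp add: run_rp_def released_def query_def Let_def assms(1))
  also have "\<dots> = distr (noisy_rows D (group_rows S (cache_table c) j)
        (\<lambda>a. noise_down b (group_noise S (cache_table c) j) (cached_response c a - query D a)))
      release_space (released S W R {} (group_rows S (cache_table c) j) b t c)"
    using b b\<^sub>o by (intro bind_noise_eq_distr R prob_space_noise_down sets_noise_down)
  finally show ?thesis .
qed

text \<open>Common core of MMM and RP. By independence the log-ratios \<open>r\<close> add up over
  \<open>P\<close>, \<open>potential_update\<close> absorbs their sum for every vector of responses,
  and the post-processing is a pushforward.\<close>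

lemma dominated_release:
  fixes D D' :: "'d::finite multiset"
  assumes R: "R \<subseteq> F \<union> P"
    and N: "\<And>a. prob_space (N a)" "\<And>a. sets (N a) = sets borel"
      "\<And>a. prob_space (N' a)" "\<And>a. sets (N' a) = sets borel"
    and shift: "\<And>a. a \<in> P \<Longrightarrow> distr (N a) borel ((+) (query D a))
       = density (distr (N' a) borel ((+) (query D' a))) (\<lambda>y. ennreal (exp (r a y)))"
    and r: "\<And>a. r a \<in> borel_measurable borel"
    and t: "t < t'" and b: "0 < b" and \<epsilon>: "B\<^sub>c + \<epsilon> \<le> \<B>"
    and le: "\<And>y. consistent \<B> t (c, B\<^sub>c) \<Longrightarrow>
       (\<Sum>a\<in>P. r a (y a) + slack D D' v a (b, y a, t') - slack D D' v a (c a)) \<le> \<epsilon>"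
  shows "dominated release_space (potential \<B> D D' v t (c, B\<^sub>c))
      (distr (noisy_rows D P N) release_space (released S W R F P b t' c))
      (\<lambda>(resp, c'). potential \<B> D D' v t' (c', B\<^sub>c + \<epsilon>))
      (distr (noisy_rows D' P N') release_space (released S W R F P b t' c))"
proof -
  \<comment> \<open>\<open>PiM_density\<close> wants probability measures before and after
    reweighting. The reweighted factors are such because, by \<open>shift\<close>, they are the
    response laws under \<open>D\<close>.\<close>
  have prob: "prob_space (distr (N a) borel ((+) (query D a)))"
    "prob_space (distr (N' a) borel ((+) (query D' a)))" for a
    using N by (auto intro!: prob_space.prob_space_distr cong: measurable_cong_sets)
  have "noisy_rows D P N = (\<Pi>\<^sub>M a\<in>P. density (distr (N' a) borel ((+) (query D' a))) (\<lambda>y. ennreal (exp (r a y))))"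
    unfolding noisy_rows_def by (intro PiM_cong refl shift) simp
  also have "\<dots> = density (noisy_rows D' P N') (\<lambda>y. \<Prod>a\<in>P. ennreal (exp (r a (y a))))"
    unfolding noisy_rows_def using prob r
    by (intro PiM_density) (auto simp flip: shift)
  finally have dens: "noisy_rows D P N = density (noisy_rows D' P N') (\<lambda>y. \<Prod>a\<in>P. ennreal (exp (r a (y a))))" .
  have "dominated (\<Pi>\<^sub>M a\<in>P. borel) (potential \<B> D D' v t (c, B\<^sub>c))
      (density (noisy_rows D' P N') (\<lambda>y. \<Prod>a\<in>P. ennreal (exp (r a (y a)))))
      (\<lambda>y. (\<lambda>(resp, c'). potential \<B> D D' v t' (c', B\<^sub>c + \<epsilon>)) (released S W R F P b t' c y))
      (noisy_rows D' P N')"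
  proof (rule dominated_density[OF sets_noisy_rows])
    have "(\<lambda>y. r a (y a)) \<in> borel_measurable (\<Pi>\<^sub>M a\<in>P. borel)" if "a \<in> P" for a
      by (rule measurable_compose[where f="\<lambda>y. y a" and g="r a", OF _ r])
        (rule measurable_component_singleton[OF that])
    then have "(\<lambda>y. ennreal (exp (r a (y a)))) \<in> borel_measurable (\<Pi>\<^sub>M a\<in>P. borel)" if "a \<in> P" for a
      using that by measurable
    then show "(\<lambda>y. \<Prod>a\<in>P. ennreal (exp (r a (y a)))) \<in> borel_measurable (\<Pi>\<^sub>M a\<in>P. borel)"
      by (rule borel_measurable_prod_ennreal)
    show "potential \<B> D D' v t (c, B\<^sub>c) * (\<Prod>a\<in>P. ennreal (exp (r a (y a))))
        \<le> (\<lambda>(resp, c'). potential \<B> D D' v t' (c', B\<^sub>c + \<epsilon>)) (released S W R F P b t' c y)" for y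
      unfolding released_def prod.case by (rule potential_update[OF t b \<epsilon> le])
  qed
  then have "dominated (\<Pi>\<^sub>M a\<in>P. borel) (potential \<B> D D' v t (c, B\<^sub>c)) (noisy_rows D P N)
      (\<lambda>y. (\<lambda>(resp, c'). potential \<B> D D' v t' (c', B\<^sub>c + \<epsilon>)) (released S W R F P b t' c y))
      (noisy_rows D' P N')"
    by (simp only: dens)
  then show ?thesis
    by (rule dominated_distr[OF _ sets_noisy_rows sets_noisy_rows measurable_released_rows[OF R]]) measurable
qed

section \<open>Domination for the two mechanisms\<close>

lemma sum_le_count:
  fixes P :: "'d::finite set set"
  assumes "\<And>a. a \<in> P \<Longrightarrow> f a \<le> of_bool (v \<in> a) * k"
  shows "sum f P \<le> real (card {a\<in>P. v \<in> a}) * (k::real)"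
proof -
  have "sum f P \<le> (\<Sum>a\<in>P. of_bool (v \<in> a)) * k"
    unfolding sum_distrib_right by (intro sum_mono assms)
  then show ?thesis by (simp add: sum_of_bool_eq Int_def conj_commute)
qed

lemma dominated_run_mmm:
  fixes D D' :: "'d::finite multiset"
  assumes S: "valid_cachedp S" and R: "R \<subseteq> global_strategy S"
    and DD': "\<And>a. \<bar>query D a - query D' a\<bar> \<le> of_bool (v \<in> a)"
    and t: "t < t'" and b: "0 < b" and \<epsilon>: "B\<^sub>c + mmm_cost S W R b (cache_table c) \<le> \<B>"
  shows "dominated release_space (potential \<B> D D' v t (c, B\<^sub>c)) (run_mmm S D t' W R b c)
    (\<lambda>(resp, c'). potential \<B> D D' v t' (c', B\<^sub>c + mmm_cost S W R b (cache_table c))) (run_mmm S D' t' W R b c)"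
proof -
  define tab where "tab = cache_table c"
  define F where "F = free_rows S R b tab"
  define P where "P = paid_rows S R b tab \<union> extra S W R b tab"
  have RFP: "R \<subseteq> F \<union> P" by (auto simp: F_def P_def paid_rows_def)
  \<comment> \<open>The rows in \<open>P\<close> include the additional ones, for which no cost is
    charged. They do not raise the norm over domain values, and for the paid rows that norm is at
    most the bucket norm entering the cost.\<close>
  have "real (card {a\<in>P. v \<in> a}) \<le> norm1_mat (row_mat P)"
    by (rule card_le_norm1_row_mat)
  also have "\<dots> \<le> norm1_mat (row_mat (paid_rows S R b tab))"
    using S by (simp add: valid_cachedp_def P_def)
  also have "\<dots> \<le> norm1_mat (bucket_mat (enum_set (paid_rows S R b tab)) (buckets S W R))"
    using S R by (intro norm1_row_mat_le_bucket_mat[of R]) (auto simp: valid_cachedp_def paid_rows_def)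
  finally have count: "real (card {a\<in>P. v \<in> a}) * (1 / b) \<le> mmm_cost S W R b tab"
    using b by (simp add: mmm_cost_def divide_right_mono)
  define r where "r a y = (\<bar>y - query D' a\<bar> - \<bar>y - query D a\<bar>) / b" for a y
  have "dominated release_space (potential \<B> D D' v t (c, B\<^sub>c))
      (distr (noisy_rows D P (\<lambda>_. laplace b)) release_space (released S W R F P b t' c))
      (\<lambda>(resp, c'). potential \<B> D D' v t' (c', B\<^sub>c + mmm_cost S W R b tab))
      (distr (noisy_rows D' P (\<lambda>_. laplace b)) release_space (released S W R F P b t' c))"
  proof (rule dominated_release[where r=r, OF RFP])
    show "distr (laplace b) borel ((+) (query D a)) =
        density (distr (laplace b) borel ((+) (query D' a))) (\<lambda>y. ennreal (exp (r a y)))" for a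
      unfolding r_def by (rule laplace_shift[OF b])
    show "r a \<in> borel_measurable borel" for a
      unfolding r_def by measurable
    fix y assume c: "consistent \<B> t (c, B\<^sub>c)"
    have "(\<Sum>a\<in>P. r a (y a) + slack D D' v a (b, y a, t') - slack D D' v a (c a))
        \<le> real (card {a\<in>P. v \<in> a}) * (1 / b)"
    proof (rule sum_le_count)
      fix a
      \<comment> \<open>The log-ratio of a fresh response and its shortfall add up to the worst
        case, whatever the value \<open>y a\<close> turns out to be.\<close>
      have "r a (y a) + slack D D' v a (b, y a, t') = of_bool (v \<in> a) * (1 / b)"
        using t by (simp add: slack_def r_def flip: add_divide_distrib)
      then show "r a (y a) + slack D D' v a (b, y a, t') - slack D D' v a (c a) \<le> of_bool (v \<in> a) * (1 / b)"
        using slack_cache_nonneg[OF DD' c] by simp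
    qed
    with count show "(\<Sum>a\<in>P. r a (y a) + slack D D' v a (b, y a, t') - slack D D' v a (c a)) \<le> mmm_cost S W R b tab"
      by linarith
  qed (use b t \<epsilon> in \<open>auto simp: sets_laplace prob_space_laplace tab_def\<close>)
  then show ?thesis
    unfolding run_mmm_eq[OF b] Let_def F_def P_def tab_def .
qed

lemma dominated_run_rp:
  fixes D D' :: "'d::finite multiset"
  assumes j: "j = pick_group S R b (cache_table c)" "j \<in> rp_candidates S R b (cache_table c)"
    and t: "t < t'" and b: "0 < b" and \<epsilon>: "B\<^sub>c + rp_cost S b (cache_table c) j \<le> \<B>"
  shows "dominated release_space (potential \<B> D D' v t (c, B\<^sub>c)) (run_rp S D t' W R b c)
    (\<lambda>(resp, c'). potential \<B> D D' v t' (c', B\<^sub>c + rp_cost S b (cache_table c) j)) (run_rp S D' t' W R b c)"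
proof -
  define tab where "tab = cache_table c"
  define P where "P = group_rows S tab j"
  define b\<^sub>o where "b\<^sub>o = group_noise S tab j"
  have RP: "R \<subseteq> {} \<union> P" and bb\<^sub>o: "b < b\<^sub>o" and ne: "P \<noteq> {}"
    using j(2) by (auto simp: rp_candidates_def P_def b\<^sub>o_def tab_def)
  \<comment> \<open>Because the noise decreases, the factor is nonnegative, and the number of
    affected rows may be replaced by the norm of the group.\<close>
  have "0 \<le> 1 / b - 1 / b\<^sub>o"
    using b bb\<^sub>o by (simp add: frac_le)
  then have "real (card {a\<in>P. v \<in> a}) * (1 / b - 1 / b\<^sub>o) \<le> norm1_mat (row_mat P) * (1 / b - 1 / b\<^sub>o)"
    by (intro mult_right_mono card_le_norm1_row_mat)
  also have "\<dots> = rp_cost S b tab j"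
    by (simp add: rp_cost_def P_def b\<^sub>o_def algebra_simps)
  finally have count: "real (card {a\<in>P. v \<in> a}) * (1 / b - 1 / b\<^sub>o) \<le> rp_cost S b tab j" .
  define z where "z = cached_response c"
  define r where "r a y = (\<bar>y - query D' a\<bar> - \<bar>y - query D a\<bar>) / b - (\<bar>z a - query D' a\<bar> - \<bar>z a - query D a\<bar>) / b\<^sub>o" for a y
  have "dominated release_space (potential \<B> D D' v t (c, B\<^sub>c))
      (distr (noisy_rows D P (\<lambda>a. noise_down b b\<^sub>o (z a - query D a))) release_space (released S W R {} P b t' c))
      (\<lambda>(resp, c'). potential \<B> D D' v t' (c', B\<^sub>c + rp_cost S b tab j))
      (distr (noisy_rows D' P (\<lambda>a. noise_down b b\<^sub>o (z a - query D' a))) release_space (released S W R {} P b t' c))"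
  proof (rule dominated_release[where r=r, OF RP])
    show "distr (noise_down b b\<^sub>o (z a - query D a)) borel ((+) (query D a)) =
        density (distr (noise_down b b\<^sub>o (z a - query D' a)) borel ((+) (query D' a))) (\<lambda>y. ennreal (exp (r a y)))" for a
      unfolding r_def using b bb\<^sub>o by (intro noise_down_shift) auto
    show "r a \<in> borel_measurable borel" for a
      unfolding r_def by measurable
    fix y assume c: "consistent \<B> t (c, B\<^sub>c)"
    have "(\<Sum>a\<in>P. r a (y a) + slack D D' v a (b, y a, t') - slack D D' v a (c a))
        \<le> real (card {a\<in>P. v \<in> a}) * (1 / b - 1 / b\<^sub>o)"
    proof (rule sum_le_count)
      fix a assume a: "a \<in> P"
      \<comment> \<open>The row from which \<open>group_noise\<close> reads its value; consistency
        transfers that value to every row of the group.\<close>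
      define a' where "a' = (SOME a. a \<in> P)"
      have "a' \<in> P" unfolding a'_def using ne by (simp add: some_in_eq)
      with a have "timestamp tab a \<noteq> 0" "timestamp tab a = timestamp tab a'"
        by (auto simp: P_def group_rows_def valid_rows_def)
      then have "noise_param tab a = noise_param tab a'"
        using consistentD(4)[OF c, of a a'] unfolding tab_def by blast
      then have "noise_param tab a = b\<^sub>o"
        by (simp add: b\<^sub>o_def group_noise_def a'_def P_def)
      then have "c a = (b\<^sub>o, z a, timestamp tab a)"
        by (simp add: tab_def cache_table_def z_def cached_response_def prod_eq_iff)
      with \<open>timestamp tab a \<noteq> 0\<close> have "slack D D' v a (c a) = (of_bool (v \<in> a) - (\<bar>z a - query D' a\<bar> - \<bar>z a - query D a\<bar>)) / b\<^sub>o"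
        by (simp add: slack_def)
      \<comment> \<open>The terms in \<open>z a\<close> cancel against the old slack and those in
        \<open>y a\<close> against the new one, so equality holds for each row.\<close>
      then have "r a (y a) + slack D D' v a (b, y a, t') - slack D D' v a (c a) = of_bool (v \<in> a) * (1 / b - 1 / b\<^sub>o)"
        using t by (simp add: slack_def r_def diff_divide_distrib right_diff_distrib)
      then show "r a (y a) + slack D D' v a (b, y a, t') - slack D D' v a (c a) \<le> of_bool (v \<in> a) * (1 / b - 1 / b\<^sub>o)"
        by simp
    qed
    with count show "(\<Sum>a\<in>P. r a (y a) + slack D D' v a (b, y a, t') - slack D D' v a (c a)) \<le> rp_cost S b tab j"
      by linarith
  qed (use b bb\<^sub>o t \<epsilon> in \<open>auto simp: prob_space_noise_down tab_def\<close>)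
  then show ?thesis
    unfolding run_rp_eq[OF j b] P_def b\<^sub>o_def z_def tab_def .
qed

section \<open>Measurability of the mechanisms\<close>

text \<open>Over a finite type there are only countably many sets, so preimages of single sets
  suffice, and being equal to a given set is a conjunction of membership conditions.\<close>

lemma measurable_set_valued:
  fixes A :: "'a \<Rightarrow> 'b::finite set"
  assumes "\<And>b. Measurable.pred M (\<lambda>x. b \<in> A x)"
  shows "A \<in> M \<rightarrow>\<^sub>M count_space UNIV"
proof (subst measurable_count_space_eq2_countable, intro conjI ballI)
  fix B
  have "Measurable.pred M (\<lambda>x. \<forall>b. (b \<in> A x) = (b \<in> B))"
    by (intro pred_intros_countable measurable_compose[OF assms]) simp
  then have "{x \<in> space M. \<forall>b. (b \<in> A x) = (b \<in> B)} \<in> sets M"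
    by (simp add: pred_def)
  also have "{x \<in> space M. \<forall>b. (b \<in> A x) = (b \<in> B)} = A -` {B} \<inter> space M"
    by auto
  finally show "A -` {B} \<inter> space M \<in> sets M" .
qed simp

lemma measurable_return_compose:
  "f \<in> M \<rightarrow>\<^sub>M N \<Longrightarrow> (\<lambda>x. return N (f x)) \<in> M \<rightarrow>\<^sub>M prob_algebra N"
  by (rule measurable_compose[OF _ measurable_return_prob_space])

context
  fixes S :: "'d::finite cachedp" and M :: "'x measure" and b :: "'x \<Rightarrow> real" and tab :: "'x \<Rightarrow> 'd cache_table"
  assumes S: "valid_cachedp S" and b: "b \<in> M \<rightarrow>\<^sub>M positive_reals" and tab: "tab \<in> M \<rightarrow>\<^sub>M table_space"
begin

lemma noise_borel: "b \<in> borel_measurable M"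
  using measurable_compose[OF b measurable_positive_reals] by simp

lemma measurable_noise_param: "(\<lambda>x. noise_param (tab x) a) \<in> borel_measurable M"
  and measurable_timestamp: "(\<lambda>x. timestamp (tab x) a) \<in> M \<rightarrow>\<^sub>M count_space UNIV"
  using measurable_compose[OF tab measurable_table_entry[of a]]
  by (auto intro: measurable_compose)

lemma pred_timestamp: "Measurable.pred M (\<lambda>x. Q (timestamp (tab x) a))"
  by (rule measurable_compose[OF measurable_timestamp]) simp

lemma measurable_free_rows: "(\<lambda>x. free_rows S R (b x) (tab x)) \<in> M \<rightarrow>\<^sub>M count_space UNIV"
proof (rule measurable_set_valued)
  fix a
  note [measurable] = noise_borel measurable_noise_param[of a] pred_timestamp[of "\<lambda>t. 0 < t" a]
  show "Measurable.pred M (\<lambda>x. a \<in> free_rows S R (b x) (tab x))"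
    unfolding free_rows_def valid_rows_def mem_Collect_eq Int_iff by measurable
qed

lemma measurable_paid_rows: "(\<lambda>x. paid_rows S R (b x) (tab x)) \<in> M \<rightarrow>\<^sub>M count_space UNIV"
  unfolding paid_rows_def by (rule measurable_compose[OF measurable_free_rows]) simp

lemma measurable_group_rows: "(\<lambda>x. group_rows S (tab x) j) \<in> M \<rightarrow>\<^sub>M count_space UNIV"
  unfolding group_rows_def valid_rows_def
  by (rule measurable_set_valued)
    (simp add: pred_timestamp[of "\<lambda>t. a \<in> global_strategy S \<and> 0 < t \<and> t = j" for a])

text \<open>For a fixed value of the group the chosen row is a constant. The group takes countably
  many values, over which the resulting functions are patched together.\<close>

lemma measurable_group_noise: "(\<lambda>x. group_noise S (tab x) j) \<in> borel_measurable M"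
  unfolding group_noise_def
  by (rule measurable_compose_countable[where f="\<lambda>G x. noise_param (tab x) (SOME a. a \<in> G)"
      and g="\<lambda>x. group_rows S (tab x) j"])
    (rule measurable_noise_param measurable_group_rows)+

lemma pred_rp_candidates: "Measurable.pred M (\<lambda>x. j \<in> rp_candidates S R (b x) (tab x))"
proof -
  have "Measurable.pred M (\<lambda>x. group_rows S (tab x) j \<noteq> {} \<and> R \<subseteq> group_rows S (tab x) j)"
    by (rule measurable_compose[OF measurable_group_rows]) simp
  moreover have "Measurable.pred M (\<lambda>x. b x < group_noise S (tab x) j)"
    by (rule borel_measurable_pred_less[OF noise_borel measurable_group_noise])
  ultimately have "Measurable.pred M (\<lambda>x. (group_rows S (tab x) j \<noteq> {} \<and> R \<subseteq> group_rows S (tab x) j) \<and>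
      b x < group_noise S (tab x) j)"
    by (rule pred_intros_logic(3))
  then show ?thesis by (simp add: rp_candidates_def conj_assoc)
qed

lemma pred_rp_candidates_empty: "Measurable.pred M (\<lambda>x. rp_candidates S R (b x) (tab x) = {})"
proof -
  have "Measurable.pred M (\<lambda>x. \<forall>j. j \<notin> rp_candidates S R (b x) (tab x))"
    by (rule pred_intros_countable(1), rule pred_intros_logic(2), rule pred_rp_candidates)
  then show ?thesis by simp
qed

lemma measurable_noise_table: "(\<lambda>x. (b x, tab x)) \<in> M \<rightarrow>\<^sub>M positive_reals \<Otimes>\<^sub>M table_space"
  using b tab by (rule measurable_Pair)

lemma measurable_expand: "(\<lambda>x. expand S W R (b x) (tab x)) \<in> M \<rightarrow>\<^sub>M count_space UNIV"
proof -
  have "(\<lambda>(b, tab). expand S W R b tab) \<in> positive_reals \<Otimes>\<^sub>M table_space \<rightarrow>\<^sub>M count_space UNIV"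
    using S unfolding valid_cachedp_def by blast
  from measurable_compose[OF measurable_noise_table this] show ?thesis by simp
qed

lemma measurable_extra: "(\<lambda>x. extra S W R (b x) (tab x)) \<in> M \<rightarrow>\<^sub>M count_space UNIV"
proof -
  have "(\<lambda>(b, tab). extra S W R b tab) \<in> positive_reals \<Otimes>\<^sub>M table_space \<rightarrow>\<^sub>M count_space UNIV"
    using S unfolding valid_cachedp_def by blast
  from measurable_compose[OF measurable_noise_table this] show ?thesis by simp
qed

lemma measurable_pick_group: "(\<lambda>x. pick_group S R (b x) (tab x)) \<in> M \<rightarrow>\<^sub>M count_space UNIV"
proof -
  have "(\<lambda>(b, tab). pick_group S R b tab) \<in> positive_reals \<Otimes>\<^sub>M table_space \<rightarrow>\<^sub>M count_space UNIV"
    using S unfolding valid_cachedp_def by blast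
  from measurable_compose[OF measurable_noise_table this] show ?thesis by simp
qed

lemma measurable_search:
  assumes "\<alpha> \<in> borel_measurable M" "\<beta> \<in> borel_measurable M"
  shows "(\<lambda>x. search S W R (\<alpha> x) (\<beta> x) (tab x)) \<in> M \<rightarrow>\<^sub>M prob_algebra positive_reals"
proof -
  have "(\<lambda>(\<alpha>, \<beta>, tab). search S W R \<alpha> \<beta> tab)
      \<in> borel \<Otimes>\<^sub>M borel \<Otimes>\<^sub>M table_space \<rightarrow>\<^sub>M prob_algebra positive_reals"
    using S by (simp add: valid_cachedp_def)
  from measurable_compose[OF measurable_Pair[OF assms(1) measurable_Pair[OF assms(2) tab]] this]
  show ?thesis by simp
qed

lemma measurable_mmm_cost: "(\<lambda>x. mmm_cost S W R (b x) (tab x)) \<in> borel_measurable M"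
proof -
  have "(\<lambda>x. norm1_mat (bucket_mat (enum_set (paid_rows S R (b x) (tab x))) (buckets S W R))) \<in> borel_measurable M"
    by (rule measurable_compose[OF measurable_paid_rows]) simp
  then show ?thesis
    unfolding mmm_cost_def using noise_borel by (rule borel_measurable_divide)
qed

lemma measurable_rp_cost: "(\<lambda>x. rp_cost S (b x) (tab x) j) \<in> borel_measurable M"
proof -
  have "(\<lambda>x. norm1_mat (row_mat (group_rows S (tab x) j))) \<in> borel_measurable M"
    by (rule measurable_compose[OF measurable_group_rows]) simp
  then show ?thesis
    unfolding rp_cost_def
    by (intro borel_measurable_diff borel_measurable_divide noise_borel measurable_group_noise)
qed

end

context
  fixes S :: "'d::finite cachedp" and M :: "'x measure" and b :: "'x \<Rightarrow> real" and c :: "'x \<Rightarrow> 'd cache"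
  assumes S: "valid_cachedp S" and b: "b \<in> M \<rightarrow>\<^sub>M positive_reals" and c: "c \<in> M \<rightarrow>\<^sub>M cache_space"
begin

lemma measurable_table: "(\<lambda>x. cache_table (c x)) \<in> M \<rightarrow>\<^sub>M table_space"
  by (rule measurable_compose[OF c measurable_cache_table])

lemma noise_pos: "x \<in> space M \<Longrightarrow> 0 < b x"
  using measurable_space[OF b] by (auto simp: space_positive_reals)

text \<open>The sets \<open>F\<close> and \<open>P\<close> are held fixed, which keeps the product
  space fixed as well. Their dependence on the state is restored afterwards by splitting over their
  countably many values.\<close>

lemma measurable_release_kernel:
  assumes R: "R \<subseteq> F \<union> P" and N: "\<And>a. a \<in> P \<Longrightarrow> N a \<in> M \<rightarrow>\<^sub>M prob_algebra borel"
  shows "(\<lambda>x. distr (noisy_rows D P (\<lambda>a. N a x)) release_space (released S W R F P (b x) t (c x)))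
    \<in> M \<rightarrow>\<^sub>M prob_algebra release_space"
proof (rule measurable_distr_prob_space2[where M="\<Pi>\<^sub>M a\<in>P. borel"])
  show "(\<lambda>x. noisy_rows D P (\<lambda>a. N a x)) \<in> M \<rightarrow>\<^sub>M prob_algebra (\<Pi>\<^sub>M a\<in>P. borel)"
    unfolding noisy_rows_def
    by (intro measurable_PiM_kernel measurable_distr_prob_space2[OF N]) auto
  show "(\<lambda>(x, y). released S W R F P (b x) t (c x) y) \<in> M \<Otimes>\<^sub>M (\<Pi>\<^sub>M a\<in>P. borel) \<rightarrow>\<^sub>M release_space"
    unfolding split_beta
    by (intro measurable_released[OF R] measurable_compose[OF measurable_fst c]
        measurable_compose[OF measurable_fst noise_borel[OF S b measurable_table]]
        measurable_compose[OF measurable_snd measurable_component_singleton])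
qed

lemma measurable_run_mmm:
  "(\<lambda>x. run_mmm S D t W R (b x) (c x)) \<in> M \<rightarrow>\<^sub>M prob_algebra release_space"
proof -
  define F where "F x = free_rows S R (b x) (cache_table (c x))" for x
  define P where "P x = paid_rows S R (b x) (cache_table (c x)) \<union> extra S W R (b x) (cache_table (c x))" for x
  have F: "F \<in> M \<rightarrow>\<^sub>M count_space UNIV"
    unfolding F_def by (rule measurable_free_rows[OF S b measurable_table])
  have P: "P \<in> M \<rightarrow>\<^sub>M count_space UNIV"
  proof (rule measurable_set_valued)
    fix a
    have "Measurable.pred M (\<lambda>x. a \<in> paid_rows S R (b x) (cache_table (c x)) \<or> a \<in> extra S W R (b x) (cache_table (c x)))"
      by (intro pred_intros_logic measurable_compose[OF measurable_paid_rows[OF S b measurable_table]]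
          measurable_compose[OF measurable_extra[OF S b measurable_table]]) auto
    then show "Measurable.pred M (\<lambda>x. a \<in> P x)" by (simp add: P_def)
  qed
  \<comment> \<open>Patching over all pairs of sets requires a probability kernel also for pairs
    that never occur. Where the rows of \<open>R\<close> are not covered, a rejection serves as
    default.\<close>
  define K where "K F P x = (if R \<subseteq> F \<union> P
      then distr (noisy_rows D P (\<lambda>_. laplace (b x))) release_space (released S W R F P (b x) t (c x))
      else return release_space (rejection, c x))" for F P x
  have [simp]: "rejection \<in> space response_space"
    by (simp add: rejection_def response_space_def space_pair_measure space_PiM)
  have K: "K F P \<in> M \<rightarrow>\<^sub>M prob_algebra release_space" for F P
  proof (cases "R \<subseteq> F \<union> P")
    case True
    then show ?thesis unfolding K_def
      by (simp only: if_True) (intro measurable_release_kernel measurable_compose[OF b measurable_laplace])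
  next
    case False
    then show ?thesis unfolding K_def
      by (simp only: if_False) (intro measurable_return_compose measurable_Pair c measurable_const, simp)
  qed
  have "(\<lambda>x. K (F x) (P x) x) \<in> M \<rightarrow>\<^sub>M prob_algebra release_space"
    by (rule measurable_compose_countable[OF measurable_compose_countable[OF K P] F])
  also have "?this \<longleftrightarrow> ?thesis"
    by (intro measurable_cong)
      (auto simp: run_mmm_eq noise_pos K_def F_def P_def Let_def paid_rows_def)
  finally show ?thesis .
qed

text \<open>Without a candidate group, \<open>run_rp\<close> could invoke \<open>noise_down\<close>
  outside 0 < b < \<open>b\<^sub>o\<close>, where it is not guaranteed to be a probability measure.
  The rejection in the guard is a placeholder.\<close>

lemma measurable_run_rp:
  "(\<lambda>x. if rp_candidates S R (b x) (cache_table (c x)) = {} then return release_space (rejection, c x)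
     else run_rp S D t W R (b x) (c x)) \<in> M \<rightarrow>\<^sub>M prob_algebra release_space"
proof -
  have [simp]: "rejection \<in> space response_space"
    by (simp add: rejection_def response_space_def space_pair_measure space_PiM)
  \<comment> \<open>Here the group index and the row set are arbitrary, so the scales need not be
    ordered; \<open>total_noise_down\<close> keeps this a probability kernel and agrees with
    \<open>noise_down\<close> for actual candidates.\<close>
  define K where "K j P x = (if R \<subseteq> {} \<union> P
      then distr (noisy_rows D P (\<lambda>a. total_noise_down
          (b x, group_noise S (cache_table (c x)) j, cached_response (c x) a - query D a)))
        release_space (released S W R {} P (b x) t (c x))
      else return release_space (rejection, c x))" for j P x
  have N: "(\<lambda>x. total_noise_down (b x, group_noise S (cache_table (c x)) j, cached_response (c x) a - query D a))
      \<in> M \<rightarrow>\<^sub>M prob_algebra borel" for a j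
  proof (rule measurable_compose[OF _ measurable_total_noise_down])
    have "(\<lambda>x. fst (snd (c x a))) \<in> borel_measurable M"
      using measurable_compose[OF c measurable_cache_entry[of a]] by measurable
    then have "(\<lambda>x. cached_response (c x) a - query D a) \<in> borel_measurable M"
      unfolding cached_response_def by (intro borel_measurable_diff borel_measurable_const)
    then show "(\<lambda>x. (b x, group_noise S (cache_table (c x)) j, cached_response (c x) a - query D a))
        \<in> M \<rightarrow>\<^sub>M borel \<Otimes>\<^sub>M borel \<Otimes>\<^sub>M borel"
      by (intro measurable_Pair noise_borel[OF S b measurable_table] measurable_group_noise[OF S b measurable_table])
  qed
  have K: "K j P \<in> M \<rightarrow>\<^sub>M prob_algebra release_space" for j P
  proof (cases "R \<subseteq> {} \<union> P")
    case True
    then show ?thesis unfolding K_def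
      by (simp only: if_True) (intro measurable_release_kernel N)
  next
    case False
    then show ?thesis unfolding K_def
      by (simp only: if_False) (intro measurable_return_compose measurable_Pair c measurable_const, simp)
  qed
  define j where "j x = pick_group S R (b x) (cache_table (c x))" for x
  have j: "j \<in> M \<rightarrow>\<^sub>M count_space UNIV"
    unfolding j_def by (rule measurable_pick_group[OF S b measurable_table])
  have "(\<lambda>x. K i (group_rows S (cache_table (c x)) i) x) \<in> M \<rightarrow>\<^sub>M prob_algebra release_space" for i
    by (rule measurable_compose_countable[OF K measurable_group_rows[OF S b measurable_table]])
  then have "(\<lambda>x. K (j x) (group_rows S (cache_table (c x)) (j x)) x) \<in> M \<rightarrow>\<^sub>M prob_algebra release_space"
    by (rule measurable_compose_countable[OF _ j])
  then have "(\<lambda>x. if rp_candidates S R (b x) (cache_table (c x)) = {} then return release_space (rejection, c x)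
      else K (j x) (group_rows S (cache_table (c x)) (j x)) x) \<in> M \<rightarrow>\<^sub>M prob_algebra release_space"
    by (intro measurable_If measurable_return_compose measurable_Pair c measurable_const)
      (use pred_rp_candidates_empty[OF S b measurable_table] in \<open>auto simp: pred_def\<close>)
  also have "?this \<longleftrightarrow> ?thesis"
  proof (intro measurable_cong if_cong refl)
    fix x assume x: "x \<in> space M" and ne: "rp_candidates S R (b x) (cache_table (c x)) \<noteq> {}"
    have cand: "j x \<in> rp_candidates S R (b x) (cache_table (c x))"
      using S ne unfolding valid_cachedp_def j_def is_arg_min_def by blast
    then have sub: "R \<subseteq> group_rows S (cache_table (c x)) (j x)" and lt: "b x < group_noise S (cache_table (c x)) (j x)"
      by (auto simp: rp_candidates_def)
    show "K (j x) (group_rows S (cache_table (c x)) (j x)) x = run_rp S D t W R (b x) (c x)"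
      unfolding run_rp_eq[OF j_def cand noise_pos[OF x]] using sub lt noise_pos[OF x]
      by (simp add: K_def total_noise_down_def)
  qed
  finally show ?thesis .
qed

end

section \<open>One round\<close>

lemma space_round_space: "space round_space = UNIV"
  by (simp add: round_space_def request_space_def response_space_def cache_space_def space_pair_measure space_PiM)

lemma measurable_round_potential:
  "(\<lambda>r. potential \<B> D D' v t (snd (snd r))) \<in> borel_measurable round_space"
  unfolding round_space_def
  by (rule measurable_compose[OF _ measurable_potential]) (intro measurable_compose[OF measurable_snd measurable_snd])

definition option_cost :: "'d::finite cachedp \<Rightarrow> 'd workload \<Rightarrow> 'd set set \<Rightarrow> 'd set set \<Rightarrow> 'd cache_table
    \<Rightarrow> real \<Rightarrow> real \<Rightarrow> real \<Rightarrow> mechanism \<Rightarrow> ereal" where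
  "option_cost S W R R\<^sub>e tab b b\<^sub>r b\<^sub>e = (\<lambda>m. case m of
       MMM \<Rightarrow> ereal (mmm_cost S W R b tab)
     | RP \<Rightarrow> if rp_candidates S R b\<^sub>r tab = {} then \<infinity>
             else ereal (rp_cost S b\<^sub>r tab (pick_group S R b\<^sub>r tab))
     | Expanded_MMM \<Rightarrow> ereal (mmm_cost S W R\<^sub>e b\<^sub>e tab))"

text \<open>A round after all noise parameters have been drawn. The two strategies are arguments, so
  that they can be held fixed while parameters, cache and budget vary.\<close>

definition respond :: "'d::finite cachedp \<Rightarrow> real \<Rightarrow> 'd multiset \<Rightarrow> nat \<Rightarrow> 'd request \<Rightarrow> 'd set set \<Rightarrow> 'd set set
    \<Rightarrow> 'd cache \<Rightarrow> real \<Rightarrow> real \<Rightarrow> real \<Rightarrow> real \<Rightarrow> 'd round measure" where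
  "respond S \<B> D t req R R\<^sub>e c B\<^sub>c b b\<^sub>r b\<^sub>e = (
     let W = fst req;
         cost = option_cost S W R R\<^sub>e (cache_table c) b b\<^sub>r b\<^sub>e;
         m = pick_mechanism S cost;
         \<epsilon> = real_of_ereal (cost m)
     in if \<epsilon> + B\<^sub>c \<ge> \<B> then return round_space (req, rejection, c, B\<^sub>c)
        else do {
          (resp, c') \<leftarrow> (case m of
              MMM \<Rightarrow> run_mmm S D t W R b c
            | RP \<Rightarrow> run_rp S D t W R b\<^sub>r c
            | Expanded_MMM \<Rightarrow> run_mmm S D t W R\<^sub>e b\<^sub>e c);
          return round_space (req, resp, c', B\<^sub>c + \<epsilon>) })"

lemma serve_eq:
  "serve S \<B> D t (W, \<alpha>, \<beta>) c B\<^sub>c = (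
     let tab = cache_table c; R = strategy (global_strategy S) W
     in do {
       b \<leftarrow> search S W R \<alpha> \<beta> tab;
       b\<^sub>r \<leftarrow> search S W R \<alpha> \<beta> (cache_table empty_cache);
       b\<^sub>e \<leftarrow> search S W (R \<union> expand S W R b tab) \<alpha> \<beta> tab;
       respond S \<B> D t (W, \<alpha>, \<beta>) R (R \<union> expand S W R b tab) c B\<^sub>c b b\<^sub>r b\<^sub>e })"
  by (simp add: serve_def respond_def option_cost_def Let_def)

text \<open>Without candidates RP costs infinity while MMM has a finite cost, so a minimizer cannot
  be RP.\<close>

lemma pick_mechanism_RP:
  assumes S: "valid_cachedp S" and "pick_mechanism S (option_cost S W R R\<^sub>e tab b b\<^sub>r b\<^sub>e) = RP"
  shows "pick_group S R b\<^sub>r tab \<in> rp_candidates S R b\<^sub>r tab"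
proof -
  have "is_arg_min (option_cost S W R R\<^sub>e tab b b\<^sub>r b\<^sub>e) (\<lambda>m. True) RP"
    using S assms(2) unfolding valid_cachedp_def by metis
  then have "\<not> option_cost S W R R\<^sub>e tab b b\<^sub>r b\<^sub>e MMM < option_cost S W R R\<^sub>e tab b b\<^sub>r b\<^sub>e RP"
    by (simp add: is_arg_min_def)
  then have ne: "rp_candidates S R b\<^sub>r tab \<noteq> {}"
    by (auto simp: option_cost_def)
  have "\<forall>R b tab. rp_candidates S R b tab \<noteq> {} \<longrightarrow>
      is_arg_min (rp_cost S b tab) (\<lambda>j. j \<in> rp_candidates S R b tab) (pick_group S R b tab)"
    using S unfolding valid_cachedp_def by blast
  with ne show ?thesis by (simp add: is_arg_min_def)
qed

lemma measurable_respond: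
  fixes S :: "'d::finite cachedp"
  assumes S: "valid_cachedp S" and c: "c \<in> M \<rightarrow>\<^sub>M cache_space" and B\<^sub>c: "B\<^sub>c \<in> borel_measurable M"
    and \<alpha>: "\<alpha> \<in> borel_measurable M" and \<beta>: "\<beta> \<in> borel_measurable M"
    and b: "b \<in> M \<rightarrow>\<^sub>M positive_reals" and b\<^sub>r: "b\<^sub>r \<in> M \<rightarrow>\<^sub>M positive_reals" and b\<^sub>e: "b\<^sub>e \<in> M \<rightarrow>\<^sub>M positive_reals"
  shows "(\<lambda>x. respond S \<B> D t (W, \<alpha> x, \<beta> x) R R\<^sub>e (c x) (B\<^sub>c x) (b x) (b\<^sub>r x) (b\<^sub>e x)) \<in> M \<rightarrow>\<^sub>M prob_algebra round_space"
proof -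
  note tab = measurable_table[OF S b c]
  define cost where "cost x = option_cost S W R R\<^sub>e (cache_table (c x)) (b x) (b\<^sub>r x) (b\<^sub>e x)" for x
  have cost: "(\<lambda>x. cost x m) \<in> borel_measurable M" for m
  proof (cases m)
    case RP
    have "(\<lambda>x. rp_cost S (b\<^sub>r x) (cache_table (c x)) (pick_group S R (b\<^sub>r x) (cache_table (c x)))) \<in> borel_measurable M"
      by (rule measurable_compose_countable[OF measurable_rp_cost[OF S b\<^sub>r tab] measurable_pick_group[OF S b\<^sub>r tab]])
    then show ?thesis
      using pred_rp_candidates_empty[OF S b\<^sub>r tab, of R] unfolding cost_def option_cost_def RP mechanism.case
      by (intro measurable_If borel_measurable_ereal measurable_const) (auto simp: pred_def)
  next
    case MMM
    then show ?thesis
      using measurable_mmm_cost[OF S b tab, of W R] by (simp add: cost_def option_cost_def)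
  next
    case Expanded_MMM
    then show ?thesis
      using measurable_mmm_cost[OF S b\<^sub>e tab, of W R\<^sub>e] by (simp add: cost_def option_cost_def)
  qed
  have pick: "(\<lambda>x. pick_mechanism S (cost x)) \<in> M \<rightarrow>\<^sub>M count_space UNIV"
  proof (rule measurable_compose[of cost M "\<Pi>\<^sub>M m\<in>UNIV. borel"])
    show "cost \<in> M \<rightarrow>\<^sub>M (\<Pi>\<^sub>M m\<in>UNIV. borel)"
      by (rule measurable_PiM_single') (auto simp: cost)
    show "pick_mechanism S \<in> (\<Pi>\<^sub>M m\<in>UNIV. borel) \<rightarrow>\<^sub>M count_space UNIV"
      using S unfolding valid_cachedp_def by blast
  qed
  have req: "(\<lambda>x. (W, \<alpha> x, \<beta> x)) \<in> M \<rightarrow>\<^sub>M request_space"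
    unfolding request_space_def by (intro measurable_Pair measurable_const \<alpha> \<beta>) simp
  have rej: "rejection \<in> space response_space"
    by (simp add: rejection_def response_space_def space_pair_measure space_PiM)
  \<comment> \<open>Each mechanism must give a probability kernel on the whole space, not only where
    it is chosen. The placeholder for RP is never reached, by
    \<open>pick_mechanism_RP\<close>.\<close>
  define run where "run m x = (case m of
      MMM \<Rightarrow> run_mmm S D t W R (b x) (c x)
    | RP \<Rightarrow> if rp_candidates S R (b\<^sub>r x) (cache_table (c x)) = {} then return release_space (rejection, c x)
            else run_rp S D t W R (b\<^sub>r x) (c x)
    | Expanded_MMM \<Rightarrow> run_mmm S D t W R\<^sub>e (b\<^sub>e x) (c x))" for m x
  have run: "run m \<in> M \<rightarrow>\<^sub>M prob_algebra release_space" for m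
    unfolding run_def using measurable_run_mmm[OF S b c] measurable_run_rp[OF S b\<^sub>r c] measurable_run_mmm[OF S b\<^sub>e c]
    by (cases m) simp_all
  define K where "K m x = (if \<B> \<le> real_of_ereal (cost x m) + B\<^sub>c x
      then return round_space ((W, \<alpha> x, \<beta> x), rejection, c x, B\<^sub>c x)
      else run m x \<bind> (\<lambda>z. return round_space ((W, \<alpha> x, \<beta> x), fst z, snd z, B\<^sub>c x + real_of_ereal (cost x m))))" for m x
  have \<epsilon>: "(\<lambda>x. real_of_ereal (cost x m)) \<in> borel_measurable M" for m
    by (rule borel_measurable_real_of_ereal[OF cost])
  have K: "K m \<in> M \<rightarrow>\<^sub>M prob_algebra round_space" for m
    unfolding K_def
  proof (rule measurable_If)
    show "(\<lambda>x. return round_space ((W, \<alpha> x, \<beta> x), rejection, c x, B\<^sub>c x)) \<in> M \<rightarrow>\<^sub>M prob_algebra round_space"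
      unfolding round_space_def by (intro measurable_return_compose measurable_Pair req c B\<^sub>c measurable_const rej)
    have "(\<lambda>(x, z). return round_space ((W, \<alpha> x, \<beta> x), fst z, snd z, B\<^sub>c x + real_of_ereal (cost x m)))
        \<in> M \<Otimes>\<^sub>M release_space \<rightarrow>\<^sub>M prob_algebra round_space"
      unfolding round_space_def split_beta
      by (intro measurable_return_compose measurable_Pair[OF measurable_compose[OF measurable_fst req]]
          measurable_Pair borel_measurable_add measurable_compose[OF measurable_fst B\<^sub>c]
          measurable_compose[OF measurable_fst \<epsilon>] measurable_compose[OF measurable_snd measurable_fst]
          measurable_compose[OF measurable_snd measurable_snd])
    then show "(\<lambda>x. run m x \<bind> (\<lambda>z. return round_space ((W, \<alpha> x, \<beta> x), fst z, snd z, B\<^sub>c x + real_of_ereal (cost x m))))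
        \<in> M \<rightarrow>\<^sub>M prob_algebra round_space"
      by (rule measurable_bind_prob_space2[OF run])
    have "Measurable.pred M (\<lambda>x. \<B> \<le> real_of_ereal (cost x m) + B\<^sub>c x)"
      using \<epsilon> B\<^sub>c by measurable
    then show "{x \<in> space M. \<B> \<le> real_of_ereal (cost x m) + B\<^sub>c x} \<in> sets M"
      by (simp add: pred_def)
  qed
  have UNIV_m: "(UNIV :: mechanism set) = {MMM, RP, Expanded_MMM}"
    using mechanism.exhaust by auto
  have "(\<lambda>x. K (pick_mechanism S (cost x)) x) \<in> M \<rightarrow>\<^sub>M prob_algebra round_space"
    by (rule measurable_compose_countable'[OF K pick]) (simp add: UNIV_m)
  moreover have "K (pick_mechanism S (cost x)) x
      = respond S \<B> D t (W, \<alpha> x, \<beta> x) R R\<^sub>e (c x) (B\<^sub>c x) (b x) (b\<^sub>r x) (b\<^sub>e x)" for x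
  proof -
    have "rp_candidates S R (b\<^sub>r x) (cache_table (c x)) \<noteq> {}" if "pick_mechanism S (cost x) = RP"
      using pick_mechanism_RP[OF S that[unfolded cost_def]] by blast
    then have "run (pick_mechanism S (cost x)) x = (case pick_mechanism S (cost x) of
          MMM \<Rightarrow> run_mmm S D t W R (b x) (c x)
        | RP \<Rightarrow> run_rp S D t W R (b\<^sub>r x) (c x)
        | Expanded_MMM \<Rightarrow> run_mmm S D t W R\<^sub>e (b\<^sub>e x) (c x))"
      by (cases "pick_mechanism S (cost x)") (simp_all add: run_def)
    then show ?thesis
      by (simp add: K_def respond_def Let_def case_prod_beta' flip: cost_def)
  qed
  ultimately show ?thesis by simp
qed

text \<open>Starting from the same cache and budget, both databases pass through the same branch:
  the costs, the chosen mechanism and the rejection test read only the public part of the cache and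
  the consumed budget. Hence a rejection reveals nothing beyond the state.\<close>

lemma dominated_respond:
  fixes D D' :: "'d::finite multiset"
  assumes S: "valid_cachedp S" and R: "R \<subseteq> global_strategy S" "R\<^sub>e \<subseteq> global_strategy S"
    and DD': "\<And>a. \<bar>query D a - query D' a\<bar> \<le> of_bool (v \<in> a)"
    and t: "t < t'" and b: "0 < b" "0 < b\<^sub>r" "0 < b\<^sub>e"
  shows "dominated round_space (potential \<B> D D' v t (c, B\<^sub>c)) (respond S \<B> D t' req R R\<^sub>e c B\<^sub>c b b\<^sub>r b\<^sub>e)
    (\<lambda>r. potential \<B> D D' v t' (snd (snd r))) (respond S \<B> D' t' req R R\<^sub>e c B\<^sub>c b b\<^sub>r b\<^sub>e)"
proof -
  define W where "W = fst req"
  define cost where "cost = option_cost S W R R\<^sub>e (cache_table c) b b\<^sub>r b\<^sub>e"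
  define m where "m = pick_mechanism S cost"
  define \<epsilon> where "\<epsilon> = real_of_ereal (cost m)"
  define run where "run D = (case m of
          MMM \<Rightarrow> run_mmm S D t' W R b c
        | RP \<Rightarrow> run_rp S D t' W R b\<^sub>r c
        | Expanded_MMM \<Rightarrow> run_mmm S D t' W R\<^sub>e b\<^sub>e c)" for D
  have respond: "respond S \<B> D t' req R R\<^sub>e c B\<^sub>c b b\<^sub>r b\<^sub>e = (if \<epsilon> + B\<^sub>c \<ge> \<B> then return round_space (req, rejection, c, B\<^sub>c)
      else run D \<bind> (\<lambda>z. return round_space (req, fst z, snd z, B\<^sub>c + \<epsilon>)))" for D
    unfolding respond_def Let_def run_def \<epsilon>_def m_def cost_def W_def case_prod_beta' ..
  note pot = measurable_round_potential[of \<B> D D' v t']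
  show ?thesis
  proof (cases "\<epsilon> + B\<^sub>c \<ge> \<B>")
    case True
    then show ?thesis
      using t pot by (simp add: respond) (intro dominated_return, auto simp: space_round_space intro: potential_mono)
  next
    case False
    \<comment> \<open>Acceptance keeps the new budget within \<B>, as consistency of the next state
      demands.\<close>
    then have le: "B\<^sub>c + \<epsilon> \<le> \<B>" by simp
    have run: "dominated release_space (potential \<B> D D' v t (c, B\<^sub>c)) (run D)
        (\<lambda>(resp, c'). potential \<B> D D' v t' (c', B\<^sub>c + \<epsilon>)) (run D')
        \<and> sets (run D) = sets release_space \<and> sets (run D') = sets release_space"
    proof (cases m)
      case MMM
      then have "\<epsilon> = mmm_cost S W R b (cache_table c)"
        by (simp add: \<epsilon>_def cost_def option_cost_def)
      with le show ?thesis
        using dominated_run_mmm[OF S R(1) DD' t b(1)] by (simp add: run_def MMM run_mmm_eq[OF b(1)] Let_def)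
    next
      case Expanded_MMM
      then have "\<epsilon> = mmm_cost S W R\<^sub>e b\<^sub>e (cache_table c)"
        by (simp add: \<epsilon>_def cost_def option_cost_def)
      with le show ?thesis
        using dominated_run_mmm[OF S R(2) DD' t b(3)] by (simp add: run_def Expanded_MMM run_mmm_eq[OF b(3)] Let_def)
    next
      case RP
      have cand: "pick_group S R b\<^sub>r (cache_table c) \<in> rp_candidates S R b\<^sub>r (cache_table c)"
        using RP unfolding m_def cost_def by (rule pick_mechanism_RP[OF S])
      then have "\<epsilon> = rp_cost S b\<^sub>r (cache_table c) (pick_group S R b\<^sub>r (cache_table c))"
        using RP by (auto simp: \<epsilon>_def cost_def option_cost_def)
      with le show ?thesis
        using dominated_run_rp[OF refl cand t b(2)] by (simp add: run_def RP run_rp_eq[OF refl cand b(2)])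
    qed
    have K: "(\<lambda>z. return round_space (req, fst z, snd z, B\<^sub>c + \<epsilon>)) \<in> release_space \<rightarrow>\<^sub>M subprob_algebra round_space"
    proof (rule measurable_prob_algebraD, rule measurable_return_compose)
      have "req \<in> space request_space" by (simp add: request_space_def space_pair_measure)
      then show "(\<lambda>z. (req, fst z, snd z, B\<^sub>c + \<epsilon>)) \<in> release_space \<rightarrow>\<^sub>M round_space"
        unfolding round_space_def by (intro measurable_Pair measurable_const measurable_fst measurable_snd) auto
    qed
    have "dominated round_space (potential \<B> D D' v t (c, B\<^sub>c))
        (run D \<bind> (\<lambda>z. return round_space (req, fst z, snd z, B\<^sub>c + \<epsilon>)))
        (\<lambda>r. potential \<B> D D' v t' (snd (snd r)))
        (run D' \<bind> (\<lambda>z. return round_space (req, fst z, snd z, B\<^sub>c + \<epsilon>)))"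
      using run pot by (intro dominated_bind[OF _ _ _ K K]) (auto simp: space_round_space intro!: dominated_return)
    with False show ?thesis by (simp add: respond)
  qed
qed

lemma strategy_subset_global:
  assumes "valid_cachedp S"
  shows "strategy (global_strategy S) W \<subseteq> global_strategy S"
  using assms by (intro strategy_subset[of "arity S"]) (simp add: valid_cachedp_def)

lemma expand_subset_global:
  assumes "valid_cachedp S"
  shows "expand S W R b tab \<subseteq> global_strategy S"
proof -
  have "expand S W R b tab \<subseteq> valid_rows S tab"
    using assms by (simp add: valid_cachedp_def)
  then show ?thesis by (auto simp: valid_rows_def)
qed

text \<open>A round is cut after the first search because the expanded strategy depends on the
  parameter found there. With \<open>R\<^sub>e\<close> as an argument, the rest can be treated for
  each value of the expansion separately.\<close>

definition serve_tail :: "'d::finite cachedp \<Rightarrow> real \<Rightarrow> 'd multiset \<Rightarrow> nat \<Rightarrow> 'd request \<Rightarrow> 'd set set \<Rightarrow> 'd set set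
    \<Rightarrow> 'd cache \<Rightarrow> real \<Rightarrow> real \<Rightarrow> 'd round measure" where
  "serve_tail S \<B> D t req R R\<^sub>e c B\<^sub>c b = (case req of (W, \<alpha>, \<beta>) \<Rightarrow>
     search S W R \<alpha> \<beta> (cache_table empty_cache) \<bind> (\<lambda>b\<^sub>r.
     search S W R\<^sub>e \<alpha> \<beta> (cache_table c) \<bind> (\<lambda>b\<^sub>e.
     respond S \<B> D t req R R\<^sub>e c B\<^sub>c b b\<^sub>r b\<^sub>e)))"

lemma serve_eq_tail:
  "serve S \<B> D t (W, \<alpha>, \<beta>) c B\<^sub>c =
     (let R = strategy (global_strategy S) W
      in search S W R \<alpha> \<beta> (cache_table c) \<bind>
        (\<lambda>b. serve_tail S \<B> D t (W, \<alpha>, \<beta>) R (R \<union> expand S W R b (cache_table c)) c B\<^sub>c b))"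
  by (simp add: serve_eq serve_tail_def Let_def)

lemma measurable_serve_tail:
  fixes S :: "'d::finite cachedp"
  assumes S: "valid_cachedp S" and c: "c \<in> M \<rightarrow>\<^sub>M cache_space" and B\<^sub>c: "B\<^sub>c \<in> borel_measurable M"
    and \<alpha>: "\<alpha> \<in> borel_measurable M" and \<beta>: "\<beta> \<in> borel_measurable M"
    and b: "b \<in> M \<rightarrow>\<^sub>M positive_reals"
  shows "(\<lambda>x. serve_tail S \<B> D t (W, \<alpha> x, \<beta> x) R R\<^sub>e (c x) (B\<^sub>c x) (b x)) \<in> M \<rightarrow>\<^sub>M prob_algebra round_space"
proof -
  have empty: "(\<lambda>x. cache_table empty_cache) \<in> M \<rightarrow>\<^sub>M table_space"
    by (rule measurable_const) (simp add: table_space_def space_PiM space_pair_measure)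
  have e: "(\<lambda>z. search S W R\<^sub>e (\<alpha> (fst z)) (\<beta> (fst z)) (cache_table (c (fst z)))) \<in> M \<Otimes>\<^sub>M positive_reals \<rightarrow>\<^sub>M prob_algebra positive_reals"
    by (rule measurable_search[OF S measurable_snd])
      (rule measurable_compose[OF measurable_fst] measurable_table[OF S b c] \<alpha> \<beta>)+
  have resp: "(\<lambda>(z, b\<^sub>e). respond S \<B> D t (W, \<alpha> (fst z), \<beta> (fst z)) R R\<^sub>e (c (fst z)) (B\<^sub>c (fst z)) (b (fst z)) (snd z) b\<^sub>e)
      \<in> (M \<Otimes>\<^sub>M positive_reals) \<Otimes>\<^sub>M positive_reals \<rightarrow>\<^sub>M prob_algebra round_space"
    unfolding split_beta
    by (intro measurable_respond S measurable_snd measurable_compose[OF measurable_fst measurable_snd]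
        measurable_compose[OF measurable_fst measurable_compose[OF measurable_fst c]]
        measurable_compose[OF measurable_fst measurable_compose[OF measurable_fst B\<^sub>c]]
        measurable_compose[OF measurable_fst measurable_compose[OF measurable_fst \<alpha>]]
        measurable_compose[OF measurable_fst measurable_compose[OF measurable_fst \<beta>]]
        measurable_compose[OF measurable_fst measurable_compose[OF measurable_fst b]])
  have "(\<lambda>z. search S W R\<^sub>e (\<alpha> (fst z)) (\<beta> (fst z)) (cache_table (c (fst z))) \<bind>
        respond S \<B> D t (W, \<alpha> (fst z), \<beta> (fst z)) R R\<^sub>e (c (fst z)) (B\<^sub>c (fst z)) (b (fst z)) (snd z))
      \<in> M \<Otimes>\<^sub>M positive_reals \<rightarrow>\<^sub>M prob_algebra round_space"
    by (rule measurable_bind_prob_space2[OF e resp])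
  then have "(\<lambda>(x, b\<^sub>r). search S W R\<^sub>e (\<alpha> x) (\<beta> x) (cache_table (c x)) \<bind>
        respond S \<B> D t (W, \<alpha> x, \<beta> x) R R\<^sub>e (c x) (B\<^sub>c x) (b x) b\<^sub>r)
      \<in> M \<Otimes>\<^sub>M positive_reals \<rightarrow>\<^sub>M prob_algebra round_space"
    by (simp add: split_beta)
  then show ?thesis
    unfolding serve_tail_def prod.case
    by (rule measurable_bind_prob_space2[OF measurable_search[OF S b empty \<alpha> \<beta>]])
qed

lemma measurable_serve:
  fixes S :: "'d::finite cachedp"
  assumes S: "valid_cachedp S" and c: "c \<in> M \<rightarrow>\<^sub>M cache_space" and B\<^sub>c: "B\<^sub>c \<in> borel_measurable M"
    and req: "req \<in> M \<rightarrow>\<^sub>M request_space"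
  shows "(\<lambda>x. serve S \<B> D t (req x) (c x) (B\<^sub>c x)) \<in> M \<rightarrow>\<^sub>M prob_algebra round_space"
proof -
  define \<alpha> \<beta> where "\<alpha> x = fst (snd (req x))" and "\<beta> x = snd (snd (req x))" for x
  have W: "(\<lambda>x. fst (req x)) \<in> M \<rightarrow>\<^sub>M count_space UNIV"
    and \<alpha>: "\<alpha> \<in> borel_measurable M" and \<beta>: "\<beta> \<in> borel_measurable M"
    using req unfolding request_space_def \<alpha>_def \<beta>_def by measurable
  have "(\<lambda>x. serve S \<B> D t (W, \<alpha> x, \<beta> x) (c x) (B\<^sub>c x)) \<in> M \<rightarrow>\<^sub>M prob_algebra round_space" for W
  proof -
    define R where "R = strategy (global_strategy S) W"
    have fst_c: "(\<lambda>z. c (fst z)) \<in> M \<Otimes>\<^sub>M positive_reals \<rightarrow>\<^sub>M cache_space"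
      by (rule measurable_compose[OF measurable_fst c])
    have ex: "(\<lambda>z. expand S W R (snd z) (cache_table (c (fst z)))) \<in> M \<Otimes>\<^sub>M positive_reals \<rightarrow>\<^sub>M count_space UNIV"
      by (rule measurable_expand[OF S measurable_snd measurable_table[OF S measurable_snd fst_c]])
    have "(\<lambda>z. serve_tail S \<B> D t (W, \<alpha> (fst z), \<beta> (fst z)) R (R \<union> E) (c (fst z)) (B\<^sub>c (fst z)) (snd z))
        \<in> M \<Otimes>\<^sub>M positive_reals \<rightarrow>\<^sub>M prob_algebra round_space" for E
      by (intro measurable_serve_tail S measurable_snd measurable_compose[OF measurable_fst c]
          measurable_compose[OF measurable_fst B\<^sub>c] measurable_compose[OF measurable_fst \<alpha>] measurable_compose[OF measurable_fst \<beta>])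
    then have "(\<lambda>z. serve_tail S \<B> D t (W, \<alpha> (fst z), \<beta> (fst z)) R
          (R \<union> expand S W R (snd z) (cache_table (c (fst z)))) (c (fst z)) (B\<^sub>c (fst z)) (snd z))
        \<in> M \<Otimes>\<^sub>M positive_reals \<rightarrow>\<^sub>M prob_algebra round_space"
      by (rule measurable_compose_countable[OF _ ex])
    then have tail: "(\<lambda>(x, b). serve_tail S \<B> D t (W, \<alpha> x, \<beta> x) R
          (R \<union> expand S W R b (cache_table (c x))) (c x) (B\<^sub>c x) b)
        \<in> M \<Otimes>\<^sub>M positive_reals \<rightarrow>\<^sub>M prob_algebra round_space"
      by (simp add: split_beta)
    have tab: "(\<lambda>x. cache_table (c x)) \<in> M \<rightarrow>\<^sub>M table_space"
      by (rule measurable_compose[OF c measurable_cache_table])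
    \<comment> \<open>Instantiates the noise parameter that the context of
      \<open>measurable_search\<close> fixes; any positive constant would serve.\<close>
    have one: "(\<lambda>x. 1) \<in> M \<rightarrow>\<^sub>M positive_reals"
      by (rule measurable_const) (simp add: space_positive_reals)
    show ?thesis
      unfolding serve_eq_tail Let_def R_def[symmetric]
      by (rule measurable_bind_prob_space2[OF measurable_search[OF S one tab \<alpha> \<beta>] tail])
  qed
  \<comment> \<open>Workloads are lists over a finite type and hence countably many, so the kernel
    is assembled from the kernels for fixed workloads.\<close>
  then have "(\<lambda>x. serve S \<B> D t (fst (req x), \<alpha> x, \<beta> x) (c x) (B\<^sub>c x)) \<in> M \<rightarrow>\<^sub>M prob_algebra round_space"
    by (rule measurable_compose_countable[OF _ W])
  then show ?thesis by (simp add: \<alpha>_def \<beta>_def)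
qed

lemma dominated_serve:
  fixes D D' :: "'d::finite multiset"
  assumes S: "valid_cachedp S" and DD': "\<And>a. \<bar>query D a - query D' a\<bar> \<le> of_bool (v \<in> a)" and t: "t < t'"
  shows "dominated round_space (potential \<B> D D' v t (c, B\<^sub>c)) (serve S \<B> D t' req c B\<^sub>c)
    (\<lambda>r. potential \<B> D D' v t' (snd (snd r))) (serve S \<B> D' t' req c B\<^sub>c)"
proof -
  obtain W \<alpha> \<beta> where req: "req = (W, \<alpha>, \<beta>)" by (cases req)
  define R where "R = strategy (global_strategy S) W"
  have R: "R \<subseteq> global_strategy S"
    unfolding R_def by (rule strategy_subset_global[OF S])
  have c: "(\<lambda>x. c) \<in> M \<rightarrow>\<^sub>M cache_space" for M :: "'x measure"
    by (rule measurable_const) (simp add: cache_space_def space_PiM space_pair_measure)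
  have search: "search S W R \<alpha> \<beta> tab \<in> space (prob_algebra positive_reals)" for R tab
  proof -
    have "(\<lambda>x. tab) \<in> count_space UNIV \<rightarrow>\<^sub>M table_space" "(\<lambda>x. 1) \<in> count_space UNIV \<rightarrow>\<^sub>M positive_reals"
      by (auto simp: table_space_def space_PiM space_pair_measure space_positive_reals)
    from measurable_search[OF S this(2,1), of "\<lambda>_. \<alpha>" "\<lambda>_. \<beta>" W R]
    show ?thesis by (simp add: Pi_iff)
  qed
  then have sets: "sets (search S W R \<alpha> \<beta> tab) = sets positive_reals" for R tab
    by (simp add: space_prob_algebra)
  \<comment> \<open>All three searches have the same law under both databases, so each is dominated
    with a constant weight, and this rule carries the potential past it unchanged.\<close>
  note bind = dominated_bind[OF dominated_refl[OF sets] sets sets _ _ measurable_round_potential]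
  have resp: "respond S \<B> D t' req R R\<^sub>e c B\<^sub>c b b\<^sub>r \<in> positive_reals \<rightarrow>\<^sub>M subprob_algebra round_space"
    if "0 < b" "0 < b\<^sub>r" for D R\<^sub>e b b\<^sub>r
    unfolding req using that
    by (intro measurable_prob_algebraD measurable_respond[OF S c]) (auto simp: space_positive_reals)
  have resp': "(\<lambda>b\<^sub>r. search S W R\<^sub>e \<alpha> \<beta> (cache_table c) \<bind> respond S \<B> D t' req R R\<^sub>e c B\<^sub>c b b\<^sub>r)
      \<in> positive_reals \<rightarrow>\<^sub>M subprob_algebra round_space" if "0 < b" for D R\<^sub>e b
  proof (rule measurable_prob_algebraD, rule measurable_bind_prob_space2)
    show "(\<lambda>b\<^sub>r. search S W R\<^sub>e \<alpha> \<beta> (cache_table c)) \<in> positive_reals \<rightarrow>\<^sub>M prob_algebra positive_reals"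
      by (rule measurable_const[OF search])
    show "(\<lambda>(b\<^sub>r, b\<^sub>e). respond S \<B> D t' req R R\<^sub>e c B\<^sub>c b b\<^sub>r b\<^sub>e)
        \<in> positive_reals \<Otimes>\<^sub>M positive_reals \<rightarrow>\<^sub>M prob_algebra round_space"
      unfolding req split_beta using that
      by (intro measurable_respond[OF S c] measurable_const measurable_fst measurable_snd) (auto simp: space_positive_reals)
  qed
  have tail: "(\<lambda>b. serve_tail S \<B> D t' req R (R \<union> expand S W R b (cache_table c)) c B\<^sub>c b)
      \<in> positive_reals \<rightarrow>\<^sub>M subprob_algebra round_space" for D
  proof (rule measurable_prob_algebraD)
    have ex: "(\<lambda>b. expand S W R b (cache_table c)) \<in> positive_reals \<rightarrow>\<^sub>M count_space UNIV"
      by (rule measurable_expand[OF S _ measurable_table[OF S _ c]]) measurable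
    have "(\<lambda>b. serve_tail S \<B> D t' req R (R \<union> E) c B\<^sub>c b) \<in> positive_reals \<rightarrow>\<^sub>M prob_algebra round_space" for E
      unfolding req by (intro measurable_serve_tail[OF S c]) auto
    then show "(\<lambda>b. serve_tail S \<B> D t' req R (R \<union> expand S W R b (cache_table c)) c B\<^sub>c b)
        \<in> positive_reals \<rightarrow>\<^sub>M prob_algebra round_space"
      by (rule measurable_compose_countable[OF _ ex])
  qed
  show ?thesis
    unfolding req serve_eq_tail Let_def R_def[symmetric]
  proof (rule bind[OF tail[unfolded req] tail[unfolded req]])
    fix b assume "b \<in> space positive_reals"
    then have b: "0 < b" by (simp add: space_positive_reals)
    define R\<^sub>e where "R\<^sub>e = R \<union> expand S W R b (cache_table c)"
    have R\<^sub>e: "R\<^sub>e \<subseteq> global_strategy S"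
      unfolding R\<^sub>e_def using R expand_subset_global[OF S] by blast
    have "dominated round_space (potential \<B> D D' v t (c, B\<^sub>c)) (serve_tail S \<B> D t' (W, \<alpha>, \<beta>) R R\<^sub>e c B\<^sub>c b)
        (\<lambda>r. potential \<B> D D' v t' (snd (snd r))) (serve_tail S \<B> D' t' (W, \<alpha>, \<beta>) R R\<^sub>e c B\<^sub>c b)"
      unfolding serve_tail_def prod.case
    proof (rule bind[OF resp'[OF b, unfolded req] resp'[OF b, unfolded req]])
      fix b\<^sub>r assume "b\<^sub>r \<in> space positive_reals"
      then have b\<^sub>r: "0 < b\<^sub>r" by (simp add: space_positive_reals)
      show "dominated round_space (potential \<B> D D' v t (c, B\<^sub>c))
          (search S W R\<^sub>e \<alpha> \<beta> (cache_table c) \<bind> respond S \<B> D t' (W, \<alpha>, \<beta>) R R\<^sub>e c B\<^sub>c b b\<^sub>r)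
          (\<lambda>r. potential \<B> D D' v t' (snd (snd r)))
          (search S W R\<^sub>e \<alpha> \<beta> (cache_table c) \<bind> respond S \<B> D' t' (W, \<alpha>, \<beta>) R R\<^sub>e c B\<^sub>c b b\<^sub>r)"
      proof (rule bind[OF resp[OF b b\<^sub>r, unfolded req] resp[OF b b\<^sub>r, unfolded req]])
        fix b\<^sub>e assume "b\<^sub>e \<in> space positive_reals"
        then have b\<^sub>e: "0 < b\<^sub>e" by (simp add: space_positive_reals)
        show "dominated round_space (potential \<B> D D' v t (c, B\<^sub>c))
            (respond S \<B> D t' (W, \<alpha>, \<beta>) R R\<^sub>e c B\<^sub>c b b\<^sub>r b\<^sub>e)
            (\<lambda>r. potential \<B> D D' v t' (snd (snd r))) (respond S \<B> D' t' (W, \<alpha>, \<beta>) R R\<^sub>e c B\<^sub>c b b\<^sub>r b\<^sub>e)"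
          by (rule dominated_respond[OF S R R\<^sub>e DD' t b b\<^sub>r b\<^sub>e])
      qed
    qed
    then show "dominated round_space (potential \<B> D D' v t (c, B\<^sub>c))
        (serve_tail S \<B> D t' (W, \<alpha>, \<beta>) R (R \<union> expand S W R b (cache_table c)) c B\<^sub>c b)
        (\<lambda>r. potential \<B> D D' v t' (snd (snd r)))
        (serve_tail S \<B> D' t' (W, \<alpha>, \<beta>) R (R \<union> expand S W R b (cache_table c)) c B\<^sub>c b)"
      by (simp only: R\<^sub>e_def)
  qed
qed

section \<open>From a single request to the kernel of a round\<close>

definition state_before :: "nat \<Rightarrow> (nat \<Rightarrow> 'd round) \<Rightarrow> 'd cache \<times> real" where
  "state_before i \<omega> = (if i = 0 then (empty_cache, 0) else snd (snd (\<omega> (i - 1))))"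

definition history :: "nat \<Rightarrow> (nat \<Rightarrow> 'd round) \<Rightarrow> nat \<Rightarrow> 'd request \<times> response" where
  "history i \<omega> = (\<lambda>j\<in>{0..<i}. case \<omega> j of (req, resp, _) \<Rightarrow> (req, resp))"

lemma round_kernel_eq:
  "round_kernel S \<B> An D i \<omega> = An i (history i \<omega>) \<bind>
     (\<lambda>req. serve S \<B> D (Suc i) req (fst (state_before i \<omega>)) (snd (state_before i \<omega>)))"
  by (simp add: round_kernel_def state_before_def history_def Let_def split_beta)

lemma measurable_state_before:
  "state_before i \<in> (\<Pi>\<^sub>M j\<in>{0..<i}. round_space) \<rightarrow>\<^sub>M cache_space \<Otimes>\<^sub>M borel"
proof (cases "i = 0")
  case True
  have "(empty_cache, 0::real) \<in> space (cache_space \<Otimes>\<^sub>M borel)"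
    by (simp add: cache_space_def space_PiM space_pair_measure)
  then show ?thesis
    unfolding state_before_def using True by (simp only: simp_thms if_True) (rule measurable_const)
next
  case False
  then have "(\<lambda>\<omega>. \<omega> (i - 1)) \<in> (\<Pi>\<^sub>M j\<in>{0..<i}. round_space) \<rightarrow>\<^sub>M round_space"
    by (intro measurable_component_singleton) auto
  then have "(\<lambda>\<omega>. snd (snd (\<omega> (i - 1)))) \<in> (\<Pi>\<^sub>M j\<in>{0..<i}. round_space) \<rightarrow>\<^sub>M cache_space \<Otimes>\<^sub>M borel"
    unfolding round_space_def by (rule measurable_compose) (rule measurable_compose[OF measurable_snd measurable_snd])
  with False show ?thesis by (simp add: state_before_def[abs_def])
qed

lemma measurable_history:
  "history i \<in> (\<Pi>\<^sub>M j\<in>{0..<i}. round_space) \<rightarrow>\<^sub>M (\<Pi>\<^sub>M j\<in>{0..<i}. request_space \<Otimes>\<^sub>M response_space)"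
  unfolding history_def
proof (rule measurable_restrict)
  fix j assume "j \<in> {0..<i}"
  then have "(\<lambda>\<omega>. \<omega> j) \<in> (\<Pi>\<^sub>M j\<in>{0..<i}. round_space) \<rightarrow>\<^sub>M round_space"
    by (rule measurable_component_singleton)
  moreover have "(\<lambda>r. case r of (req, resp, _) \<Rightarrow> (req, resp)) \<in> round_space \<rightarrow>\<^sub>M request_space \<Otimes>\<^sub>M response_space"
    unfolding round_space_def by measurable
  ultimately show "(\<lambda>\<omega>. case \<omega> j of (req, resp, _) \<Rightarrow> (req, resp))
      \<in> (\<Pi>\<^sub>M j\<in>{0..<i}. round_space) \<rightarrow>\<^sub>M request_space \<Otimes>\<^sub>M response_space"
    by (rule measurable_compose)
qed

lemma measurable_analyst:
  assumes "valid_analyst An"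
  shows "(\<lambda>\<omega>. An i (history i \<omega>)) \<in> (\<Pi>\<^sub>M j\<in>{0..<i}. round_space) \<rightarrow>\<^sub>M prob_algebra request_space"
  using assms by (intro measurable_compose[OF measurable_history]) (auto simp: valid_analyst_def)

lemma measurable_round_kernel:
  fixes S :: "'d::finite cachedp"
  assumes S: "valid_cachedp S" and An: "valid_analyst An"
  shows "round_kernel S \<B> An D i \<in> (\<Pi>\<^sub>M j\<in>{0..<i}. round_space) \<rightarrow>\<^sub>M prob_algebra round_space"
proof -
  have "(\<lambda>(\<omega>, req). serve S \<B> D (Suc i) req (fst (state_before i \<omega>)) (snd (state_before i \<omega>)))
      \<in> (\<Pi>\<^sub>M j\<in>{0..<i}. round_space) \<Otimes>\<^sub>M request_space \<rightarrow>\<^sub>M prob_algebra round_space"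
    unfolding split_beta
    by (intro measurable_serve S measurable_snd
        measurable_compose[OF measurable_fst measurable_compose[OF measurable_state_before measurable_fst]]
        measurable_compose[OF measurable_fst measurable_compose[OF measurable_state_before measurable_snd]])
  then show ?thesis
    unfolding round_kernel_eq[abs_def] by (rule measurable_bind_prob_space2[OF measurable_analyst[OF An]])
qed

text \<open>Rounds are counted from 0, but round \<open>i\<close> stamps its entries with
  \<open>Suc i\<close>, as 0 marks invalid ones. Thus \<open>i\<close> bounds all stamps before the
  round and \<open>Suc i\<close> those after it. Given the history, the request has the same law on
  both sides.\<close>

lemma dominated_round_kernel:
  fixes D D' :: "'d::finite multiset"
  assumes S: "valid_cachedp S" and An: "valid_analyst An"
    and DD': "\<And>a. \<bar>query D a - query D' a\<bar> \<le> of_bool (v \<in> a)"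
    and \<omega>: "\<omega> \<in> space (\<Pi>\<^sub>M j\<in>{0..<i}. round_space)"
  shows "dominated round_space (potential \<B> D D' v i (state_before i \<omega>)) (round_kernel S \<B> An D i \<omega>)
    (\<lambda>r. potential \<B> D D' v (Suc i) (snd (snd r))) (round_kernel S \<B> An D' i \<omega>)"
proof -
  have An: "sets (An i (history i \<omega>)) = sets request_space"
    using measurable_space[OF measurable_analyst[OF An] \<omega>] by (simp add: space_prob_algebra)
  have state: "state_before i \<omega> \<in> space (cache_space \<Otimes>\<^sub>M borel)"
    using measurable_space[OF measurable_state_before \<omega>] .
  have serve: "(\<lambda>req. serve S \<B> D (Suc i) req (fst (state_before i \<omega>)) (snd (state_before i \<omega>)))
      \<in> request_space \<rightarrow>\<^sub>M subprob_algebra round_space" for D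
    using state by (intro measurable_prob_algebraD measurable_serve[OF S]) (auto simp: space_pair_measure)
  show ?thesis
    unfolding round_kernel_eq
    by (rule dominated_bind[OF dominated_refl[OF An] An An serve serve measurable_round_potential])
      (use dominated_serve[OF S DD' lessI, of \<B> i "fst (state_before i \<omega>)" "snd (state_before i \<omega>)"] in simp)
qed

section \<open>The interaction\<close>

lemma Ionescu_Tulcea_round_kernel:
  assumes "valid_cachedp S" "valid_analyst An"
  shows "Ionescu_Tulcea (round_kernel S \<B> An D) (\<lambda>_. round_space)"
  unfolding Ionescu_Tulcea_def
proof (intro conjI allI impI)
  fix i
  show "round_kernel S \<B> An D i \<in> (\<Pi>\<^sub>M j\<in>{0..<i}. round_space) \<rightarrow>\<^sub>M subprob_algebra round_space"
    by (rule measurable_prob_algebraD[OF measurable_round_kernel[OF assms]])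
  show "prob_space (round_kernel S \<B> An D i \<omega>)" if "\<omega> \<in> space (\<Pi>\<^sub>M j\<in>{0..<i}. round_space)" for \<omega>
    using measurable_space[OF measurable_round_kernel[OF assms] that] by (simp add: space_prob_algebra)
qed

text \<open>Induction over the rounds: the potential reached after \<open>n\<close> rounds is the
  weight with which the next kernel starts.\<close>

lemma dominated_rounds:
  fixes D D' :: "'d::finite multiset"
  assumes S: "valid_cachedp S" and An: "valid_analyst An" and \<B>: "0 \<le> \<B>"
    and DD': "\<And>a. \<bar>query D a - query D' a\<bar> \<le> of_bool (v \<in> a)"
  shows "dominated (\<Pi>\<^sub>M j\<in>{0..<n}. round_space) 1
    (Ionescu_Tulcea.C (round_kernel S \<B> An D) (\<lambda>_. round_space) 0 n (\<lambda>_. undefined))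
    (\<lambda>\<omega>. potential \<B> D D' v n (state_before n \<omega>))
    (Ionescu_Tulcea.C (round_kernel S \<B> An D') (\<lambda>_. round_space) 0 n (\<lambda>_. undefined))"
proof -
  interpret X: Ionescu_Tulcea "round_kernel S \<B> An D" "\<lambda>_. round_space"
    by (rule Ionescu_Tulcea_round_kernel[OF S An])
  interpret Y: Ionescu_Tulcea "round_kernel S \<B> An D'" "\<lambda>_. round_space"
    by (rule Ionescu_Tulcea_round_kernel[OF S An])
  have pot: "(\<lambda>\<omega> :: nat \<Rightarrow> 'd round. potential \<B> D D' v n (state_before n \<omega>)) \<in> borel_measurable (\<Pi>\<^sub>M j\<in>{0..<n}. round_space)" for n
    by (rule measurable_compose[OF measurable_state_before measurable_potential])
  \<comment> \<open>The empty history, the only point of the product over no coordinates.\<close>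
  have undef: "(\<lambda>_. undefined) \<in> space (\<Pi>\<^sub>M j\<in>{0..<0::nat}. round_space :: 'd round measure)"
    by (simp add: space_PiM)
  show ?thesis
  proof (induction n)
    case 0
    have "consistent \<B> 0 (empty_cache :: 'd cache, 0)"
      using \<B> by (simp add: consistent_def empty_cache_def cache_table_def)
    \<comment> \<open>An empty cache has no slack and no budget has been consumed. This is where the
      constant 1 on the left comes from.\<close>
    then have "potential \<B> D D' v 0 (state_before 0 (\<lambda>_. undefined)) = 1"
      by (simp add: potential_def state_before_def slack_def empty_cache_def)
    then show ?case
      unfolding X.C.simps Y.C.simps by (intro dominated_return undef pot) simp
  next
    case (Suc n)
    show ?case
      unfolding X.C.simps Y.C.simps add_0
    proof (rule dominated_bind[OF Suc.IH])
      show "sets (X.C 0 n (\<lambda>_. undefined)) = sets (\<Pi>\<^sub>M j\<in>{0..<n}. round_space)"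
        "sets (Y.C 0 n (\<lambda>_. undefined)) = sets (\<Pi>\<^sub>M j\<in>{0..<n}. round_space)"
        using X.sets_C[OF undef, of n] Y.sets_C[OF undef, of n] by simp_all
      fix \<omega> :: "nat \<Rightarrow> 'd round" assume \<omega>: "\<omega> \<in> space (\<Pi>\<^sub>M j\<in>{0..<n}. round_space)"
      have upd: "fun_upd \<omega> n \<in> round_space \<rightarrow>\<^sub>M (\<Pi>\<^sub>M j\<in>{0..<Suc n}. round_space)"
        using \<omega> by (intro measurable_fun_upd[where J="{0..<n}"] measurable_const measurable_ident_sets) auto
      show "dominated (\<Pi>\<^sub>M j\<in>{0..<Suc n}. round_space) (potential \<B> D D' v n (state_before n \<omega>)) (X.eP n \<omega>)
          (\<lambda>\<omega>. potential \<B> D D' v (Suc n) (state_before (Suc n) \<omega>)) (Y.eP n \<omega>)"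
        unfolding X.eP_def Y.eP_def
      proof (rule dominated_distr[OF _ X.sets_P[OF \<omega>] Y.sets_P[OF \<omega>] upd pot])
        \<comment> \<open>The state after round \<open>n\<close> is a component of the round just
          appended, so the new potential depends on the extended history only through its last
          entry.\<close>
        show "dominated round_space (potential \<B> D D' v n (state_before n \<omega>)) (round_kernel S \<B> An D n \<omega>)
            (\<lambda>x. potential \<B> D D' v (Suc n) (state_before (Suc n) (fun_upd \<omega> n x))) (round_kernel S \<B> An D' n \<omega>)"
          using dominated_round_kernel[OF S An DD' \<omega>] by (simp add: state_before_def)
      qed
    qed (rule X.measurable_eP Y.measurable_eP pot)+
  qed
qed

lemma prob_space_interaction:
  assumes "valid_cachedp S" "valid_analyst An"
  shows "prob_space (interaction S \<B> An D)"
    and "sets (interaction S \<B> An D) = sets (\<Pi>\<^sub>M i\<in>UNIV. round_space)"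
proof -
  interpret X: Ionescu_Tulcea "round_kernel S \<B> An D" "\<lambda>_. round_space"
    by (rule Ionescu_Tulcea_round_kernel[OF assms])
  show "sets (interaction S \<B> An D) = sets (\<Pi>\<^sub>M i\<in>UNIV. round_space)"
    by (simp add: interaction_def)
  \<comment> \<open>The total mass of the limit is read off from the cylinder over the empty index
    set, which is the whole space.\<close>
  have "emeasure (X.CI {}) (space (\<Pi>\<^sub>M i\<in>{}. round_space)) = 1"
    using prob_space.emeasure_space_1[OF X.PF.prob_space_P[of "{}"]] X.PF.space_P[of "{}"] by simp
  then have "emeasure (interaction S \<B> An D) (X.PF.emb UNIV {} (space (\<Pi>\<^sub>M i\<in>{}. round_space))) = 1"
    unfolding interaction_def by (subst X.lim) auto
  also have "X.PF.emb UNIV {} (space (\<Pi>\<^sub>M i\<in>{}. round_space)) = space (interaction S \<B> An D)"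
    by (auto simp: interaction_def prod_emb_def space_PiM)
  finally show "prob_space (interaction S \<B> An D)"
    by (rule prob_spaceI)
qed

text \<open>Events about finitely many rounds are handled by the law of those rounds, where the
  potential is at most exp \<B>. Such events form an algebra generating the product, and the
  constant is the same for all of them, so the bound extends to every event.\<close>

lemma interaction_le:
  fixes D D' :: "'d::finite multiset"
  assumes S: "valid_cachedp S" and An: "valid_analyst An" and \<B>: "0 \<le> \<B>"
    and DD': "neighbouring D D'" and X: "X \<in> sets (\<Pi>\<^sub>M i\<in>UNIV. round_space)"
  shows "measure (interaction S \<B> An D) X \<le> exp \<B> * measure (interaction S \<B> An D') X"
proof -
  obtain v where v: "\<And>a. \<bar>query D a - query D' a\<bar> \<le> of_bool (v \<in> a)"
    using neighbouring_query[OF DD'] by blast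
  interpret X: Ionescu_Tulcea "round_kernel S \<B> An D" "\<lambda>_. round_space"
    by (rule Ionescu_Tulcea_round_kernel[OF S An])
  interpret Y: Ionescu_Tulcea "round_kernel S \<B> An D'" "\<lambda>_. round_space"
    by (rule Ionescu_Tulcea_round_kernel[OF S An])
  interpret PX: prob_space "interaction S \<B> An D"
    by (rule prob_space_interaction[OF S An])
  interpret PY: prob_space "interaction S \<B> An D'"
    by (rule prob_space_interaction[OF S An])
  have undef: "(\<lambda>_. undefined) \<in> space (\<Pi>\<^sub>M j\<in>{0..<0::nat}. round_space :: 'd round measure)"
    by (simp add: space_PiM)
  have C_le: "emeasure (X.C 0 n (\<lambda>_. undefined)) A \<le> ennreal (exp \<B>) * emeasure (Y.C 0 n (\<lambda>_. undefined)) A"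
    if A: "A \<in> sets (\<Pi>\<^sub>M j\<in>{0..<n}. round_space)" for n A
  proof -
    have sets: "sets (X.C 0 n (\<lambda>_. undefined)) = sets (\<Pi>\<^sub>M j\<in>{0..<n}. round_space)"
      "sets (Y.C 0 n (\<lambda>_. undefined)) = sets (\<Pi>\<^sub>M j\<in>{0..<n}. round_space)"
      using X.sets_C[OF undef, of n] Y.sets_C[OF undef, of n] by simp_all
    have "1 * (\<integral>\<^sup>+\<omega>. indicator A \<omega> \<partial>X.C 0 n (\<lambda>_. undefined))
        \<le> (\<integral>\<^sup>+\<omega>. indicator A \<omega> * potential \<B> D D' v n (state_before n \<omega>) \<partial>Y.C 0 n (\<lambda>_. undefined))"
      using dominated_rounds[OF S An \<B> v] borel_measurable_indicator[OF A] unfolding dominated_def by blast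
    also have "\<dots> \<le> (\<integral>\<^sup>+\<omega>. ennreal (exp \<B>) * indicator A \<omega> \<partial>Y.C 0 n (\<lambda>_. undefined))"
      by (intro nn_integral_mono) (simp add: potential_le[OF v] split: split_indicator)
    also have "\<dots> = ennreal (exp \<B>) * emeasure (Y.C 0 n (\<lambda>_. undefined)) A"
      using A sets by (intro nn_integral_cmult_indicator) simp
    finally show ?thesis using A sets by simp
  qed
  have gen: "measure (interaction S \<B> An D) A \<le> exp \<B> * measure (interaction S \<B> An D') A"
    if "A \<in> X.PF.generator" for A
    using that
  proof cases
    case (1 J Z)
    \<comment> \<open>A cylinder over \<open>J\<close> is determined by the first \<open>n\<close>
      rounds, and the limit measure gives it the mass it has under their law.\<close>
    define n where "n = X.up_to J"
    have J: "J \<subseteq> {0..<n}" unfolding n_def by (rule X.up_to[OF 1(2)])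
    have "emeasure (interaction S \<B> An D) A = emeasure (X.C 0 n (\<lambda>_. undefined)) (X.PF.emb {0..<n} J Z)"
      unfolding interaction_def 1(1) using 1 J by (simp add: X.lim X.emeasure_CI)
    also have "\<dots> \<le> ennreal (exp \<B>) * emeasure (Y.C 0 n (\<lambda>_. undefined)) (X.PF.emb {0..<n} J Z)"
      using 1 J by (intro C_le measurable_prod_emb)
    also have "emeasure (Y.C 0 n (\<lambda>_. undefined)) (X.PF.emb {0..<n} J Z) = emeasure (interaction S \<B> An D') A"
      unfolding interaction_def 1(1) using 1 J by (simp add: Y.lim Y.emeasure_CI)
    finally show ?thesis
      by (simp add: PX.emeasure_eq_measure PY.emeasure_eq_measure ennreal_mult'[symmetric])
  qed
  have sets: "sets (\<Pi>\<^sub>M i\<in>UNIV. round_space) = sigma_sets (space (\<Pi>\<^sub>M i\<in>UNIV. round_space)) X.PF.generator"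
    by (rule X.PF.sets_PiM_generator)
  show ?thesis
  proof (rule algebra.measure_le_sigma_sets[OF X.PF.algebra_generator])
    show "X \<in> sigma_sets (space (\<Pi>\<^sub>M i\<in>UNIV. round_space)) X.PF.generator"
      using X sets by simp
  qed (use gen sets prob_space_interaction(2)[OF S An] in \<open>auto intro: PX.finite_measure_axioms PY.finite_measure_axioms\<close>)
qed

lemma measurable_responses:
  "(\<lambda>\<omega> i. fst (snd (\<omega> i))) \<in> (\<Pi>\<^sub>M i\<in>UNIV. round_space) \<rightarrow>\<^sub>M transcript_space"
  unfolding transcript_space_def
proof (rule measurable_PiM_single')
  fix i :: nat
  have "(\<lambda>\<omega>. \<omega> i) \<in> (\<Pi>\<^sub>M i\<in>UNIV. round_space) \<rightarrow>\<^sub>M round_space"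
    by (rule measurable_component_singleton) simp
  moreover have "(\<lambda>r. fst (snd r)) \<in> round_space \<rightarrow>\<^sub>M response_space"
    unfolding round_space_def by measurable
  ultimately show "(\<lambda>\<omega>. fst (snd (\<omega> i))) \<in> (\<Pi>\<^sub>M i\<in>UNIV. round_space) \<rightarrow>\<^sub>M response_space"
    by (rule measurable_compose)
qed (simp add: response_space_def space_pair_measure space_PiM)

theorem theorem3p1:
  fixes S :: "'d::finite cachedp" and \<B> :: real and An :: "'d analyst"
  assumes "0 < \<B>"
    and "valid_cachedp S"
    and "valid_analyst An"
  shows "differentially_private \<B> transcript_space (CacheDP S \<B> An)"
  unfolding differentially_private_def
proof (intro conjI allI impI ballI)
  have meas: "(\<lambda>\<omega> i. fst (snd (\<omega> i))) \<in> interaction S \<B> An D \<rightarrow>\<^sub>M transcript_space" for D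
    using measurable_responses prob_space_interaction(2)[OF assms(2,3)]
    by (simp cong: measurable_cong_sets)
  show "CacheDP S \<B> An D \<in> space (prob_algebra transcript_space)" for D
    using prob_space.prob_space_distr[OF prob_space_interaction(1)[OF assms(2,3)] meas]
    by (simp add: CacheDP_def space_prob_algebra)
  fix D D' :: "'d multiset" and X
  assume DD': "neighbouring D D'" and X: "X \<in> sets transcript_space"
  have sp: "space (interaction S \<B> An D) = space (\<Pi>\<^sub>M i\<in>UNIV. round_space)" for D
    by (rule sets_eq_imp_space_eq[OF prob_space_interaction(2)[OF assms(2,3)]])
  \<comment> \<open>Forgetting requests, caches and budgets is post-processing: an event about the
    responses pulls back to an event about the rounds.\<close>
  have "(\<lambda>\<omega> i. fst (snd (\<omega> i))) -` X \<inter> space (\<Pi>\<^sub>M i\<in>UNIV. round_space) \<in> sets (\<Pi>\<^sub>M i\<in>UNIV. round_space)"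
    by (rule measurable_sets[OF measurable_responses X])
  from interaction_le[OF assms(2,3) less_imp_le[OF assms(1)] DD' this]
  show "measure (CacheDP S \<B> An D) X \<le> exp \<B> * measure (CacheDP S \<B> An D') X"
    by (simp add: CacheDP_def measure_distr[OF meas X] sp)
qed

end
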